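(* Let $T_1,\dots,T_N$ be invertible column-stochastic $C\times C$ matrices, $\mathcal{T}=\{T_i\}_{i=1}^N$, and $w\in\Delta^N$. Let $\ell$ be a proper loss such that for all $i\in\{1,\dots,N\}$ and $c\in\mathcal{Y}$ the function $\lambda_{\ell_{T_i}}(\cdot,c)$ is Lipschitz continuous with respect to the $2$-norm. Let $S=\{X_{i,c,j}: 1\le i\le N,\ c\in\mathcal{Y},\ 1\le j\le n_{i,c}\}$ be mutually independent with $X_{i,c,j}\sim P_{T_i}(\cdot\mid c)$. Let $\mathcal{G}_1$ (RKHS class) and $\mathcal{G}_2$ (multilayer perceptron class) be as defined in the context. Assume that for each $q\in\{1,2\}$, $\sup_{x\in\mathcal{X},\,g\in\mathcal{G}_q}\|g(x)\|_2\le A_q$ for some constant $A_q$. Put $$\hat{\mathcal{R}}_{w,S}(g)=\sum_{i=1}^N w_i\sum_{c=1}^C\frac{\alpha_i(c)}{n_{i,c}}\sum_{j=1}^{n_{i,c}}\lambda_{\ell_{T_i}}\left(g(X_{i,c,j}),c\right),\qquad \widetilde{\mathcal{R}}(g)=\widetilde{\mathcal{R}}_{\ell,P,\mathcal{T}}(\psi^{-1}\circ g)=\mathbb{E}_S\left[\hat{\mathcal{R}}_{w,S}(g)\right].$$ Then for each $q\in\{1,2\}$ there is a constant $B_q$ depending only on $\mathcal{G}_q$ such that for every $\delta\in(0,1]$, with probability at least $1-\delta$, $$\sup_{g\in\mathcal{G}_q}\left|\hat{\mathcal{R}}_{w,S}(g)-\widetilde{\mathcal{R}}(g)\right|\le\left(\max_i\left(|\lambda_{\ell_{T_i}}|A_q+|\lambda_{\ell_{T_i}}|_0\right)\sqrt{2\log\tfrac{2}{\delta}}+C\,B_q\max_i|\lambda_{\ell_{T_i}}|\right)\sqrt{\sum_{i=1}^N\sum_{c=1}^C\frac{w_i^2}{n_{i,c}}},$$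 where $|\lambda_{\ell_{T_i}}|_0=\max_c|\lambda_{\ell_{T_i}}(0,c)|$ and $|\lambda_{\ell_{T_i}}|$ is the smallest real number that is a Lipschitz constant of $\lambda_{\ell_{T_i}}(\cdot,c)$ for all $c$.
   Context: $\mathcal{X}$ is a (measurable) feature space, $\mathcal{Y}=\{1,\dots,C\}$, $\Delta^n$ is the probability simplex in $\mathbb{R}^n$, $\mathring\Delta^n$ its interior. $\mathcal{F}$ is the set of measurable functions $\mathcal{X}\to\Delta^C$. $P$ is a probability measure on $\mathcal{X}\times\mathcal{Y}$ (law of $(X,Y)$). For a column-stochastic $T=(t_{i,j})$, $P_T$ is the law of $(X,\tilde Y)$, where $(X,Y,\tilde Y)$ has law $\bar P_T(\mathcal{A}\times\{i\}\times\{j\})=P(\mathcal{A}\times\{i\})\,t_{j,i}$. $\alpha_i\in\mathring\Delta^C$ is given by $\alpha_i(c)=P_{T_i}(\tilde Y=c)$, and $P_{T_i}(\cdot\mid c)$ is the law of $X$ given $\tilde Y=c$ under $P_{T_i}$. The $n_{i,c}$ are positive integers. A loss $\ell:\Delta^C\times\mathcal{Y}\to\mathbb{R}$ is proper if for every $p\in\Delta^C$ the map $q\mapsto\sum_c p_c\ell(q,c)$ attains its minimum over $\Delta^C$ at $q=p$. Forward correction: $\ell_T(q,c)=\ell(Tq,c)$. Risk: $\mathcal{R}_{\ell,P}(f)=\mathbb{E}_P[\ell(f(X),Y)]$; $\widetilde{\mathcal{R}}_{\ell,P,\mathcal{T}}(f)=\sum_{i=1}^N w_i\mathcal{R}_{\ell_{T_i},P_{T_i}}(f)$.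 $\psi:\mathcal{U}\subset\Delta^C\to\mathcal{V}\subset\mathbb{R}^C$ is a fixed invertible link function; the proper composite loss is $\lambda_\ell:\mathcal{V}\times\mathcal{Y}\to\mathbb{R}$, $\lambda_\ell(v,c)=\ell(\psi^{-1}(v),c)$, so $\lambda_{\ell_T}(v,c)=\ell(T\psi^{-1}(v),c)$. All function classes $\mathcal{G}$ considered satisfy $\mathcal{G}\subset\psi\circ\mathcal{F}=\{\psi\circ f: f\in\mathcal{F}\}$ (so $\psi^{-1}\circ g\in\mathcal{F}$ for $g\in\mathcal{G}$). $\mathcal{G}_1$: let $k$ be a symmetric positive definite kernel on $\mathcal{X}$ with RKHS $\mathcal{H}$, bounded by $K$: $\|k(\cdot,x)\|_{\mathcal{H}}\le K$ for all $x$. Let $\mathcal{G}^k_{K,R}$ be the ball of radius $R$ in $\mathcal{H}$. $\mathcal{G}_1=\mathcal{G}^k_{K,R}\times\cdots\times\mathcal{G}^k_{K,R}$ ($C$ copies). $\mathcal{G}_2$: here $\mathcal{X}\subset\mathbb{R}^d$ and there is $\alpha$ with $\|x\|_2\le\alpha$ for all $x\in\mathcal{X}$. Let $\beta>0$ and $\mu:\mathbb{R}\to\mathbb{R}$ be a $1$-Lipschitz activation function. $\mathcal{N}_1=\{x\mapsto\langle x,v\rangle: v\in\mathbb{R}^d,\|v\|_2\le\beta\}$ and, for $m\ge2$, $\mathcal{N}_m=\{x\mapsto\sum_{j=1}^d v_j\mu(f_j(x)): v\in\mathbb{R}^d,\|v\|_1\le\beta, f_j\in\mathcal{N}_{m-1}\}$.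 It is assumed that for every $m\in\mathbb{N}$ the zero function lies in $\mu\circ\mathcal{N}_m=\{\mu\circ h:h\in\mathcal{N}_m\}$. For a fixed depth $m$, $\mathcal{G}_2=\mathcal{N}_m\times\cdots\times\mathcal{N}_m$ ($C$ copies).
   Formalization: For the RKHS class the kernel k is additionally assumed jointly measurable on X×X; without it the supremum need not be measurable and the bound can fail (e.g. k(x,y)=1 if x=y, else 0, on an uncountable X with the countable–cocountable sigma-algebra). *)

theory Defs
  imports "HOL-Probability.Probability"
begin

section \<open>Simplices, column-stochastic matrices, proper losses\<close>

definition prob_simplex :: "(real ^ 'n) set" where
  "prob_simplex = {p. (\<forall>i. 0 \<le> p $ i) \<and> (\<Sum>i\<in>UNIV. p $ i) = 1}"

text \<open>The relative interior; the topological interior in the ambient space is empty.\<close>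

definition prob_simplex_interior :: "(real ^ 'n) set" where
  "prob_simplex_interior = {p. (\<forall>i. 0 < p $ i) \<and> (\<Sum>i\<in>UNIV. p $ i) = 1}"

definition column_stochastic :: "real ^ 'n ^ 'n \<Rightarrow> bool" where
  "column_stochastic T \<longleftrightarrow> (\<forall>i j. 0 \<le> T $ i $ j) \<and> (\<forall>j. (\<Sum>i\<in>UNIV. T $ i $ j) = 1)"

text \<open>Losses are total functions here; only their values on the simplex are ever used.\<close>

definition proper_loss :: "(real ^ 'c \<Rightarrow> 'c \<Rightarrow> real) \<Rightarrow> bool" where
  "proper_loss loss \<longleftrightarrow>
     (\<forall>p\<in>prob_simplex. \<forall>q\<in>prob_simplex.
        (\<Sum>c\<in>UNIV. p $ c * loss p c) \<le> (\<Sum>c\<in>UNIV. p $ c * loss q c))"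

definition forward_correction ::
  "(real ^ 'c \<Rightarrow> 'c \<Rightarrow> real) \<Rightarrow> real ^ 'c ^ 'c \<Rightarrow> real ^ 'c \<Rightarrow> 'c \<Rightarrow> real" where
  "forward_correction loss T q c = loss (T *v q) c"

text \<open>A link function is a bijection \<open>\<psi>\<close> from \<open>U\<close> onto \<open>V\<close>; its inverse is \<open>inv_into U \<psi>\<close>.\<close>

definition composite_loss ::
  "(real ^ 'c) set \<Rightarrow> (real ^ 'c \<Rightarrow> real ^ 'c) \<Rightarrow> (real ^ 'c \<Rightarrow> 'c \<Rightarrow> real) \<Rightarrow> real ^ 'c \<Rightarrow> 'c \<Rightarrow> real"
  where "composite_loss U \<psi> loss v c = loss (inv_into U \<psi> v) c"

definition lip_const :: "(real ^ 'c) set \<Rightarrow> (real ^ 'c \<Rightarrow> 'c \<Rightarrow> real) \<Rightarrow> real" where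
  "lip_const V l = (LEAST L. \<forall>c. L-lipschitz_on V (\<lambda>v. l v c))"

definition zero_const :: "(real ^ 'c \<Rightarrow> 'c::finite \<Rightarrow> real) \<Rightarrow> real" where
  "zero_const l = Max (range (\<lambda>c. \<bar>l 0 c\<bar>))"


section \<open>Label noise\<close>

text \<open>
  The law of \<open>(X, Y, \<tilde>Y)\<close>, grouped as \<open>((x, i), j)\<close>. Rows of \<open>T\<close> are indexed by the noisy label
  and columns by the clean one.
\<close>

definition noisy_triple :: "('x \<times> 'c::finite) measure \<Rightarrow> real ^ 'c ^ 'c \<Rightarrow> (('x \<times> 'c) \<times> 'c) measure"
  where "noisy_triple P T =
    density (P \<Otimes>\<^sub>M count_space UNIV) (\<lambda>((x, i), j). ennreal (T $ j $ i))"

definition noisy_law ::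
  "'x measure \<Rightarrow> ('x \<times> 'c::finite) measure \<Rightarrow> real ^ 'c ^ 'c \<Rightarrow> ('x \<times> 'c) measure" where
  "noisy_law X P T = distr (noisy_triple P T) (X \<Otimes>\<^sub>M count_space UNIV) (\<lambda>((x, i), j). (x, j))"

lemma emeasure_noisy_triple:
  fixes P :: "('x \<times> 'c::finite) measure"
  assumes P: "sets P = sets (X \<Otimes>\<^sub>M count_space UNIV)" and A: "A \<in> sets X"
  shows "emeasure (noisy_triple P T) ((A \<times> {i}) \<times> {j}) = emeasure P (A \<times> {i}) * ennreal (T $ j $ i)"
proof -
  interpret C: sigma_finite_measure "count_space (UNIV :: 'c set)"
    by (rule sigma_finite_measure_count_space_finite) simp
  have Ai: "A \<times> {i} \<in> sets P"
    using A by (simp add: P pair_measureI)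
  have fs: "(\<lambda>p. snd (fst p)) \<in> (P \<Otimes>\<^sub>M count_space UNIV) \<rightarrow>\<^sub>M (count_space UNIV :: 'c measure)"
  proof -
    have "snd \<in> P \<rightarrow>\<^sub>M (count_space UNIV :: 'c measure)"
      using measurable_snd[of X "count_space UNIV :: 'c measure"]
      by (subst measurable_cong_sets[OF P refl])
    with measurable_fst show ?thesis
      by (rule measurable_compose)
  qed
  have "(\<lambda>p. ennreal (T $ snd p $ snd (fst p))) \<in> borel_measurable (P \<Otimes>\<^sub>M count_space UNIV)"
  proof (rule measurable_compose_countable'[OF _ measurable_snd])
    show "(\<lambda>p. ennreal (T $ j $ snd (fst p))) \<in> borel_measurable (P \<Otimes>\<^sub>M count_space UNIV)" for j
      by (rule measurable_compose[OF fs]) (rule borel_measurable_count_space)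
  qed (rule countable_finite, simp)
  then have m: "(\<lambda>((x, i), j). ennreal (T $ j $ i)) \<in> borel_measurable (P \<Otimes>\<^sub>M count_space UNIV)"
    by (simp add: case_prod_beta')
  have "emeasure (noisy_triple P T) ((A \<times> {i}) \<times> {j}) =
      (\<integral>\<^sup>+p. (\<lambda>((x, i), j). ennreal (T $ j $ i)) p * indicator ((A \<times> {i}) \<times> {j}) p
        \<partial>(P \<Otimes>\<^sub>M count_space UNIV))"
    unfolding noisy_triple_def by (intro emeasure_density[OF m] pair_measureI Ai) simp
  also have "\<dots> = (\<integral>\<^sup>+p. ennreal (T $ j $ i) * indicator ((A \<times> {i}) \<times> {j}) p
        \<partial>(P \<Otimes>\<^sub>M count_space UNIV))"
    by (intro nn_integral_cong) (auto split: split_indicator)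
  also have "\<dots> = ennreal (T $ j $ i) * emeasure (P \<Otimes>\<^sub>M count_space UNIV) ((A \<times> {i}) \<times> {j})"
    by (intro nn_integral_cmult_indicator pair_measureI Ai) simp
  also have "emeasure (P \<Otimes>\<^sub>M count_space UNIV) ((A \<times> {i}) \<times> {j}) = emeasure P (A \<times> {i})"
    by (subst C.emeasure_pair_measure_Times[OF Ai]) simp_all
  finally show ?thesis
    by (simp add: mult.commute)
qed

definition class_prior :: "'x measure \<Rightarrow> ('x \<times> 'c::finite) measure \<Rightarrow> real ^ 'c ^ 'c \<Rightarrow> real ^ 'c" where
  "class_prior X P T = (\<chi> c. measure (noisy_law X P T) (space X \<times> {c}))"

text \<open>\<open>uniform_measure M A\<close> is \<open>M\<close> conditioned on the event \<open>A\<close>.\<close>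

definition class_conditional ::
  "'x measure \<Rightarrow> ('x \<times> 'c::finite) measure \<Rightarrow> real ^ 'c ^ 'c \<Rightarrow> 'c \<Rightarrow> 'x measure" where
  "class_conditional X P T c = distr (uniform_measure (noisy_law X P T) (space X \<times> {c})) X fst"


section \<open>Risks\<close>

definition risk ::
  "(real ^ 'c \<Rightarrow> 'c \<Rightarrow> real) \<Rightarrow> ('x \<times> 'c::finite) measure \<Rightarrow> ('x \<Rightarrow> real ^ 'c) \<Rightarrow> real" where
  "risk loss P f = (\<integral>z. loss (f (fst z)) (snd z) \<partial>P)"

definition corrected_risk ::
  "'x measure \<Rightarrow> (real ^ 'c \<Rightarrow> 'c \<Rightarrow> real) \<Rightarrow> ('x \<times> 'c::finite) measure \<Rightarrow>
   nat \<Rightarrow> (nat \<Rightarrow> real) \<Rightarrow> (nat \<Rightarrow> real ^ 'c ^ 'c) \<Rightarrow> ('x \<Rightarrow> real ^ 'c) \<Rightarrow> real" where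
  "corrected_risk X loss P N w T f =
     (\<Sum>i=1..N. w i * risk (forward_correction loss (T i)) (noisy_law X P (T i)) f)"

text \<open>Here \<open>s i c j\<close> is the realised sample point with indices \<open>(i, c, j)\<close>.\<close>

definition empirical_risk ::
  "'x measure \<Rightarrow> (real ^ 'c) set \<Rightarrow> (real ^ 'c \<Rightarrow> real ^ 'c) \<Rightarrow> (real ^ 'c \<Rightarrow> 'c \<Rightarrow> real) \<Rightarrow>
   ('x \<times> 'c::finite) measure \<Rightarrow> nat \<Rightarrow> (nat \<Rightarrow> real) \<Rightarrow> (nat \<Rightarrow> real ^ 'c ^ 'c) \<Rightarrow>
   (nat \<Rightarrow> 'c \<Rightarrow> nat) \<Rightarrow> (nat \<Rightarrow> 'c \<Rightarrow> nat \<Rightarrow> 'x) \<Rightarrow> ('x \<Rightarrow> real ^ 'c) \<Rightarrow> real" where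
  "empirical_risk X U \<psi> loss P N w T n s g =
     (\<Sum>i=1..N. w i * (\<Sum>c\<in>UNIV. class_prior X P (T i) $ c / real (n i c) *
        (\<Sum>j=1..n i c. composite_loss U \<psi> (forward_correction loss (T i)) (g (s i c j)) c)))"


section \<open>Standing assumptions\<close>

text \<open>
  \<open>X\<close> serves only as a measurable space. A predictor is a total function of which only the
  restriction to \<open>space X\<close> matters.
\<close>

definition predictors :: "'x measure \<Rightarrow> ('x \<Rightarrow> real ^ 'c::finite) set" where
  "predictors X = {f \<in> borel_measurable X. \<forall>x\<in>space X. f x \<in> prob_simplex}"

definition linked_predictors ::
  "'x measure \<Rightarrow> (real ^ 'c) set \<Rightarrow> (real ^ 'c \<Rightarrow> real ^ 'c) \<Rightarrow> ('x \<Rightarrow> real ^ 'c::finite) set" where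
  "linked_predictors X U \<psi> =
     {g. \<exists>f\<in>predictors X. \<forall>x\<in>space X. f x \<in> U \<and> g x = \<psi> (f x)}"

locale noisy_label_model =
  fixes X :: "'x measure"
    and P :: "('x \<times> 'c::finite) measure"
    and N :: nat
    and T :: "nat \<Rightarrow> real ^ 'c ^ 'c"
    and w :: "nat \<Rightarrow> real"
    and loss :: "real ^ 'c \<Rightarrow> 'c \<Rightarrow> real"
    and U V :: "(real ^ 'c) set"
    and \<psi> :: "real ^ 'c \<Rightarrow> real ^ 'c"
  assumes prob_space_P: "prob_space P"
    and sets_P: "sets P = sets (X \<Otimes>\<^sub>M count_space UNIV)"
    and T_stochastic: "i \<in> {1..N} \<Longrightarrow> column_stochastic (T i)"
    and T_invertible: "i \<in> {1..N} \<Longrightarrow> invertible (T i)"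
    and w_nonneg: "i \<in> {1..N} \<Longrightarrow> 0 \<le> w i"
    and w_sum: "(\<Sum>i=1..N. w i) = 1"
    and prior_interior: "i \<in> {1..N} \<Longrightarrow> class_prior X P (T i) \<in> prob_simplex_interior"
    and loss_proper: "proper_loss loss"
    and U_subset: "U \<subseteq> prob_simplex"
    and link_bij: "bij_betw \<psi> U V"
    and composite_lipschitz: "i \<in> {1..N} \<Longrightarrow>
      \<exists>L. L-lipschitz_on V (\<lambda>v. composite_loss U \<psi> (forward_correction loss (T i)) v c)"

locale noisy_label_sample = noisy_label_model X P N T w loss U V \<psi> + prob_space M
  for X :: "'x measure"
    and P :: "('x \<times> 'c::finite) measure"
    and N :: nat
    and T :: "nat \<Rightarrow> real ^ 'c ^ 'c"
    and w :: "nat \<Rightarrow> real"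
    and loss :: "real ^ 'c \<Rightarrow> 'c \<Rightarrow> real"
    and U V :: "(real ^ 'c) set"
    and \<psi> :: "real ^ 'c \<Rightarrow> real ^ 'c"
    and M :: "'w measure" +
  fixes n :: "nat \<Rightarrow> 'c \<Rightarrow> nat"
    and S :: "nat \<Rightarrow> 'c \<Rightarrow> nat \<Rightarrow> 'w \<Rightarrow> 'x"
  assumes n_pos: "i \<in> {1..N} \<Longrightarrow> 0 < n i c"
    and S_indep: "indep_vars (\<lambda>_. X) (\<lambda>(i, c, j). S i c j) {(i, c, j). i \<in> {1..N} \<and> j \<in> {1..n i c}}"
    and S_distr: "i \<in> {1..N} \<Longrightarrow> j \<in> {1..n i c} \<Longrightarrow>
      distr M X (S i c j) = class_conditional X P (T i) c"

text \<open>
  A supremum over an uncountable class need not be measurable, so ``with probability at least \<open>p\<close>''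
  asks for a measurable event of that probability inside the given one. For measurable events this
  is the plain probability.
\<close>

definition with_prob_at_least :: "'w measure \<Rightarrow> real \<Rightarrow> ('w \<Rightarrow> bool) \<Rightarrow> bool" where
  "with_prob_at_least M p Q \<longleftrightarrow> (\<exists>E\<in>sets M. p \<le> measure M E \<and> (\<forall>\<omega>\<in>E. Q \<omega>))"

lemma (in prob_space) with_prob_at_least_iff:
  assumes "{\<omega> \<in> space M. Q \<omega>} \<in> sets M"
  shows "with_prob_at_least M p Q \<longleftrightarrow> p \<le> prob {\<omega> \<in> space M. Q \<omega>}"
proof
  assume "with_prob_at_least M p Q"
  then obtain E where E: "E \<in> sets M" "p \<le> prob E" "\<forall>\<omega>\<in>E. Q \<omega>"
    by (auto simp: with_prob_at_least_def)
  then have "E \<subseteq> {\<omega> \<in> space M. Q \<omega>}"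
    using sets.sets_into_space[OF E(1)] by blast
  then show "p \<le> prob {\<omega> \<in> space M. Q \<omega>}"
    by (rule order_trans[OF E(2) finite_measure_mono[OF _ assms]])
next
  assume "p \<le> prob {\<omega> \<in> space M. Q \<omega>}"
  then show "with_prob_at_least M p Q"
    unfolding with_prob_at_least_def by (intro bexI[OF _ assms]) simp
qed

section \<open>Reproducing kernel Hilbert spaces\<close>

text \<open>
  Functions on a set \<open>D\<close> are represented by total functions vanishing outside \<open>D\<close>, so that
  equality is equality on \<open>D\<close>. The Hilbert space is a set \<open>H\<close> of such functions together
  with an inner product \<open>ip\<close>.
\<close>

definition fun_norm :: "(('x \<Rightarrow> real) \<Rightarrow> ('x \<Rightarrow> real) \<Rightarrow> real) \<Rightarrow> ('x \<Rightarrow> real) \<Rightarrow> real" where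
  "fun_norm ip f = sqrt (ip f f)"

definition kernel_section :: "'x set \<Rightarrow> ('x \<Rightarrow> 'x \<Rightarrow> real) \<Rightarrow> 'x \<Rightarrow> 'x \<Rightarrow> real" where
  "kernel_section D k x = (\<lambda>y. if y \<in> D then k y x else 0)"

definition pos_def_kernel :: "'x set \<Rightarrow> ('x \<Rightarrow> 'x \<Rightarrow> real) \<Rightarrow> bool" where
  "pos_def_kernel D k \<longleftrightarrow>
     (\<forall>x\<in>D. \<forall>y\<in>D. k x y = k y x) \<and>
     (\<forall>F a. finite F \<and> F \<subseteq> D \<longrightarrow> 0 \<le> (\<Sum>x\<in>F. \<Sum>y\<in>F. a x * a y * k x y))"

locale hilbert_function_space =
  fixes D :: "'x set"
    and H :: "('x \<Rightarrow> real) set"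
    and ip :: "('x \<Rightarrow> real) \<Rightarrow> ('x \<Rightarrow> real) \<Rightarrow> real"
  assumes vanish: "f \<in> H \<Longrightarrow> x \<notin> D \<Longrightarrow> f x = 0"
    and zero_mem: "(\<lambda>_. 0) \<in> H"
    and add_mem: "f \<in> H \<Longrightarrow> g \<in> H \<Longrightarrow> (\<lambda>x. f x + g x) \<in> H"
    and scale_mem: "f \<in> H \<Longrightarrow> (\<lambda>x. a * f x) \<in> H"
    and ip_commute: "f \<in> H \<Longrightarrow> g \<in> H \<Longrightarrow> ip f g = ip g f"
    and ip_add: "f \<in> H \<Longrightarrow> g \<in> H \<Longrightarrow> h \<in> H \<Longrightarrow> ip (\<lambda>x. f x + g x) h = ip f h + ip g h"
    and ip_scale: "f \<in> H \<Longrightarrow> g \<in> H \<Longrightarrow> ip (\<lambda>x. a * f x) g = a * ip f g"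
    and ip_nonneg: "f \<in> H \<Longrightarrow> 0 \<le> ip f f"
    and ip_definite: "f \<in> H \<Longrightarrow> ip f f = 0 \<Longrightarrow> f = (\<lambda>_. 0)"
    and complete: "(\<And>m. s m \<in> H) \<Longrightarrow>
      (\<And>e. 0 < e \<Longrightarrow> \<exists>m0. \<forall>m\<ge>m0. \<forall>m'\<ge>m0. fun_norm ip (\<lambda>x. s m x - s m' x) < e) \<Longrightarrow>
      \<exists>f\<in>H. (\<lambda>m. fun_norm ip (\<lambda>x. s m x - f x)) \<longlonglongrightarrow> 0"

locale rkhs = hilbert_function_space D H ip
  for D :: "'x set" and k :: "'x \<Rightarrow> 'x \<Rightarrow> real"
    and H :: "('x \<Rightarrow> real) set" and ip :: "('x \<Rightarrow> real) \<Rightarrow> ('x \<Rightarrow> real) \<Rightarrow> real" +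
  assumes kernel: "pos_def_kernel D k"
    and section_mem: "x \<in> D \<Longrightarrow> kernel_section D k x \<in> H"
    and reproducing: "f \<in> H \<Longrightarrow> x \<in> D \<Longrightarrow> ip f (kernel_section D k x) = f x"

definition rkhs_ball ::
  "('x \<Rightarrow> real) set \<Rightarrow> (('x \<Rightarrow> real) \<Rightarrow> ('x \<Rightarrow> real) \<Rightarrow> real) \<Rightarrow> real \<Rightarrow> ('x \<Rightarrow> real) set" where
  "rkhs_ball H ip R = {f \<in> H. fun_norm ip f \<le> R}"


section \<open>Multilayer perceptrons\<close>

text \<open>Layers are counted from 1; the value at 0 is a dummy.\<close>

fun mlp :: "real \<Rightarrow> (real \<Rightarrow> real) \<Rightarrow> nat \<Rightarrow> (real ^ 'd \<Rightarrow> real) set" where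
  "mlp \<beta> \<mu> 0 = {}"
| "mlp \<beta> \<mu> (Suc 0) = {(\<lambda>x. x \<bullet> v) | v. norm v \<le> \<beta>}"
| "mlp \<beta> \<mu> (Suc (Suc m)) =
     {(\<lambda>x. \<Sum>j\<in>UNIV. v $ j * \<mu> (f j x)) | (v :: real ^ 'd) (f :: 'd \<Rightarrow> real ^ 'd \<Rightarrow> real).
        (\<Sum>j\<in>UNIV. \<bar>v $ j\<bar>) \<le> \<beta> \<and> (\<forall>j. f j \<in> mlp \<beta> \<mu> (Suc m))}"


section \<open>Vector-valued classes and the bound\<close>

definition copies :: "('x \<Rightarrow> real) set \<Rightarrow> ('x \<Rightarrow> real ^ 'c::finite) set" where
  "copies F = {g. \<forall>c. (\<lambda>x. g x $ c) \<in> F}"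

definition deviation_bound ::
  "(real ^ 'c) set \<Rightarrow> (real ^ 'c) set \<Rightarrow> (real ^ 'c \<Rightarrow> real ^ 'c) \<Rightarrow> (real ^ 'c \<Rightarrow> 'c::finite \<Rightarrow> real) \<Rightarrow>
   nat \<Rightarrow> (nat \<Rightarrow> real) \<Rightarrow> (nat \<Rightarrow> real ^ 'c ^ 'c) \<Rightarrow> (nat \<Rightarrow> 'c \<Rightarrow> nat) \<Rightarrow>
   real \<Rightarrow> real \<Rightarrow> real \<Rightarrow> real" where
  "deviation_bound U V \<psi> loss N w T n A B \<delta> =
     (let l = (\<lambda>i. composite_loss U \<psi> (forward_correction loss (T i))) in
      (Max ((\<lambda>i. lip_const V (l i) * A + zero_const (l i)) ` {1..N}) * sqrt (2 * ln (2 / \<delta>))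
        + real CARD('c) * B * Max ((\<lambda>i. lip_const V (l i)) ` {1..N}))
      * sqrt (\<Sum>i=1..N. \<Sum>c\<in>UNIV. (w i)\<^sup>2 / real (n i c)))"

end

theory Submission
  imports Defs
begin

text \<open>
  The supremum of the deviations over the class changes by at most twice the weighted maximal loss
  when one sample point changes, so McDiarmid's inequality concentrates it around its mean; the
  mean is bounded by symmetrisation, contraction (the composite losses are Lipschitz) and a bound
  on the Rademacher averages of the scalar class that holds at every sample: Cauchy-Schwarz in the
  RKHS, and peeling off one layer at a time for the perceptrons.

  Measurability of the supremum needs care, since the RKHS may be non-separable. The risk only
  depends on the part of a function orthogonal to the almost everywhere vanishing ones, which lives
  in a separable subspace, and the sample values only depend on the projection to the span of the
  kernel sections at the sample. Hence the supremum is determined by a countable family of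
  functions that depend measurably on the sample, and the symmetrisation argument is carried out
  for such families.
\<close>

section \<open>Rademacher averages\<close>

text \<open>The supremum over the whole class is never integrated: it occurs only in bounds that
  hold at each fixed sample, while every integral is taken of a supremum over a countable family.
  The price is that this family moves with the sample. Changing one sample point changes the
  functions too, which is harmless because every selected function still belongs to the class and is
  again approximated at the new sample. Exchanging sample and ghost sample destroys the symmetry of
  the selection, so each half is bounded separately by the supremum over the class.

  Constants: if the scalar class has Rademacher averages at most b times the 2-norm of the weights,
  then B = 4 C b. One factor 2 comes from symmetrisation and one from removing absolute values. Of
  the two factors C, one is the cost of contraction to a single coordinate per sample point and the
  other counts the coordinates over which the sum is then split; one is explicit in the bound, the
  other is part of B. The margin in McDiarmid's inequality leads to the tail \<delta>/2, which lies
  within the permitted \<delta>.\<close>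

definition rsign :: "'t set \<Rightarrow> 't \<Rightarrow> real" where
  "rsign A t = (if t \<in> A then 1 else -1)"

text \<open>A sign vector is encoded as the set of indices with sign +1, so the expectation over
  independent uniform signs is a finite average. There is no normalisation by the number of indices:
  the sample weights sit inside \<open>\<xi>\<close>.\<close>

definition rademacher :: "'t set \<Rightarrow> 'g set \<Rightarrow> ('t \<Rightarrow> 'g \<Rightarrow> real) \<Rightarrow> real" where
  "rademacher I G \<xi> = (\<Sum>A\<in>Pow I. SUP g\<in>G. \<Sum>t\<in>I. rsign A t * \<xi> t g) / 2 ^ card I"

lemma rsign_complement: "t \<in> I \<Longrightarrow> rsign (I - A) t = - rsign A t"
  by (simp add: rsign_def)

lemma sum_Pow_split:
  assumes "finite I" "t \<in> I"
  shows "(\<Sum>A\<in>Pow I. f A) = (\<Sum>A\<in>Pow (I - {t}). f A + f (insert t A))"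
proof -
  have I: "I = insert t (I - {t})" using assms by auto
  have inj: "inj_on (insert t) (Pow (I - {t}))"
    by (intro inj_onI) auto
  have "sum f (Pow I) = sum f (Pow (I - {t}) \<union> insert t ` Pow (I - {t}))"
    by (subst I, subst Pow_insert) simp
  also have "\<dots> = sum f (Pow (I - {t})) + sum f (insert t ` Pow (I - {t}))"
    using assms by (intro sum.union_disjoint) auto
  also have "sum f (insert t ` Pow (I - {t})) = (\<Sum>A\<in>Pow (I - {t}). f (insert t A))"
    by (simp add: sum.reindex[OF inj])
  finally show ?thesis by (simp add: sum.distrib)
qed

lemma sum_Pow_complement: "(\<Sum>A\<in>Pow I. f (I - A)) = (\<Sum>A\<in>Pow I. f A)"
  by (rule sum.reindex_bij_witness[of _ "\<lambda>A. I - A" "\<lambda>A. I - A"]) (auto simp: double_diff)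

text \<open>Orthogonality of the signs: toggling membership of t flips the product when s differs
  from t, so the patterns cancel in pairs.\<close>

lemma sum_rsign_rsign:
  assumes "finite I" "s \<in> I" "t \<in> I"
  shows "(\<Sum>A\<in>Pow I. rsign A s * rsign A t) = (if s = t then 2 ^ card I else 0)"
proof (cases "s = t")
  case True
  have "rsign A t * rsign A t = 1" for A
    by (simp add: rsign_def)
  then show ?thesis using True assms by (simp add: card_Pow)
next
  case False
  have "(\<Sum>A\<in>Pow I. rsign A s * rsign A t) =
      (\<Sum>A\<in>Pow (I - {t}). rsign A s * rsign A t + rsign (insert t A) s * rsign (insert t A) t)"
    by (rule sum_Pow_split[OF assms(1,3)])
  also have "\<dots> = 0"
    using False by (intro sum.neutral) (auto simp: rsign_def)
  finally show ?thesis using False by simp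
qed

text \<open>For a Gram matrix m the left side is the mean squared norm of a randomly signed sum of
  vectors; by orthogonality only the diagonal survives.\<close>

lemma rademacher_quadratic:
  assumes "finite I"
  shows "(\<Sum>A\<in>Pow I. \<Sum>s\<in>I. \<Sum>t\<in>I. rsign A s * rsign A t * m s t) / 2 ^ card I = (\<Sum>t\<in>I. m t t)"
proof -
  have "(\<Sum>A\<in>Pow I. \<Sum>s\<in>I. \<Sum>t\<in>I. rsign A s * rsign A t * m s t) =
     (\<Sum>s\<in>I. \<Sum>t\<in>I. (\<Sum>A\<in>Pow I. rsign A s * rsign A t) * m s t)"
    by (subst sum.swap, rule sum.cong[OF refl], subst sum.swap) (simp add: sum_distrib_right)
  also have "\<dots> = (\<Sum>s\<in>I. \<Sum>t\<in>I. (if s = t then 2 ^ card I else 0) * m s t)"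
    by (intro sum.cong refl) (simp add: sum_rsign_rsign assms)
  also have "\<dots> = (\<Sum>s\<in>I. 2 ^ card I * m s s)"
    by (intro sum.cong refl) (simp add: if_distrib[where f="\<lambda>x. x * _"] assms cong: if_cong)
  finally show ?thesis by (simp flip: sum_distrib_left)
qed

text \<open>Jensen's inequality for the concave square root, obtained as Cauchy-Schwarz against the
  constant 1.\<close>

lemma rademacher_mean_sqrt:
  assumes "finite I" and "\<And>A. A \<in> Pow I \<Longrightarrow> 0 \<le> f A"
  shows "(\<Sum>A\<in>Pow I. sqrt (f A)) / 2 ^ card I \<le> sqrt ((\<Sum>A\<in>Pow I. f A) / 2 ^ card I)"
proof (rule real_le_rsqrt)
  have "(\<Sum>A\<in>Pow I. sqrt (f A))\<^sup>2 \<le> (\<Sum>A\<in>Pow I. (sqrt (f A))\<^sup>2) * (\<Sum>A\<in>Pow I. 1\<^sup>2)"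
    using Cauchy_Schwarz_ineq_sum[of "\<lambda>A. sqrt (f A)" "\<lambda>_. 1" "Pow I"] by simp
  also have "(\<Sum>A\<in>Pow I. (sqrt (f A))\<^sup>2) = (\<Sum>A\<in>Pow I. f A)"
    using assms by (intro sum.cong) auto
  finally have "(\<Sum>A\<in>Pow I. sqrt (f A))\<^sup>2 \<le> (\<Sum>A\<in>Pow I. f A) * 2 ^ card I"
    using assms(1) by (simp add: card_Pow)
  then show "((\<Sum>A\<in>Pow I. sqrt (f A)) / 2 ^ card I)\<^sup>2 \<le> (\<Sum>A\<in>Pow I. f A) / 2 ^ card I"
    by (simp add: power_divide divide_simps power2_eq_square)
qed

text \<open>Jensen's inequality and orthogonality of the signs, for any class whose suprema are
  controlled by a norm coming from the kernel \<open>m\<close>.\<close>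

lemma rademacher_le_quadratic:
  assumes I: "finite I" and G: "G \<noteq> {}" and b: "0 \<le> b"
    and nonneg: "\<And>A. 0 \<le> (\<Sum>s\<in>I. \<Sum>t\<in>I. rsign A s * rsign A t * m s t)"
    and le: "\<And>A g. g \<in> G \<Longrightarrow> (\<Sum>t\<in>I. rsign A t * \<xi> t g) \<le>
       b * sqrt (\<Sum>s\<in>I. \<Sum>t\<in>I. rsign A s * rsign A t * m s t)"
  shows "rademacher I G \<xi> \<le> b * sqrt (\<Sum>t\<in>I. m t t)"
proof -
  let ?q = "\<lambda>A. \<Sum>s\<in>I. \<Sum>t\<in>I. rsign A s * rsign A t * m s t"
  have "rademacher I G \<xi> \<le> (\<Sum>A\<in>Pow I. b * sqrt (?q A)) / 2 ^ card I"
    unfolding rademacher_def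
    by (intro divide_right_mono sum_mono cSUP_least[OF G] le) auto
  also have "\<dots> = b * ((\<Sum>A\<in>Pow I. sqrt (?q A)) / 2 ^ card I)"
    by (simp add: sum_distrib_left)
  also have "\<dots> \<le> b * sqrt ((\<Sum>A\<in>Pow I. ?q A) / 2 ^ card I)"
    by (intro mult_left_mono b rademacher_mean_sqrt I nonneg)
  finally show ?thesis
    by (simp add: rademacher_quadratic[OF I])
qed

section \<open>Suprema over bounded classes and the contraction principle\<close>

lemma cSUP_add_le:
  fixes f h :: "'g \<Rightarrow> real"
  assumes G: "G \<noteq> {}" and le: "\<And>g g'. g \<in> G \<Longrightarrow> g' \<in> G \<Longrightarrow> f g + h g' \<le> q"
  shows "(SUP g\<in>G. f g) + (SUP g\<in>G. h g) \<le> q"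
proof -
  have "(SUP g\<in>G. f g) \<le> q - (SUP g\<in>G. h g)"
  proof (rule cSUP_least[OF G])
    fix g assume g: "g \<in> G"
    have "(SUP g\<in>G. h g) \<le> q - f g"
      using le[OF g] by (intro cSUP_least[OF G]) (simp add: algebra_simps)
    then show "f g \<le> q - (SUP g\<in>G. h g)" by simp
  qed
  then show ?thesis by simp
qed

text \<open>A real \<open>SUP\<close> is informative only for a nonempty family bounded above. The
  two-sided form is stable under negation and under scaling by either sign, so this side condition
  can be derived term by term.\<close>

definition bounded_on :: "'g set \<Rightarrow> ('g \<Rightarrow> real) \<Rightarrow> bool" where
  "bounded_on G f \<longleftrightarrow> (\<exists>b. \<forall>g\<in>G. \<bar>f g\<bar> \<le> b)"

lemma bounded_onI: "(\<And>g. g \<in> G \<Longrightarrow> \<bar>f g\<bar> \<le> b) \<Longrightarrow> bounded_on G f"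
  by (auto simp: bounded_on_def)

lemma bounded_on_add:
  "bounded_on G f \<Longrightarrow> bounded_on G h \<Longrightarrow> bounded_on G (\<lambda>g. f g + h g)"
  unfolding bounded_on_def by (meson abs_triangle_ineq add_mono order_trans)

lemma bounded_on_cmult: "bounded_on G f \<Longrightarrow> bounded_on G (\<lambda>g. c * f g)"
  unfolding bounded_on_def abs_mult by (meson abs_ge_zero mult_left_mono)

lemma bounded_on_sum:
  "(\<And>t. t \<in> I \<Longrightarrow> bounded_on G (f t)) \<Longrightarrow> bounded_on G (\<lambda>g. \<Sum>t\<in>I. f t g)"
proof (induction I rule: infinite_finite_induct)
  case (insert x F)
  then show ?case using bounded_on_add[of G "f x" "\<lambda>g. \<Sum>t\<in>F. f t g"] by simp
qed (auto intro: bounded_onI[of _ _ 0])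

lemma bounded_on_uminus: "bounded_on G f \<Longrightarrow> bounded_on G (\<lambda>g. - f g)"
  by (simp add: bounded_on_def)

lemma bounded_on_diff:
  "bounded_on G f \<Longrightarrow> bounded_on G h \<Longrightarrow> bounded_on G (\<lambda>g. f g - h g)"
  using bounded_on_add[of G f "\<lambda>g. - h g"] bounded_on_uminus[of G h] by simp

lemma bounded_on_bdd_above: "bounded_on G f \<Longrightarrow> bdd_above (f ` G)"
  by (force simp: bounded_on_def dest: abs_le_D1 intro: bdd_aboveI2)

lemma bounded_on_bdd_above_abs: "bounded_on G f \<Longrightarrow> bdd_above ((\<lambda>g. \<bar>f g\<bar>) ` G)"
  by (force simp: bounded_on_def intro: bdd_aboveI2)

lemma bounded_on_signed_sum:
  "(\<And>t. t \<in> I \<Longrightarrow> bounded_on G (\<xi> t)) \<Longrightarrow> bounded_on G (\<lambda>g. \<Sum>t\<in>I. rsign A t * \<xi> t g)"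
  by (intro bounded_on_sum bounded_on_cmult)

text \<open>The two values of one sign, with \<open>a\<close> collecting the terms of all other
  signs. The Lipschitz bound by an l1 sum is rewritten as an average over K, which produces the
  factor \<open>card K\<close>; within each coordinate the absolute value is resolved by assigning
  the two suprema to g and g'.\<close>

lemma contraction_pair:
  fixes a \<phi> :: "'g \<Rightarrow> real" and v :: "'k \<Rightarrow> 'g \<Rightarrow> real"
  assumes G: "G \<noteq> {}" and K: "finite K" "K \<noteq> {}"
    and a: "bounded_on G a" and v: "\<And>c. c \<in> K \<Longrightarrow> bounded_on G (v c)"
    and lip: "\<And>g g'. g \<in> G \<Longrightarrow> g' \<in> G \<Longrightarrow> \<bar>\<phi> g - \<phi> g'\<bar> \<le> (\<Sum>c\<in>K. \<bar>v c g - v c g'\<bar>)"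
  shows "(SUP g\<in>G. a g - \<phi> g) + (SUP g\<in>G. a g + \<phi> g) \<le>
    (\<Sum>c\<in>K. (SUP g\<in>G. a g - card K * v c g) + (SUP g\<in>G. a g + card K * v c g)) / card K"
proof (rule cSUP_add_le[OF G])
  fix g g' assume g: "g \<in> G" and g': "g' \<in> G"
  let ?k = "real (card K)"
  have k: "0 < ?k" using K by (simp add: card_gt_0_iff)
  have "a g - \<phi> g + (a g' + \<phi> g') \<le> a g + a g' + (\<Sum>c\<in>K. \<bar>v c g - v c g'\<bar>)"
    using lip[OF g g'] by simp
  also have "\<dots> = (\<Sum>c\<in>K. a g + a g' + ?k * \<bar>v c g - v c g'\<bar>) / ?k"
    using k by (simp add: sum.distrib sum_distrib_left[symmetric] field_simps)
  also have "\<dots> \<le> (\<Sum>c\<in>K. (SUP g\<in>G. a g - ?k * v c g) + (SUP g\<in>G. a g + ?k * v c g)) / ?k"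
  proof (intro divide_right_mono sum_mono)
    fix c assume c: "c \<in> K"
    have up: "a h + ?k * v c h \<le> (SUP g\<in>G. a g + ?k * v c g)"
      and dn: "a h - ?k * v c h \<le> (SUP g\<in>G. a g - ?k * v c g)" if "h \<in> G" for h
      using that a v[OF c]
      by (auto intro!: cSUP_upper bounded_on_bdd_above bounded_on_add bounded_on_diff bounded_on_cmult)
    \<comment> \<open>The part \<open>a g + a g'\<close> is symmetric, so whichever of g, g' has the
      larger coordinate is placed in the supremum with the plus sign and the other one in the
      supremum with the minus sign.\<close>
    show "a g + a g' + ?k * \<bar>v c g - v c g'\<bar>
        \<le> (SUP g\<in>G. a g - ?k * v c g) + (SUP g\<in>G. a g + ?k * v c g)"
      using up[OF g] dn[OF g] up[OF g'] dn[OF g'] by (cases "v c g \<le> v c g'") (simp_all add: algebra_simps)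
  qed simp
  finally show "a g - \<phi> g + (a g' + \<phi> g') \<le>
      (\<Sum>c\<in>K. (SUP g\<in>G. a g - ?k * v c g) + (SUP g\<in>G. a g + ?k * v c g)) / ?k" .
qed

text \<open>\<open>contraction_pair\<close> bounds the average by a mean over the coordinates c, and
  some c is at least as good as the mean. The choice is made after summing over all sign patterns; a
  c depending on the pattern would not leave a Rademacher average.\<close>

lemma rademacher_contraction_step:
  fixes v :: "'k \<Rightarrow> 'g \<Rightarrow> real"
  assumes I: "finite I" "t \<in> I" and G: "G \<noteq> {}" and K: "finite K" "K \<noteq> {}"
    and \<xi>: "\<And>s. s \<in> I \<Longrightarrow> bounded_on G (\<xi> s)" and v: "\<And>c. c \<in> K \<Longrightarrow> bounded_on G (v c)"
    and lip: "\<And>g g'. g \<in> G \<Longrightarrow> g' \<in> G \<Longrightarrow> \<bar>\<xi> t g - \<xi> t g'\<bar> \<le> (\<Sum>c\<in>K. \<bar>v c g - v c g'\<bar>)"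
  shows "\<exists>c\<in>K. rademacher I G \<xi> \<le> rademacher I G (\<xi>(t := \<lambda>g. card K * v c g))"
proof -
  let ?J = "I - {t}" and ?k = "real (card K)"
  define a where "a A g = (\<Sum>s\<in>?J. rsign A s * \<xi> s g)" for A g
  define S where "S \<phi> A = (SUP g\<in>G. a A g - \<phi> g) + (SUP g\<in>G. a A g + \<phi> g)" for \<phi> A
  have rad: "rademacher I G (\<xi>(t := \<phi>)) = (\<Sum>A\<in>Pow ?J. S \<phi> A) / 2 ^ card I" for \<phi>
  proof -
    have spl: "(\<Sum>s\<in>I. rsign A s * (\<xi>(t := \<phi>)) s g) =
        rsign A t * \<phi> g + (\<Sum>s\<in>?J. rsign A s * \<xi> s g)" for A g
      using I by (simp add: sum.remove[of I t])
    have ins: "(\<Sum>s\<in>?J. rsign (insert t A) s * \<xi> s g) = (\<Sum>s\<in>?J. rsign A s * \<xi> s g)" for A g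
      by (intro sum.cong) (auto simp: rsign_def)
    have "(\<Sum>A\<in>Pow I. SUP g\<in>G. \<Sum>s\<in>I. rsign A s * (\<xi>(t := \<phi>)) s g) = (\<Sum>A\<in>Pow ?J. S \<phi> A)"
      unfolding sum_Pow_split[OF I]
    proof (intro sum.cong refl)
      fix A assume "A \<in> Pow ?J"
      then have "rsign A t = -1" "rsign (insert t A) t = 1" by (auto simp: rsign_def)
      then show "(SUP g\<in>G. \<Sum>s\<in>I. rsign A s * (\<xi>(t := \<phi>)) s g) +
          (SUP g\<in>G. \<Sum>s\<in>I. rsign (insert t A) s * (\<xi>(t := \<phi>)) s g) = S \<phi> A"
        unfolding spl ins by (simp add: S_def a_def add.commute)
    qed
    then show ?thesis by (simp add: rademacher_def)
  qed
  have "rademacher I G \<xi> = (\<Sum>A\<in>Pow ?J. S (\<xi> t) A) / 2 ^ card I"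
    using rad[of "\<xi> t"] by simp
  also have "\<dots> \<le> (\<Sum>A\<in>Pow ?J. (\<Sum>c\<in>K. S (\<lambda>g. ?k * v c g) A) / ?k) / 2 ^ card I"
    unfolding S_def using \<xi>
    by (intro divide_right_mono sum_mono contraction_pair[OF G K _ v lip])
       (auto simp: a_def intro!: bounded_on_signed_sum)
  also have "\<dots> = (\<Sum>c\<in>K. rademacher I G (\<xi>(t := \<lambda>g. ?k * v c g))) / ?k"
    unfolding rad by (simp add: sum_divide_distrib[symmetric]) (subst sum.swap, simp add: mult.commute)
  finally have le: "rademacher I G \<xi> \<le> (\<Sum>c\<in>K. rademacher I G (\<xi>(t := \<lambda>g. ?k * v c g))) / ?k" .
  show ?thesis
  proof (rule ccontr)
    assume "\<not> ?thesis"
    then have "(\<Sum>c\<in>K. rademacher I G (\<xi>(t := \<lambda>g. ?k * v c g))) < (\<Sum>c\<in>K. rademacher I G \<xi>)"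
      by (intro sum_strict_mono K) auto
    with le K show False
      by (simp add: field_simps card_gt_0_iff)
  qed
qed

lemma rademacher_cong:
  "(\<And>t g. t \<in> I \<Longrightarrow> g \<in> G \<Longrightarrow> \<xi> t g = \<zeta> t g) \<Longrightarrow> rademacher I G \<xi> = rademacher I G \<zeta>"
  unfolding rademacher_def by (simp cong: sum.cong SUP_cong)

text \<open>Vector contraction in a cheap form: each index keeps a single coordinate, at the price of
  the factor \<open>card K\<close>.\<close>

lemma rademacher_contraction:
  fixes v :: "'t \<Rightarrow> 'k \<Rightarrow> 'g \<Rightarrow> real"
  assumes I: "finite I" and G: "G \<noteq> {}" and K: "finite K" "K \<noteq> {}"
    and \<xi>: "\<And>s. s \<in> I \<Longrightarrow> bounded_on G (\<xi> s)"
    and v: "\<And>s c. s \<in> I \<Longrightarrow> c \<in> K \<Longrightarrow> bounded_on G (v s c)"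
    and lip: "\<And>s g g'. s \<in> I \<Longrightarrow> g \<in> G \<Longrightarrow> g' \<in> G \<Longrightarrow>
        \<bar>\<xi> s g - \<xi> s g'\<bar> \<le> (\<Sum>c\<in>K. \<bar>v s c g - v s c g'\<bar>)"
  shows "\<exists>\<kappa>\<in>I \<rightarrow> K. rademacher I G \<xi> \<le> rademacher I G (\<lambda>t g. card K * v t (\<kappa> t) g)"
proof -
  \<comment> \<open>J holds the indices already replaced by a single coordinate; the others still
    carry \<open>\<xi>\<close>. Every intermediate stage is again a Rademacher average, so the
    single step applies.\<close>
  have "\<exists>\<kappa>\<in>J \<rightarrow> K. rademacher I G \<xi> \<le>
      rademacher I G (\<lambda>t. if t \<in> J then \<lambda>g. card K * v t (\<kappa> t) g else \<xi> t)"
    if "finite J" "J \<subseteq> I" for J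
    using that
  proof (induction J rule: finite_induct)
    case (insert s J)
    then obtain \<kappa> where \<kappa>: "\<kappa> \<in> J \<rightarrow> K" and le: "rademacher I G \<xi> \<le>
        rademacher I G (\<lambda>t. if t \<in> J then \<lambda>g. card K * v t (\<kappa> t) g else \<xi> t)" (is "_ \<le> rademacher I G ?\<zeta>")
      by auto
    have s: "s \<in> I" "s \<notin> J" using insert by auto
    have "\<exists>c\<in>K. rademacher I G ?\<zeta> \<le> rademacher I G (?\<zeta>(s := \<lambda>g. card K * v s c g))"
      using s \<kappa> insert.prems
      by (intro rademacher_contraction_step I G K)
         (auto intro!: \<xi> v lip bounded_on_cmult)
    then obtain c where c: "c \<in> K" "rademacher I G ?\<zeta> \<le> rademacher I G (?\<zeta>(s := \<lambda>g. card K * v s c g))"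
      by blast
    have "?\<zeta>(s := \<lambda>g. card K * v s c g) =
        (\<lambda>t. if t \<in> insert s J then \<lambda>g. card K * v t ((\<kappa>(s := c)) t) g else \<xi> t)"
      using s by auto
    with le c have "rademacher I G \<xi> \<le>
        rademacher I G (\<lambda>t. if t \<in> insert s J then \<lambda>g. card K * v t ((\<kappa>(s := c)) t) g else \<xi> t)"
      by simp
    moreover have "\<kappa>(s := c) \<in> insert s J \<rightarrow> K" using \<kappa> c by auto
    ultimately show ?case by blast
  qed auto
  from this[OF I order_refl] obtain \<kappa> where "\<kappa> \<in> I \<rightarrow> K" "rademacher I G \<xi> \<le>
      rademacher I G (\<lambda>t. if t \<in> I then \<lambda>g. card K * v t (\<kappa> t) g else \<xi> t)" by blast
  moreover have "rademacher I G (\<lambda>t. if t \<in> I then \<lambda>g. card K * v t (\<kappa> t) g else \<xi> t) =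
     rademacher I G (\<lambda>t g. card K * v t (\<kappa> t) g)"
    by (intro rademacher_cong) auto
  ultimately show ?thesis by auto
qed

text \<open>With one coordinate the factor \<open>card K\<close> is 1: the Ledoux-Talagrand
  contraction principle without loss of a constant.\<close>

corollary rademacher_contraction_scalar:
  assumes I: "finite I" and G: "G \<noteq> {}"
    and \<xi>: "\<And>s. s \<in> I \<Longrightarrow> bounded_on G (\<xi> s)" and v: "\<And>s. s \<in> I \<Longrightarrow> bounded_on G (v s)"
    and lip: "\<And>s g g'. s \<in> I \<Longrightarrow> g \<in> G \<Longrightarrow> g' \<in> G \<Longrightarrow> \<bar>\<xi> s g - \<xi> s g'\<bar> \<le> \<bar>v s g - v s g'\<bar>"
  shows "rademacher I G \<xi> \<le> rademacher I G v"
  using rademacher_contraction[of I G "{()}" \<xi> "\<lambda>s _. v s"] assms by simp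

text \<open>Negating all signs replaces the pattern A by its complement, so the absolute value is
  the larger of the signed sums for A and for its complement. The element z makes both suprema
  nonnegative, hence their sum dominates, and complementation permutes the patterns.\<close>

lemma rademacher_abs:
  assumes I: "finite I" and \<xi>: "\<And>s. s \<in> I \<Longrightarrow> bounded_on G (\<xi> s)"
    and z: "z \<in> G" "\<And>s. s \<in> I \<Longrightarrow> \<xi> s z = 0"
  shows "(\<Sum>A\<in>Pow I. SUP g\<in>G. \<bar>\<Sum>t\<in>I. rsign A t * \<xi> t g\<bar>) / 2 ^ card I \<le> 2 * rademacher I G \<xi>"
proof -
  let ?Z = "\<lambda>A g. \<Sum>t\<in>I. rsign A t * \<xi> t g"
  have "(SUP g\<in>G. \<bar>?Z A g\<bar>) \<le> (SUP g\<in>G. ?Z A g) + (SUP g\<in>G. ?Z (I - A) g)" for A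
  proof -
    have neg: "?Z (I - A) g = - ?Z A g" for g
      by (simp add: rsign_complement sum_negf)
    have up: "?Z B g \<le> (SUP g\<in>G. ?Z B g)" if "g \<in> G" for g B
      using that by (intro cSUP_upper bounded_on_bdd_above bounded_on_signed_sum \<xi>)
    have nn: "0 \<le> (SUP g\<in>G. ?Z B g)" for B
      using up[OF z(1), of B] z(2) by simp
    show ?thesis
    proof (rule cSUP_least)
      fix g assume g: "g \<in> G"
      show "\<bar>?Z A g\<bar> \<le> (SUP g\<in>G. ?Z A g) + (SUP g\<in>G. ?Z (I - A) g)"
        using up[OF g, of A] up[OF g, of "I - A"] nn[of A] nn[of "I - A"] neg[of g] by linarith
    qed (use z in auto)
  qed
  then have "(\<Sum>A\<in>Pow I. SUP g\<in>G. \<bar>?Z A g\<bar>) \<le> (\<Sum>A\<in>Pow I. SUP g\<in>G. ?Z A g) + (\<Sum>A\<in>Pow I. SUP g\<in>G. ?Z (I - A) g)"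
    by (simp flip: sum.distrib add: sum_mono)
  also have "(\<Sum>A\<in>Pow I. SUP g\<in>G. ?Z (I - A) g) = (\<Sum>A\<in>Pow I. SUP g\<in>G. ?Z A g)"
    by (rule sum_Pow_complement[of "\<lambda>A. SUP g\<in>G. ?Z A g"])
  finally show ?thesis by (simp add: rademacher_def divide_right_mono flip: add_divide_distrib)
qed

section \<open>Bounded differences\<close>

text \<open>An oscillation of at most c puts f into the interval of length c starting at its
  infimum, which is the setting of Hoeffding's lemma. The nonnegative integral spares the
  integrability of the exponential.\<close>

lemma nn_integral_exp_le_Hoeffding:
  fixes f :: "'a \<Rightarrow> real"
  assumes "prob_space M" and f: "f \<in> borel_measurable M" and l: "0 < l"
    and osc: "\<And>x y. x \<in> space M \<Longrightarrow> y \<in> space M \<Longrightarrow> \<bar>f x - f y\<bar> \<le> c"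
  shows "(\<integral>\<^sup>+x. exp (l * f x) \<partial>M) \<le> exp (l * (\<integral>x. f x \<partial>M) + l\<^sup>2 * c\<^sup>2 / 8)"
proof -
  interpret prob_space M by fact
  obtain x0 where x0: "x0 \<in> space M" using not_empty by auto
  define a where "a = (INF x\<in>space M. f x)"
  have bdd: "bdd_below (f ` space M)"
    by (rule bdd_belowI2[of _ "f x0 - c"]) (use osc[OF x0] in \<open>fastforce simp: abs_le_iff\<close>)
  have a: "a \<le> f x" if "x \<in> space M" for x
    unfolding a_def by (rule cINF_lower[OF bdd that])
  have b: "f x \<le> a + c" if x: "x \<in> space M" for x
  proof -
    have "f x - c \<le> a"
      unfolding a_def by (rule cINF_greatest) (use x osc[OF x] in \<open>fastforce simp: abs_le_iff\<close>)+
    then show ?thesis by simp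
  qed
  interpret interval_bounded_random_variable M f a "a + c"
    by unfold_locales (use f a b in auto)
  let ?E = "expectation f"
  have "(\<integral>\<^sup>+x. exp (l * f x) \<partial>M) = (\<integral>\<^sup>+x. ennreal (exp (l * ?E)) * exp (l * (f x - ?E)) \<partial>M)"
    by (intro nn_integral_cong) (simp add: exp_diff right_diff_distrib flip: ennreal_mult)
  also have "\<dots> = exp (l * ?E) * (\<integral>\<^sup>+x. exp (l * (f x - ?E)) \<partial>M)"
    using f by (intro nn_integral_cmult) simp
  also have "\<dots> \<le> exp (l * ?E) * ennreal (exp (l\<^sup>2 * (a + c - a)\<^sup>2 / 8))"
    by (intro mult_left_mono Hoeffdings_lemma_nn_integral l) simp
  also have "\<dots> = exp (l * ?E + l\<^sup>2 * c\<^sup>2 / 8)"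
    by (simp add: exp_add flip: ennreal_mult)
  finally show ?thesis .
qed

lemma measurable_PiM_fun_upd:
  assumes "t \<notin> I"
  shows "(\<lambda>(x, y). x(t := y)) \<in> PiM I \<mu> \<Otimes>\<^sub>M \<mu> t \<rightarrow>\<^sub>M PiM (insert t I) \<mu>"
  by (rule measurable_add_dim)

text \<open>McDiarmid's inequality: integrating out one coordinate keeps the bounded differences in the
  others, so Hoeffding's lemma can be applied coordinate by coordinate.\<close>

lemma nn_integral_exp_le_McDiarmid:
  fixes \<mu> :: "'t \<Rightarrow> 'x measure" and F :: "('t \<Rightarrow> 'x) \<Rightarrow> real"
  assumes \<mu>: "\<And>t. prob_space (\<mu> t)" and I: "finite I" and l: "0 < l"
    and F: "F \<in> borel_measurable (PiM I \<mu>)"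
    and B: "\<And>x. x \<in> space (PiM I \<mu>) \<Longrightarrow> \<bar>F x\<bar> \<le> B"
    and diff: "\<And>x t y. x \<in> space (PiM I \<mu>) \<Longrightarrow> t \<in> I \<Longrightarrow> y \<in> space (\<mu> t) \<Longrightarrow>
        \<bar>F (x(t := y)) - F x\<bar> \<le> c t"
  shows "(\<integral>\<^sup>+x. exp (l * F x) \<partial>PiM I \<mu>) \<le>
    exp (l * (\<integral>x. F x \<partial>PiM I \<mu>) + l\<^sup>2 * (\<Sum>t\<in>I. (c t)\<^sup>2) / 8)"
  using I F B diff
proof (induction I arbitrary: F rule: finite_induct)
  case empty
  show ?case by (simp add: PiM_empty nn_integral_count_space_finite lebesgue_integral_count_space_finite)
next
  case (insert t I)
  interpret product_prob_space \<mu> I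
    using \<mu> by (auto intro!: product_prob_spaceI)
  interpret It: prob_space "PiM (insert t I) \<mu>" by (rule prob_space_PiM) (rule \<mu>)
  note [measurable] = insert.prems(1)
  have upd: "(\<lambda>(x, y). F (x(t := y))) \<in> borel_measurable (PiM I \<mu> \<Otimes>\<^sub>M \<mu> t)"
    using measurable_compose[OF measurable_PiM_fun_upd[OF insert.hyps(2), of \<mu>] insert.prems(1)]
    by (simp add: case_prod_beta')
  have upd1: "(\<lambda>y. F (x(t := y))) \<in> borel_measurable (\<mu> t)" if "x \<in> space (PiM I \<mu>)" for x
    using measurable_Pair2[OF upd that] by simp
  have sp: "x(t := y) \<in> space (PiM (insert t I) \<mu>)"
    if "x \<in> space (PiM I \<mu>)" "y \<in> space (\<mu> t)" for x y
    using that by (auto simp: space_PiM PiE_def extensional_def)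
  have int1: "integrable (\<mu> t) (\<lambda>y. F (x(t := y)))" if "x \<in> space (PiM I \<mu>)" for x
    by (rule M.integrable_const_bound[of _ B])
       (use insert.prems(2) sp that in \<open>auto intro: upd1\<close>)
  \<comment> \<open>The conditional mean given the remaining coordinates; the induction hypothesis
    is applied to it, with the same bounds B and c.\<close>
  define H where "H x = (\<integral>y. F (x(t := y)) \<partial>\<mu> t)" for x
  have intF: "integrable (PiM (insert t I) \<mu>) F"
    by (rule It.integrable_const_bound[of _ B]) (use insert.prems in auto)
  have H1: "H \<in> borel_measurable (PiM I \<mu>)"
    unfolding H_def by (rule M.borel_measurable_lebesgue_integral[OF upd])
  have H2: "\<bar>H x\<bar> \<le> B" if x: "x \<in> space (PiM I \<mu>)" for x
  proof -
    have "\<bar>H x\<bar> \<le> (\<integral>y. \<bar>F (x(t := y))\<bar> \<partial>\<mu> t)"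
      unfolding H_def by (rule integral_abs_bound)
    also have "\<dots> \<le> B"
      by (rule M.integral_le_const) (use int1[OF x] insert.prems(2) sp[OF x] in auto)
    finally show ?thesis .
  qed
  have H3: "\<bar>H (x(s := z)) - H x\<bar> \<le> c s"
    if x: "x \<in> space (PiM I \<mu>)" and s: "s \<in> I" and z: "z \<in> space (\<mu> s)" for x s z
  proof -
    have xz: "x(s := z) \<in> space (PiM I \<mu>)"
      using that by (auto simp: space_PiM PiE_def extensional_def)
    have "H (x(s := z)) - H x = (\<integral>y. F (x(s := z, t := y)) - F (x(t := y)) \<partial>\<mu> t)"
      unfolding H_def by (rule Bochner_Integration.integral_diff[symmetric]) (intro int1 x xz)+
    also have "\<bar>\<dots>\<bar> \<le> (\<integral>y. \<bar>F (x(s := z, t := y)) - F (x(t := y))\<bar> \<partial>\<mu> t)"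
      by (rule integral_abs_bound)
    also have "\<dots> \<le> c s"
    proof (rule M.integral_le_const)
      show "AE y in \<mu> t. \<bar>F (x(s := z, t := y)) - F (x(t := y))\<bar> \<le> c s"
      proof (rule AE_I2)
        fix y assume y: "y \<in> space (\<mu> t)"
        have "x(s := z, t := y) = x(t := y, s := z)"
          using s insert.hyps by (auto intro: fun_upd_twist)
        moreover have "\<bar>F (x(t := y, s := z)) - F (x(t := y))\<bar> \<le> c s"
          by (intro insert.prems(3) sp x y z) (use s in simp)
        ultimately show "\<bar>F (x(s := z, t := y)) - F (x(t := y))\<bar> \<le> c s"
          by simp
      qed
    qed (use int1 x xz in auto)
    finally show ?thesis .
  qed
  have "(\<integral>\<^sup>+x. exp (l * F x) \<partial>PiM (insert t I) \<mu>) =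
      (\<integral>\<^sup>+x. (\<integral>\<^sup>+y. exp (l * F (x(t := y))) \<partial>\<mu> t) \<partial>PiM I \<mu>)"
    by (rule product_nn_integral_insert) (use insert.hyps in auto)
  also have "\<dots> \<le> (\<integral>\<^sup>+x. exp (l * H x + l\<^sup>2 * (c t)\<^sup>2 / 8) \<partial>PiM I \<mu>)"
  proof (intro nn_integral_mono)
    fix x assume x: "x \<in> space (PiM I \<mu>)"
    show "(\<integral>\<^sup>+y. exp (l * F (x(t := y))) \<partial>\<mu> t) \<le> ennreal (exp (l * H x + l\<^sup>2 * (c t)\<^sup>2 / 8))"
      unfolding H_def
    proof (rule nn_integral_exp_le_Hoeffding[OF \<mu> upd1[OF x] l])
      fix y y' assume y: "y \<in> space (\<mu> t)" and y': "y' \<in> space (\<mu> t)"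
      show "\<bar>F (x(t := y)) - F (x(t := y'))\<bar> \<le> c t"
        using insert.prems(3)[OF sp[OF x y'] insertI1 y] unfolding fun_upd_upd .
    qed
  qed
  also have "\<dots> = (\<integral>\<^sup>+x. ennreal (exp (l\<^sup>2 * (c t)\<^sup>2 / 8)) * exp (l * H x) \<partial>PiM I \<mu>)"
    by (intro nn_integral_cong) (simp add: exp_add mult.commute flip: ennreal_mult)
  also have "\<dots> = exp (l\<^sup>2 * (c t)\<^sup>2 / 8) * (\<integral>\<^sup>+x. exp (l * H x) \<partial>PiM I \<mu>)"
    using H1 by (intro nn_integral_cmult) simp
  also have "\<dots> \<le> exp (l\<^sup>2 * (c t)\<^sup>2 / 8) *
      ennreal (exp (l * (\<integral>x. H x \<partial>PiM I \<mu>) + l\<^sup>2 * (\<Sum>t\<in>I. (c t)\<^sup>2) / 8))"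
    by (intro mult_left_mono insert.IH H1 H2 H3) auto
  also have "\<dots> = exp (l * (\<integral>x. H x \<partial>PiM I \<mu>) + l\<^sup>2 * (\<Sum>t\<in>insert t I. (c t)\<^sup>2) / 8)"
    using insert.hyps by (simp add: algebra_simps add_divide_distrib flip: ennreal_mult exp_add)
  also have "(\<integral>x. H x \<partial>PiM I \<mu>) = (\<integral>x. F x \<partial>PiM (insert t I) \<mu>)"
    unfolding H_def by (rule product_integral_insert[symmetric]) (use insert.hyps intF in auto)
  finally show ?case .
qed

text \<open>Chernoff's bound applied to the exponential moment. V is an upper bound for the sum of
  squares, so that an estimate through the sample sizes can be inserted and stays positive even if
  all differences vanish.\<close>

corollary McDiarmid:
  fixes \<mu> :: "'t \<Rightarrow> 'x measure" and F :: "('t \<Rightarrow> 'x) \<Rightarrow> real"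
  assumes \<mu>: "\<And>t. prob_space (\<mu> t)" and I: "finite I"
    and F: "F \<in> borel_measurable (PiM I \<mu>)"
    and B: "\<And>x. x \<in> space (PiM I \<mu>) \<Longrightarrow> \<bar>F x\<bar> \<le> B"
    and diff: "\<And>x t y. x \<in> space (PiM I \<mu>) \<Longrightarrow> t \<in> I \<Longrightarrow> y \<in> space (\<mu> t) \<Longrightarrow>
        \<bar>F (x(t := y)) - F x\<bar> \<le> c t"
    and V: "(\<Sum>t\<in>I. (c t)\<^sup>2) \<le> V" "0 < V" and s: "0 < s"
  shows "measure (PiM I \<mu>) {x \<in> space (PiM I \<mu>). (\<integral>x. F x \<partial>PiM I \<mu>) + s \<le> F x} \<le> exp (- 2 * s\<^sup>2 / V)"
proof -
  let ?P = "PiM I \<mu>"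
  interpret prob_space ?P by (rule prob_space_PiM) (rule \<mu>)
  \<comment> \<open>The minimiser of - l s + l^2 V / 8.\<close>
  define l where "l = 4 * s / V"
  define m where "m = (\<integral>x. F x \<partial>?P)"
  have l: "0 < l" using s V by (simp add: l_def)
  have "emeasure ?P {x \<in> space ?P. m + s \<le> F x} \<le>
      emeasure ?P {x \<in> space ?P. 1 \<le> ennreal (exp (- l * (m + s))) * ennreal (exp (l * F x))}"
  proof (rule emeasure_mono)
    show "{x \<in> space ?P. m + s \<le> F x} \<subseteq>
        {x \<in> space ?P. 1 \<le> ennreal (exp (- l * (m + s))) * ennreal (exp (l * F x))}"
    proof safe
      fix x assume "m + s \<le> F x"
      then have "l * (m + s) \<le> l * F x" using l by (intro mult_left_mono) auto
      then have "1 \<le> exp (- l * (m + s) + l * F x)" by simp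
      then show "1 \<le> ennreal (exp (- l * (m + s))) * ennreal (exp (l * F x))"
        unfolding exp_add by (simp flip: ennreal_mult)
    qed
  qed (use F in measurable)
  also have "\<dots> \<le> exp (- l * (m + s)) * (\<integral>\<^sup>+x. ennreal (exp (l * F x)) * indicator (space ?P) x \<partial>?P)"
    using nn_integral_Markov_inequality[of "\<lambda>x. ennreal (exp (l * F x))" "space ?P" ?P "ennreal (exp (- l * (m + s)))"] F
    by (simp add: measurable_compose[OF F])
  also have "\<dots> = exp (- l * (m + s)) * (\<integral>\<^sup>+x. ennreal (exp (l * F x)) \<partial>?P)"
    by (intro arg_cong2[where f="(*)"] nn_integral_cong) auto
  also have "\<dots> \<le> exp (- l * (m + s)) * ennreal (exp (l * m + l\<^sup>2 * (\<Sum>t\<in>I. (c t)\<^sup>2) / 8))"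
    unfolding m_def by (intro mult_left_mono nn_integral_exp_le_McDiarmid[OF \<mu> I l F B diff]) auto
  also have "\<dots> = exp (- l * s + l\<^sup>2 * (\<Sum>t\<in>I. (c t)\<^sup>2) / 8)"
    by (simp add: algebra_simps flip: ennreal_mult exp_add)
  also have "\<dots> \<le> exp (- l * s + l\<^sup>2 * V / 8)"
    using V by (intro ennreal_leI) (simp add: mult_left_mono)
  also have "- l * s + l\<^sup>2 * V / 8 = - 2 * s\<^sup>2 / V"
    using V by (simp add: l_def power2_eq_square field_simps)
  finally show ?thesis
    unfolding m_def by (simp add: emeasure_eq_measure)
qed

section \<open>Symmetrisation\<close>

text \<open>\<open>\<Gamma> k x\<close> selects members of G depending on the sample x. Joint
  measurability in the sample and a separate point y covers the value at the sample itself, the mean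
  over y, and the value at an independent ghost sample. That the selection approximates all of G
  enters only later, as the hypothesis \<open>approx\<close>.\<close>

locale separable_process =
  fixes I :: "'t set" and \<mu> :: "'t \<Rightarrow> 'x measure" and G :: "'g set"
    and u :: "'t \<Rightarrow> 'g \<Rightarrow> 'x \<Rightarrow> real" and \<Gamma> :: "'k::countable \<Rightarrow> ('t \<Rightarrow> 'x) \<Rightarrow> 'g" and b :: "'t \<Rightarrow> real"
  assumes finite_I: "finite I" and prob: "prob_space (\<mu> t)"
    and u_measurable: "t \<in> I \<Longrightarrow> g \<in> G \<Longrightarrow> u t g \<in> borel_measurable (\<mu> t)"
    and u_bound: "t \<in> I \<Longrightarrow> g \<in> G \<Longrightarrow> y \<in> space (\<mu> t) \<Longrightarrow> \<bar>u t g y\<bar> \<le> b t"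
    and \<Gamma>_mem: "x \<in> space (PiM I \<mu>) \<Longrightarrow> \<Gamma> k x \<in> G"
    and \<Gamma>_measurable: "t \<in> I \<Longrightarrow>
       (\<lambda>(x, y). u t (\<Gamma> k x) y) \<in> borel_measurable (PiM I \<mu> \<Otimes>\<^sub>M \<mu> t)"
begin

definition deviation :: "'g \<Rightarrow> ('t \<Rightarrow> 'x) \<Rightarrow> real" where
  "deviation g x = (\<Sum>t\<in>I. u t g (x t) - (\<integral>y. u t g y \<partial>\<mu> t))"

definition sup_deviation :: "('t \<Rightarrow> 'x) \<Rightarrow> real" where
  "sup_deviation x = (SUP k. \<bar>deviation (\<Gamma> k x) x\<bar>)"

text \<open>The functions are selected by the true sample x even where they are evaluated at the
  ghost sample y. Hence the expression is not symmetric under exchanging coordinates of x and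
  y.\<close>

definition ghost_deviation :: "('t \<Rightarrow> 'x) \<Rightarrow> ('t \<Rightarrow> 'x) \<Rightarrow> real" where
  "ghost_deviation x y = (SUP k. \<bar>\<Sum>t\<in>I. u t (\<Gamma> k x) (x t) - u t (\<Gamma> k x) (y t)\<bar>)"

section \<open>Bounds, measurability and ghost samples for the countable supremum\<close>

sublocale product_prob_space \<mu> I
  using prob by (auto intro!: product_prob_spaceI)

lemma I_in_space: "x \<in> space (PiM I \<mu>) \<Longrightarrow> t \<in> I \<Longrightarrow> x t \<in> space (\<mu> t)"
  by (auto simp: space_PiM)

lemma u_integrable: "t \<in> I \<Longrightarrow> g \<in> G \<Longrightarrow> integrable (\<mu> t) (u t g)"
  by (rule finite_measure.integrable_const_bound[of _ _ "b t"])
     (auto intro: prob_space.finite_measure prob u_measurable u_bound)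

lemma integral_bound:
  assumes "t \<in> I" "g \<in> G" shows "\<bar>\<integral>y. u t g y \<partial>\<mu> t\<bar> \<le> b t"
proof -
  have "\<bar>\<integral>y. u t g y \<partial>\<mu> t\<bar> \<le> (\<integral>y. \<bar>u t g y\<bar> \<partial>\<mu> t)"
    by (rule integral_abs_bound)
  also have "\<dots> \<le> b t"
    by (rule prob_space.integral_le_const[OF prob]) (use assms u_integrable u_bound in auto)
  finally show ?thesis .
qed

lemma deviation_bound_sum:
  assumes "g \<in> G" "x \<in> space (PiM I \<mu>)" shows "\<bar>deviation g x\<bar> \<le> 2 * (\<Sum>t\<in>I. b t)"
proof -
  have "\<bar>deviation g x\<bar> \<le> (\<Sum>t\<in>I. \<bar>u t g (x t) - (\<integral>y. u t g y \<partial>\<mu> t)\<bar>)"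
    unfolding deviation_def by (rule sum_abs)
  also have "\<dots> \<le> (\<Sum>t\<in>I. 2 * b t)"
  proof (intro sum_mono)
    fix t assume t: "t \<in> I"
    show "\<bar>u t g (x t) - (\<integral>y. u t g y \<partial>\<mu> t)\<bar> \<le> 2 * b t"
      using u_bound[OF t assms(1) I_in_space[OF assms(2) t]] integral_bound[OF t assms(1)] by linarith
  qed
  finally show ?thesis by (simp add: sum_distrib_left)
qed

lemma ghost_bound:
  assumes "g \<in> G" "x \<in> space (PiM I \<mu>)" "y \<in> space (PiM I \<mu>)"
  shows "\<bar>\<Sum>t\<in>I. u t g (x t) - u t g (y t)\<bar> \<le> 2 * (\<Sum>t\<in>I. b t)"
proof -
  have "\<bar>\<Sum>t\<in>I. u t g (x t) - u t g (y t)\<bar> \<le> (\<Sum>t\<in>I. \<bar>u t g (x t) - u t g (y t)\<bar>)"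
    by (rule sum_abs)
  also have "\<dots> \<le> (\<Sum>t\<in>I. 2 * b t)"
  proof (intro sum_mono)
    fix t assume t: "t \<in> I"
    show "\<bar>u t g (x t) - u t g (y t)\<bar> \<le> 2 * b t"
      using u_bound[OF t assms(1) I_in_space[OF assms(2) t]]
        u_bound[OF t assms(1) I_in_space[OF assms(3) t]] by linarith
  qed
  finally show ?thesis by (simp add: sum_distrib_left)
qed

lemma deviation_bdd:
  "x \<in> space (PiM I \<mu>) \<Longrightarrow> bdd_above (range (\<lambda>k. \<bar>deviation (\<Gamma> k x) x\<bar>))"
  by (rule bdd_aboveI2) (rule deviation_bound_sum[OF \<Gamma>_mem])

lemma ghost_bdd:
  "x \<in> space (PiM I \<mu>) \<Longrightarrow> y \<in> space (PiM I \<mu>) \<Longrightarrow>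
    bdd_above (range (\<lambda>k. \<bar>\<Sum>t\<in>I. u t (\<Gamma> k x) (x t) - u t (\<Gamma> k x) (y t)\<bar>))"
  by (rule bdd_aboveI2) (rule ghost_bound[OF \<Gamma>_mem])

lemma measurable_u_\<Gamma>:
  assumes "t \<in> I" "f \<in> M \<rightarrow>\<^sub>M PiM I \<mu>" "h \<in> M \<rightarrow>\<^sub>M \<mu> t"
  shows "(\<lambda>z. u t (\<Gamma> k (f z)) (h z)) \<in> borel_measurable M"
  using measurable_compose[OF measurable_Pair[OF assms(2,3)] \<Gamma>_measurable[OF assms(1), of k]] by simp

lemma deviation_measurable: "(\<lambda>x. deviation (\<Gamma> k x) x) \<in> borel_measurable (PiM I \<mu>)"
  unfolding deviation_def
proof (intro borel_measurable_sum borel_measurable_diff)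
  fix t assume t: "t \<in> I"
  show "(\<lambda>x. u t (\<Gamma> k x) (x t)) \<in> borel_measurable (PiM I \<mu>)"
    by (rule measurable_u_\<Gamma>) (use t in measurable)
  show "(\<lambda>x. \<integral>y. u t (\<Gamma> k x) y \<partial>\<mu> t) \<in> borel_measurable (PiM I \<mu>)"
    by (rule M.borel_measurable_lebesgue_integral[OF \<Gamma>_measurable[OF t]])
qed

lemma sup_deviation_measurable: "sup_deviation \<in> borel_measurable (PiM I \<mu>)"
  unfolding sup_deviation_def
  by (intro borel_measurable_cSUP borel_measurable_abs deviation_measurable deviation_bdd) auto

lemma abs_SUP_le:
  fixes f :: "'i \<Rightarrow> real"
  assumes "\<And>k. \<bar>f k\<bar> \<le> q" shows "\<bar>SUP k. \<bar>f k\<bar>\<bar> \<le> q"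
proof -
  have "0 \<le> \<bar>f undefined\<bar>" by simp
  also have "\<dots> \<le> (SUP k. \<bar>f k\<bar>)"
    by (rule cSUP_upper[OF _ bdd_aboveI2[OF assms]]) simp
  finally have "0 \<le> (SUP k. \<bar>f k\<bar>)" .
  moreover have "(SUP k. \<bar>f k\<bar>) \<le> q" by (rule cSUP_least) (use assms in auto)
  ultimately show ?thesis by simp
qed

lemma sup_deviation_bound: "x \<in> space (PiM I \<mu>) \<Longrightarrow> \<bar>sup_deviation x\<bar> \<le> 2 * (\<Sum>t\<in>I. b t)"
  unfolding sup_deviation_def by (intro abs_SUP_le deviation_bound_sum \<Gamma>_mem)

lemma abs_ghost_deviation_le:
  "x \<in> space (PiM I \<mu>) \<Longrightarrow> y \<in> space (PiM I \<mu>) \<Longrightarrow> \<bar>ghost_deviation x y\<bar> \<le> 2 * (\<Sum>t\<in>I. b t)"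
  unfolding ghost_deviation_def by (intro abs_SUP_le ghost_bound \<Gamma>_mem)

lemma ghost_measurable:
  assumes "f \<in> M \<rightarrow>\<^sub>M PiM I \<mu>" "h \<in> M \<rightarrow>\<^sub>M PiM I \<mu>"
  shows "(\<lambda>z. ghost_deviation (f z) (h z)) \<in> borel_measurable M"
  unfolding ghost_deviation_def
proof (intro borel_measurable_cSUP borel_measurable_abs borel_measurable_sum borel_measurable_diff)
  fix z assume "z \<in> space M"
  then show "bdd_above (range (\<lambda>k. \<bar>\<Sum>t\<in>I. u t (\<Gamma> k (f z)) (f z t) - u t (\<Gamma> k (f z)) (h z t)\<bar>))"
    using assms by (intro ghost_bdd) (auto dest: measurable_space)
next
  fix k t assume t: "t \<in> I"
  note c = measurable_component_singleton[OF t]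
  show "(\<lambda>z. u t (\<Gamma> k (f z)) (f z t)) \<in> borel_measurable M"
    by (rule measurable_u_\<Gamma>[OF t assms(1) measurable_compose[OF assms(1) c]])
  show "(\<lambda>z. u t (\<Gamma> k (f z)) (h z t)) \<in> borel_measurable M"
    by (rule measurable_u_\<Gamma>[OF t assms(1) measurable_compose[OF assms(2) c]])
qed simp

lemma integral_component:
  fixes f :: "'x \<Rightarrow> real"
  assumes "t \<in> I" "f \<in> borel_measurable (\<mu> t)"
  shows "(\<integral>y. f (y t) \<partial>PiM I \<mu>) = (\<integral>y. f y \<partial>\<mu> t)"
proof -
  have "(\<integral>y. f y \<partial>\<mu> t) = (\<integral>y. f y \<partial>distr (PiM I \<mu>) (\<mu> t) (\<lambda>\<omega>. \<omega> t))"
    by (simp only: PiM_component[OF assms(1)])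
  also have "\<dots> = (\<integral>y. f (y t) \<partial>PiM I \<mu>)"
    by (rule integral_distr) (use assms in measurable)
  finally show ?thesis by simp
qed

text \<open>With x fixed the selected functions are fixed as well, so each mean is the expectation
  of a ghost evaluation, and the absolute value and the supremum may be moved inside that
  expectation.\<close>

lemma sup_deviation_le_ghost:
  assumes x: "x \<in> space (PiM I \<mu>)"
  shows "sup_deviation x \<le> (\<integral>y. ghost_deviation x y \<partial>PiM I \<mu>)"
  unfolding sup_deviation_def
proof (rule cSUP_least)
  fix k
  let ?g = "\<Gamma> k x"
  have g: "?g \<in> G" by (rule \<Gamma>_mem[OF x])
  have m: "(\<lambda>y. u t ?g (y t)) \<in> borel_measurable (PiM I \<mu>)" if "t \<in> I" for t
    by (rule measurable_compose[OF measurable_component_singleton[OF that, of \<mu>] u_measurable[OF that g]])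
  have int: "integrable (PiM I \<mu>) (\<lambda>y. u t ?g (y t))" if "t \<in> I" for t
    using that by (intro P.integrable_const_bound[of _ "b t"]) (auto intro!: u_bound g I_in_space m)
  have dint: "integrable (PiM I \<mu>) (ghost_deviation x)"
    using x abs_ghost_deviation_le[OF x]
    by (intro P.integrable_const_bound[of _ "2 * (\<Sum>t\<in>I. b t)"] AE_I2 ghost_measurable) auto
  have "deviation ?g x = (\<integral>y. (\<Sum>t\<in>I. u t ?g (x t) - u t ?g (y t)) \<partial>PiM I \<mu>)"
    unfolding deviation_def using int
    by (subst Bochner_Integration.integral_sum)
       (auto simp: integral_component u_measurable g P.prob_space intro!: sum.cong)
  then have "\<bar>deviation ?g x\<bar> \<le> (\<integral>y. \<bar>\<Sum>t\<in>I. u t ?g (x t) - u t ?g (y t)\<bar> \<partial>PiM I \<mu>)"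
    by (metis integral_abs_bound)
  also have "\<dots> \<le> (\<integral>y. ghost_deviation x y \<partial>PiM I \<mu>)"
  proof (rule integral_mono)
    fix y assume y: "y \<in> space (PiM I \<mu>)"
    show "\<bar>\<Sum>t\<in>I. u t ?g (x t) - u t ?g (y t)\<bar> \<le> ghost_deviation x y"
      unfolding ghost_deviation_def by (rule cSUP_upper[OF _ ghost_bdd[OF x y]]) simp
  qed (use int dint in auto)
  finally show "\<bar>deviation ?g x\<bar> \<le> (\<integral>y. ghost_deviation x y \<partial>PiM I \<mu>)" .
qed simp

text \<open>The sample and its ghost copy form a single product over \<open>I \<times> UNIV\<close>, on which exchanging
  them on a subset of indices is a permutation of coordinates.\<close>

lemma integral_reindex:
  assumes inj: "inj_on p I'" and p: "p ` I' \<subseteq> J" and h: "h \<in> borel_measurable (PiM I' (\<lambda>t. \<nu> (p t)))"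
    and \<nu>: "\<And>j. prob_space (\<nu> j)"
  shows "(\<integral>x. h x \<partial>PiM I' (\<lambda>t. \<nu> (p t))) = (\<integral>z. h (\<lambda>t\<in>I'. z (p t)) \<partial>PiM J \<nu> :: real)"
proof -
  have "PiM I' (\<lambda>t. \<nu> (p t)) = distr (PiM J \<nu>) (PiM I' (\<lambda>t. \<nu> (p t))) (\<lambda>z. \<lambda>t\<in>I'. z (p t))"
    using p by (intro distr_PiM_reindex[symmetric] \<nu> inj) auto
  also have "(\<integral>x. h x \<partial>\<dots>) = (\<integral>z. h (\<lambda>t\<in>I'. z (p t)) \<partial>PiM J \<nu>)"
    using p by (intro integral_distr h measurable_restrict measurable_component_singleton) auto
  finally show ?thesis .
qed

text \<open>The hypothesis is a pointwise bound, so the possibly nonmeasurable supremum over G stays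
  outside all integrals. After a swap of coordinates the selected functions depend on the mixed
  sample; they are nevertheless members of G, and bounding the two halves separately gives r +
  r.\<close>

theorem expectation_sup_deviation_le:
  assumes rad: "\<And>x. x \<in> space (PiM I \<mu>) \<Longrightarrow>
     (\<Sum>A\<in>Pow I. SUP g\<in>G. \<bar>\<Sum>t\<in>I. rsign A t * u t g (x t)\<bar>) / 2 ^ card I \<le> r"
  shows "(\<integral>x. sup_deviation x \<partial>PiM I \<mu>) \<le> 2 * r"
proof -
  \<comment> \<open>The tag \<open>False\<close> marks the sample and \<open>True\<close> the ghost
    copy; both have the same law.\<close>
  define \<nu> :: "'t \<times> bool \<Rightarrow> 'x measure" where "\<nu> = (\<lambda>(t, _). \<mu> t)"
  have \<nu>: "prob_space (\<nu> j)" for j by (cases j) (simp add: \<nu>_def prob)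
  have \<nu>_eq: "\<nu> (t, c) = \<mu> t" for t c by (simp add: \<nu>_def)
  interpret \<nu>: product_sigma_finite \<nu>
    by (rule product_sigma_finite.intro, rule prob_space_imp_sigma_finite, rule \<nu>)
  let ?J = "I \<times> (UNIV :: bool set)" and ?JF = "I \<times> {False}" and ?JT = "I \<times> {True}"
  define half where "half c z = (\<lambda>t\<in>I. z (t, c))" for c and z :: "'t \<times> bool \<Rightarrow> 'x"
  define \<Phi> where "\<Phi> z = ghost_deviation (half False z) (half True z)" for z
  define B where "B = 2 * (\<Sum>t\<in>I. b t)"
  interpret L: prob_space "PiM ?J \<nu>" by (rule prob_space_PiM) (rule \<nu>)
  have J: "?J = ?JF \<union> ?JT"
    unfolding Sigma_Un_distrib2[symmetric] UNIV_bool by (simp add: insert_commute)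
  have half_meas: "half c \<in> PiM J' \<nu> \<rightarrow>\<^sub>M PiM I \<mu>" if "I \<times> {c} \<subseteq> J'" for c J'
    unfolding half_def
  proof (rule measurable_restrict)
    fix t assume "t \<in> I"
    with that have "(t, c) \<in> J'" by auto
    from measurable_component_singleton[OF this, of \<nu>]
    show "(\<lambda>z. z (t, c)) \<in> PiM J' \<nu> \<rightarrow>\<^sub>M \<mu> t" by (simp add: \<nu>_eq)
  qed
  have half_int: "(\<integral>x. h x \<partial>PiM I \<mu>) = (\<integral>z. h (half c z) \<partial>PiM (I \<times> {c}) \<nu>)"
    if "h \<in> borel_measurable (PiM I \<mu>)" for c and h :: "_ \<Rightarrow> real"
    using integral_reindex[of "\<lambda>t. (t, c)" I "I \<times> {c}" h \<nu>] that
    by (auto simp: \<nu>_eq half_def \<nu> inj_on_def)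
  have \<Phi>_meas: "\<Phi> \<in> borel_measurable (PiM ?J \<nu>)"
    unfolding \<Phi>_def by (intro ghost_measurable half_meas) auto
  have half_sp: "half c z \<in> space (PiM I \<mu>)" if "z \<in> space (PiM ?J \<nu>)" for c z
    using measurable_space[OF half_meas[of c ?J] that] by auto
  have \<Phi>_int: "integrable (PiM ?J \<nu>) \<Phi>"
    by (rule L.integrable_const_bound[of _ B])
       (auto simp: \<Phi>_def[abs_def] B_def intro!: abs_ghost_deviation_le half_sp \<Phi>_meas[unfolded \<Phi>_def[abs_def]])
  have "(\<integral>x. sup_deviation x \<partial>PiM I \<mu>) \<le> (\<integral>x. (\<integral>y. ghost_deviation x y \<partial>PiM I \<mu>) \<partial>PiM I \<mu>)"
  proof (rule integral_mono)
    have "(\<lambda>(x, y). ghost_deviation x y) \<in> borel_measurable (PiM I \<mu> \<Otimes>\<^sub>M PiM I \<mu>)"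
      unfolding case_prod_beta' by (intro ghost_measurable) auto
    then have m: "(\<lambda>x. \<integral>y. ghost_deviation x y \<partial>PiM I \<mu>) \<in> borel_measurable (PiM I \<mu>)"
      by (rule P.borel_measurable_lebesgue_integral)
    show "integrable (PiM I \<mu>) (\<lambda>x. \<integral>y. ghost_deviation x y \<partial>PiM I \<mu>)"
    proof (rule P.integrable_const_bound[OF AE_I2 m])
      fix x assume x: "x \<in> space (PiM I \<mu>)"
      have "integrable (PiM I \<mu>) (ghost_deviation x)"
        using x abs_ghost_deviation_le[OF x]
        by (intro P.integrable_const_bound[of _ "2 * (\<Sum>t\<in>I. b t)"] AE_I2 ghost_measurable) auto
      then have le: "(\<integral>y. \<bar>ghost_deviation x y\<bar> \<partial>PiM I \<mu>) \<le> B"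
        by (intro P.integral_le_const) (auto simp: B_def intro!: abs_ghost_deviation_le x)
      have "\<bar>\<integral>y. ghost_deviation x y \<partial>PiM I \<mu>\<bar> \<le> (\<integral>y. \<bar>ghost_deviation x y\<bar> \<partial>PiM I \<mu>)"
        by (rule integral_abs_bound)
      also note le
      finally show "norm (\<integral>y. ghost_deviation x y \<partial>PiM I \<mu>) \<le> B"
        by simp
    qed
    show "integrable (PiM I \<mu>) sup_deviation"
      by (rule P.integrable_const_bound[of _ B])
         (auto simp: B_def intro: sup_deviation_bound sup_deviation_measurable)
    then show "sup_deviation x \<le> (\<integral>y. ghost_deviation x y \<partial>PiM I \<mu>)" if "x \<in> space (PiM I \<mu>)" for x
      by (intro sup_deviation_le_ghost that)
  qed
  also have "\<dots> = (\<integral>z. (\<integral>y. ghost_deviation (half False z) y \<partial>PiM I \<mu>) \<partial>PiM ?JF \<nu>)"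
  proof (rule half_int)
    have "(\<lambda>(x, y). ghost_deviation x y) \<in> borel_measurable (PiM I \<mu> \<Otimes>\<^sub>M PiM I \<mu>)"
      unfolding case_prod_beta' by (intro ghost_measurable) auto
    then show "(\<lambda>x. \<integral>y. ghost_deviation x y \<partial>PiM I \<mu>) \<in> borel_measurable (PiM I \<mu>)"
      by (rule P.borel_measurable_lebesgue_integral)
  qed
  also have "\<dots> = (\<integral>z. (\<integral>z'. ghost_deviation (half False z) (half True z') \<partial>PiM ?JT \<nu>) \<partial>PiM ?JF \<nu>)"
  proof (intro Bochner_Integration.integral_cong refl half_int ghost_measurable)
    fix z assume "z \<in> space (PiM ?JF \<nu>)"
    then have "half False z \<in> space (PiM I \<mu>)"
      using measurable_space[OF half_meas[of False ?JF]] by auto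
    then show "(\<lambda>_. half False z) \<in> PiM I \<mu> \<rightarrow>\<^sub>M PiM I \<mu>" by simp
  qed simp
  also have "\<dots> = (\<integral>z. (\<integral>z'. \<Phi> (merge ?JF ?JT (z, z')) \<partial>PiM ?JT \<nu>) \<partial>PiM ?JF \<nu>)"
    unfolding \<Phi>_def half_def
    by (intro Bochner_Integration.integral_cong refl arg_cong2[where f=ghost_deviation] restrict_ext)
       (auto simp: merge_def)
  also have "\<dots> = (\<integral>z. \<Phi> z \<partial>PiM ?J \<nu>)"
  proof -
    have "integrable (PiM (?JF \<union> ?JT) \<nu>) \<Phi>"
      unfolding J[symmetric] by (rule \<Phi>_int)
    then have "(\<integral>z. \<Phi> z \<partial>PiM (?JF \<union> ?JT) \<nu>) =
        (\<integral>z. (\<integral>z'. \<Phi> (merge ?JF ?JT (z, z')) \<partial>PiM ?JT \<nu>) \<partial>PiM ?JF \<nu>)"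
      using finite_I by (intro \<nu>.product_integral_fold) auto
    then show ?thesis unfolding J[symmetric] by (rule sym)
  qed
  finally have le: "(\<integral>x. sup_deviation x \<partial>PiM I \<mu>) \<le> (\<integral>z. \<Phi> z \<partial>PiM ?J \<nu>)" .
  \<comment> \<open>The two copies are exchanged exactly at the indices outside A, which is where
    \<open>rsign A\<close> is -1.\<close>
  define sw where "sw A = (\<lambda>(t, c). (t :: 't, if t \<in> A then c else \<not> c))" for A
  define \<Psi> where "\<Psi> A z = \<Phi> (\<lambda>j\<in>?J. z (sw A j))" for A z
  have sw_int: "(\<integral>z. \<Phi> z \<partial>PiM ?J \<nu>) = (\<integral>z. \<Psi> A z \<partial>PiM ?J \<nu>)" for A
  proof -
    have eq: "\<nu> (sw A j) = \<nu> j" for j by (cases j) (simp add: sw_def \<nu>_eq)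
    have "inj_on (sw A) ?J" "sw A ` ?J \<subseteq> ?J"
      by (auto simp: sw_def inj_on_def split: if_splits)
    from integral_reindex[OF this, of \<Phi> \<nu>] show ?thesis
      using \<Phi>_meas \<nu> by (simp add: eq \<Psi>_def)
  qed
  have sw_meas: "(\<lambda>z. \<lambda>j\<in>?J. z (sw A j)) \<in> PiM ?J \<nu> \<rightarrow>\<^sub>M PiM ?J \<nu>" for A
  proof (rule measurable_restrict)
    fix j assume j: "j \<in> ?J"
    then have "sw A j \<in> ?J" by (auto simp: sw_def)
    from measurable_component_singleton[OF this, of \<nu>]
    show "(\<lambda>z. z (sw A j)) \<in> PiM ?J \<nu> \<rightarrow>\<^sub>M \<nu> j"
      by (cases j) (simp add: sw_def \<nu>_eq)
  qed
  have sw_sp: "(\<lambda>j\<in>?J. z (sw A j)) \<in> space (PiM ?J \<nu>)" if "z \<in> space (PiM ?J \<nu>)" for z A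
    by (rule measurable_space[OF sw_meas that])
  have \<Psi>_int: "integrable (PiM ?J \<nu>) (\<Psi> A)" for A
  proof (rule L.integrable_const_bound[of _ B])
    show "AE z in PiM ?J \<nu>. norm (\<Psi> A z) \<le> B"
      by (rule AE_I2)
         (simp add: \<Psi>_def \<Phi>_def B_def abs_ghost_deviation_le half_sp sw_sp)
    show "\<Psi> A \<in> borel_measurable (PiM ?J \<nu>)"
      unfolding \<Psi>_def by (rule measurable_compose[OF sw_meas \<Phi>_meas])
  qed
  \<comment> \<open>All exchanges preserve the integral, so it equals the average over the 2^|I|
    exchanges.\<close>
  have "(\<integral>z. \<Phi> z \<partial>PiM ?J \<nu>) = (\<Sum>A\<in>Pow I. \<integral>z. \<Psi> A z \<partial>PiM ?J \<nu>) / 2 ^ card I"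
    using finite_I by (simp add: card_Pow flip: sw_int)
  also have "\<dots> = (\<integral>z. (\<Sum>A\<in>Pow I. \<Psi> A z) / 2 ^ card I \<partial>PiM ?J \<nu>)"
    using \<Psi>_int by simp
  also have "\<dots> \<le> 2 * r"
  proof (rule L.integral_le_const[OF _ AE_I2])
    fix z assume z: "z \<in> space (PiM ?J \<nu>)"
    let ?R = "\<lambda>c A. SUP g\<in>G. \<bar>\<Sum>t\<in>I. rsign A t * u t g (half c z t)\<bar>"
    \<comment> \<open>The selected function is frozen as a member g of G. Its difference of
      evaluations becomes a signed sum over the unswapped copies, and the triangle inequality
      separates these.\<close>
    have "\<Psi> A z \<le> ?R False A + ?R True A" for A
      unfolding \<Psi>_def \<Phi>_def ghost_deviation_def
    proof (rule cSUP_least)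
      fix k
      let ?z = "\<lambda>j\<in>?J. z (sw A j)"
      define g where "g = \<Gamma> k (half False ?z)"
      have g: "g \<in> G" unfolding g_def by (intro \<Gamma>_mem half_sp sw_sp z)
      have up: "\<bar>\<Sum>t\<in>I. rsign A t * u t g (half c z t)\<bar> \<le> ?R c A" for c
      proof (rule cSUP_upper[OF g bounded_on_bdd_above_abs[OF bounded_on_signed_sum]])
        fix t assume "t \<in> I"
        then show "bounded_on G (\<lambda>g. u t g (half c z t))"
          using I_in_space[OF half_sp[OF z]] by (intro bounded_onI[of _ _ "b t"] u_bound)
      qed
      have "(\<Sum>t\<in>I. u t g (half False ?z t) - u t g (half True ?z t)) =
          (\<Sum>t\<in>I. rsign A t * (u t g (half False z t) - u t g (half True z t)))"
        by (intro sum.cong refl) (simp add: half_def sw_def rsign_def)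
      also have "\<dots> = (\<Sum>t\<in>I. rsign A t * u t g (half False z t)) - (\<Sum>t\<in>I. rsign A t * u t g (half True z t))"
        by (simp add: right_diff_distrib sum_subtractf)
      finally have "\<bar>\<Sum>t\<in>I. u t g (half False ?z t) - u t g (half True ?z t)\<bar> \<le> ?R False A + ?R True A"
        using up[of False] up[of True] by linarith
      then show "\<bar>\<Sum>t\<in>I. u t (\<Gamma> k (half False ?z)) (half False ?z t) - u t (\<Gamma> k (half False ?z)) (half True ?z t)\<bar>
          \<le> ?R False A + ?R True A"
        by (simp add: g_def)
    qed simp
    then have "(\<Sum>A\<in>Pow I. \<Psi> A z) / 2 ^ card I \<le> (\<Sum>A\<in>Pow I. ?R False A + ?R True A) / 2 ^ card I"
      by (intro divide_right_mono sum_mono) auto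
    also have "\<dots> = (\<Sum>A\<in>Pow I. ?R False A) / 2 ^ card I + (\<Sum>A\<in>Pow I. ?R True A) / 2 ^ card I"
      by (simp add: sum.distrib add_divide_distrib)
    also have "\<dots> \<le> r + r"
      by (intro add_mono rad half_sp z)
    finally show "(\<Sum>A\<in>Pow I. \<Psi> A z) / 2 ^ card I \<le> 2 * r" by simp
  qed (use \<Psi>_int in auto)
  finally show ?thesis using le by simp
qed

text \<open>At a fixed sample the countable supremum dominates the whole class; this carries a
  measurable event over to a statement about every g in G.\<close>

lemma abs_deviation_le_sup:
  assumes x: "x \<in> space (PiM I \<mu>)"
    and approx: "\<And>e. 0 < e \<Longrightarrow> \<exists>k. \<bar>deviation g x\<bar> \<le> \<bar>deviation (\<Gamma> k x) x\<bar> + e"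
  shows "\<bar>deviation g x\<bar> \<le> sup_deviation x"
proof (rule field_le_epsilon)
  fix e :: real assume "0 < e"
  then obtain k where "\<bar>deviation g x\<bar> \<le> \<bar>deviation (\<Gamma> k x) x\<bar> + e"
    using approx by blast
  moreover have "\<bar>deviation (\<Gamma> k x) x\<bar> \<le> sup_deviation x"
    unfolding sup_deviation_def by (rule cSUP_upper[OF _ deviation_bdd[OF x]]) simp
  ultimately show "\<bar>deviation g x\<bar> \<le> sup_deviation x + e" by simp
qed

text \<open>The bounded differences are not immediate, because changing a coordinate of x also
  changes the functions over which the supremum runs. Each function selected at x is compared with
  its own deviation at x', and \<open>approx\<close> at x' bounds that by the supremum at
  x'.\<close>

theorem sup_deviation_concentration:
  assumes rad: "\<And>x. x \<in> space (PiM I \<mu>) \<Longrightarrow>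
     (\<Sum>A\<in>Pow I. SUP g\<in>G. \<bar>\<Sum>t\<in>I. rsign A t * u t g (x t)\<bar>) / 2 ^ card I \<le> r"
    and approx: "\<And>g x e. g \<in> G \<Longrightarrow> x \<in> space (PiM I \<mu>) \<Longrightarrow> 0 < e \<Longrightarrow>
        \<exists>k. \<bar>deviation g x\<bar> \<le> \<bar>deviation (\<Gamma> k x) x\<bar> + e"
    and osc: "\<And>t g y y'. t \<in> I \<Longrightarrow> g \<in> G \<Longrightarrow> y \<in> space (\<mu> t) \<Longrightarrow> y' \<in> space (\<mu> t) \<Longrightarrow>
        \<bar>u t g y - u t g y'\<bar> \<le> c t"
    and V: "(\<Sum>t\<in>I. (c t)\<^sup>2) \<le> V" "0 < V" and s: "0 < s"
  shows "measure (PiM I \<mu>) {x \<in> space (PiM I \<mu>). 2 * r + s < sup_deviation x} \<le> exp (- 2 * s\<^sup>2 / V)"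
proof -
  have diff: "sup_deviation x \<le> sup_deviation x' + c t"
    if x: "x \<in> space (PiM I \<mu>)" and x': "x' \<in> space (PiM I \<mu>)" and t: "t \<in> I"
      and eq: "\<And>t'. t' \<in> I \<Longrightarrow> t' \<noteq> t \<Longrightarrow> x t' = x' t'" for x x' t
    unfolding sup_deviation_def[of x]
  proof (rule cSUP_least)
    fix k
    let ?g = "\<Gamma> k x"
    have g: "?g \<in> G" by (rule \<Gamma>_mem[OF x])
    have "deviation ?g x - deviation ?g x' = (\<Sum>t'\<in>I. u t' ?g (x t') - u t' ?g (x' t'))"
      by (simp add: deviation_def flip: sum_subtractf)
    also have "\<dots> = u t ?g (x t) - u t ?g (x' t)"
      using finite_I t eq by (subst sum.remove[of I t]) (auto intro!: sum.neutral)
    finally have "\<bar>deviation ?g x\<bar> \<le> \<bar>deviation ?g x'\<bar> + c t"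
      using osc[OF t g I_in_space[OF x t] I_in_space[OF x' t]] by linarith
    also have "\<bar>deviation ?g x'\<bar> \<le> sup_deviation x'"
      by (rule abs_deviation_le_sup[OF x' approx[OF g x']])
    finally show "\<bar>deviation ?g x\<bar> \<le> sup_deviation x' + c t" by simp
  qed simp
  have "measure (PiM I \<mu>) {x \<in> space (PiM I \<mu>). 2 * r + s < sup_deviation x} \<le>
    measure (PiM I \<mu>) {x \<in> space (PiM I \<mu>). (\<integral>x. sup_deviation x \<partial>PiM I \<mu>) + s \<le> sup_deviation x}"
    using expectation_sup_deviation_le[OF rad] sup_deviation_measurable
    by (intro P.finite_measure_mono) auto
  also have "\<dots> \<le> exp (- 2 * s\<^sup>2 / V)"
  proof (rule McDiarmid[OF prob finite_I sup_deviation_measurable sup_deviation_bound _ V s])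
    fix x t y assume *: "x \<in> space (PiM I \<mu>)" "t \<in> I" "y \<in> space (\<mu> t)"
    then have "x(t := y) \<in> space (PiM I \<mu>)"
      by (auto simp: space_PiM PiE_def extensional_def)
    with * show "\<bar>sup_deviation (x(t := y)) - sup_deviation x\<bar> \<le> c t"
      using diff[of "x(t := y)" x t] diff[of x "x(t := y)" t] by (simp add: abs_le_iff)
  qed
  finally show ?thesis .
qed

end

text \<open>A deviation consists of values at the sample points and of means of Lipschitz functions.
  Approximation at the points together with approximation in L1 therefore controls it, although
  neither is uniform on the space. Letting \<open>\<gamma> i\<close> depend on the sample x is what
  admits non-separable classes.\<close>

definition separating_family ::
  "'x measure \<Rightarrow> ('x \<Rightarrow> real) set \<Rightarrow> 't set \<Rightarrow> ('t \<Rightarrow> 'x measure) \<Rightarrow>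
    (nat \<Rightarrow> ('t \<Rightarrow> 'x) \<Rightarrow> 'x \<Rightarrow> real) \<Rightarrow> bool" where
  "separating_family X F I \<mu> \<gamma> \<longleftrightarrow>
     (\<forall>i. (\<lambda>(x, y). \<gamma> i x y) \<in> borel_measurable (PiM I \<mu> \<Otimes>\<^sub>M X)) \<and>
     (\<forall>i. \<forall>x\<in>space (PiM I \<mu>). \<gamma> i x \<in> F) \<and>
     (\<forall>x\<in>space (PiM I \<mu>). \<forall>h\<in>F. \<forall>e>0. \<exists>i. \<forall>t\<in>I.
        \<bar>\<gamma> i x (x t) - h (x t)\<bar> \<le> e \<and> (\<integral>y. \<bar>\<gamma> i x y - h y\<bar> \<partial>\<mu> t) \<le> e)"

lemma separating_familyD:
  assumes "separating_family X F I \<mu> \<gamma>" "x \<in> space (PiM I \<mu>)" "h \<in> F" "0 < e"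
  shows "\<exists>i. \<forall>t\<in>I. \<bar>\<gamma> i x (x t) - h (x t)\<bar> \<le> e \<and> (\<integral>y. \<bar>\<gamma> i x y - h y\<bar> \<partial>\<mu> t) \<le> e"
  using assms unfolding separating_family_def by simp

section \<open>Reproducing kernel Hilbert spaces\<close>

context hilbert_function_space
begin

abbreviation nrm where "nrm \<equiv> fun_norm ip"

lemma diff_mem: "f \<in> H \<Longrightarrow> g \<in> H \<Longrightarrow> (\<lambda>x. f x - g x) \<in> H"
  using add_mem[OF _ scale_mem[of g "-1"], of f] by simp

lemma sum_mem: "(\<And>i. i \<in> A \<Longrightarrow> f i \<in> H) \<Longrightarrow> (\<lambda>x. \<Sum>i\<in>A. f i x) \<in> H"
  by (induction A rule: infinite_finite_induct) (simp_all add: zero_mem add_mem)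

lemma ip_zero: "g \<in> H \<Longrightarrow> ip (\<lambda>_. 0) g = 0"
  using ip_scale[OF zero_mem, of g 0] by simp

lemma ip_diff: "f \<in> H \<Longrightarrow> g \<in> H \<Longrightarrow> h \<in> H \<Longrightarrow> ip (\<lambda>x. f x - g x) h = ip f h - ip g h"
  using ip_add[OF _ scale_mem[of g "-1"], of f h] ip_scale[of g h "-1"] by simp

lemma ip_add_right: "f \<in> H \<Longrightarrow> g \<in> H \<Longrightarrow> h \<in> H \<Longrightarrow> ip h (\<lambda>x. f x + g x) = ip h f + ip h g"
  by (simp add: ip_commute[of h] add_mem ip_add)

lemma ip_diff_right: "f \<in> H \<Longrightarrow> g \<in> H \<Longrightarrow> h \<in> H \<Longrightarrow> ip h (\<lambda>x. f x - g x) = ip h f - ip h g"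
  by (simp add: ip_commute[of h] diff_mem ip_diff)

lemma ip_scale_right: "f \<in> H \<Longrightarrow> h \<in> H \<Longrightarrow> ip h (\<lambda>x. a * f x) = a * ip h f"
  by (simp add: ip_commute[of h] scale_mem ip_scale)

lemma ip_sum: "(\<And>i. i \<in> A \<Longrightarrow> f i \<in> H) \<Longrightarrow> h \<in> H \<Longrightarrow> ip (\<lambda>x. \<Sum>i\<in>A. f i x) h = (\<Sum>i\<in>A. ip (f i) h)"
  by (induction A rule: infinite_finite_induct) (simp_all add: ip_zero ip_add sum_mem)

lemma ip_sum_right: "(\<And>i. i \<in> A \<Longrightarrow> f i \<in> H) \<Longrightarrow> h \<in> H \<Longrightarrow> ip h (\<lambda>x. \<Sum>i\<in>A. f i x) = (\<Sum>i\<in>A. ip h (f i))"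
  by (simp add: ip_commute[of h] sum_mem ip_sum)

lemmas ip_simps = ip_add ip_add_right ip_diff ip_diff_right ip_scale ip_scale_right
  add_mem diff_mem scale_mem

lemma nrm_nonneg: "f \<in> H \<Longrightarrow> 0 \<le> nrm f"
  by (simp add: fun_norm_def ip_nonneg)

lemma nrm_square: "f \<in> H \<Longrightarrow> (nrm f)\<^sup>2 = ip f f"
  by (simp add: fun_norm_def ip_nonneg)

lemma nrm_scale: "f \<in> H \<Longrightarrow> nrm (\<lambda>x. a * f x) = \<bar>a\<bar> * nrm f"
  by (simp add: fun_norm_def ip_simps real_sqrt_mult flip: mult.assoc)

lemma ip_Cauchy_Schwarz:
  assumes f: "f \<in> H" and g: "g \<in> H" shows "\<bar>ip f g\<bar> \<le> nrm f * nrm g"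
proof (cases "ip g g = 0")
  case True
  then have "ip f g = 0"
    using ip_definite[OF g] ip_zero[OF f] ip_commute[OF f g] by simp
  then show ?thesis by (simp add: nrm_nonneg f g)
next
  case False
  then have pos: "0 < ip g g" using ip_nonneg[OF g] by simp
  define c where "c = ip f g / ip g g"
  have "0 \<le> ip (\<lambda>x. f x - c * g x) (\<lambda>x. f x - c * g x)"
    by (intro ip_nonneg diff_mem scale_mem f g)
  also have "\<dots> = ip f f - 2 * c * ip f g + c * c * ip g g"
    using f g by (simp add: ip_simps ip_commute[of g f] algebra_simps)
  also have "\<dots> = ip f f - (ip f g)\<^sup>2 / ip g g"
    using pos by (simp add: c_def field_simps power2_eq_square)
  finally have "(ip f g)\<^sup>2 \<le> ip f f * ip g g"
    using pos by (simp add: field_simps)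
  then have "sqrt ((ip f g)\<^sup>2) \<le> sqrt (ip f f * ip g g)" by (rule real_sqrt_le_mono)
  then show ?thesis by (simp add: fun_norm_def real_sqrt_mult)
qed

lemma nrm_triangle:
  assumes f: "f \<in> H" and g: "g \<in> H" shows "nrm (\<lambda>x. f x + g x) \<le> nrm f + nrm g"
proof (rule power2_le_imp_le)
  have "(nrm (\<lambda>x. f x + g x))\<^sup>2 = ip f f + 2 * ip f g + ip g g"
    using f g by (simp add: nrm_square ip_simps ip_commute[of g f])
  also have "\<dots> \<le> (nrm f + nrm g)\<^sup>2"
    using ip_Cauchy_Schwarz[OF f g] by (simp add: power2_sum nrm_square[symmetric] f g)
  finally show "(nrm (\<lambda>x. f x + g x))\<^sup>2 \<le> (nrm f + nrm g)\<^sup>2" .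
qed (simp add: nrm_nonneg f g)

text \<open>The form needed for minimising sequences: two vectors a, b almost closest to f must be
  close to each other, since their midpoint cannot be much closer to f.\<close>

lemma parallelogram:
  assumes "f \<in> H" "a \<in> H" "b \<in> H"
  shows "ip (\<lambda>x. a x - b x) (\<lambda>x. a x - b x) =
    2 * ip (\<lambda>x. f x - a x) (\<lambda>x. f x - a x) + 2 * ip (\<lambda>x. f x - b x) (\<lambda>x. f x - b x)
    - 4 * ip (\<lambda>x. f x - (1/2) * (a x + b x)) (\<lambda>x. f x - (1/2) * (a x + b x))"
proof -
  have "ip (\<lambda>x. f x - c * (a x + b x)) (\<lambda>x. f x - c * (a x + b x)) =
    ip f f - 2 * c * (ip f a + ip f b) + c * c * (ip a a + 2 * ip a b + ip b b)" for c
    using assms by (simp add: ip_simps ip_commute[of b a] ip_commute[of a f] ip_commute[of b f] algebra_simps)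
  from this[of "1/2"] show ?thesis
    using assms by (simp add: ip_simps ip_commute[of b a] ip_commute[of a f] ip_commute[of b f] field_simps)
qed

text \<open>Only rational scalars are required of \<open>W\<close>, so that \<open>W\<close> may be countable.\<close>

lemma projection:
  assumes W: "W \<subseteq> H" "W \<noteq> {}" and add: "\<And>u v. u \<in> W \<Longrightarrow> v \<in> W \<Longrightarrow> (\<lambda>x. u x + v x) \<in> W"
    and scale: "\<And>q u. q \<in> \<rat> \<Longrightarrow> u \<in> W \<Longrightarrow> (\<lambda>x. q * u x) \<in> W" and f: "f \<in> H"
  obtains p s where "p \<in> H" "\<And>m. s m \<in> W" "(\<lambda>m. nrm (\<lambda>x. s m x - p x)) \<longlonglongrightarrow> 0"
    "\<And>u. u \<in> W \<Longrightarrow> ip (\<lambda>x. f x - p x) u = 0"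
proof -
  define N where "N u = ip (\<lambda>x. f x - u x) (\<lambda>x. f x - u x)" for u
  define d where "d = (INF u\<in>W. N u)"
  have bdd: "bdd_below (N ` W)"
    using W f by (intro bdd_belowI2[of _ 0]) (auto simp: N_def intro!: ip_nonneg diff_mem)
  have d: "d \<le> N u" if "u \<in> W" for u
    unfolding d_def by (rule cINF_lower[OF bdd that])
  have "\<exists>u\<in>W. N u < d + inverse (real (Suc m))" for m
    using cINF_less_iff[OF W(2) bdd, of "d + inverse (real (Suc m))"] by (simp add: d_def)
  then obtain s where s: "\<And>m. s m \<in> W" "\<And>m. N (s m) < d + inverse (real (Suc m))"
    by metis
  have sH: "s m \<in> H" for m using s W by blast
  \<comment> \<open>The midpoint lies in W because 1/2 is rational, so its squared distance is at
    least d. In the parallelogram identity the multiples of d cancel and 4 e remains.\<close>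
  have close: "ip (\<lambda>x. s m x - s m' x) (\<lambda>x. s m x - s m' x) < 4 * e"
    if "inverse (real (Suc m)) < e" "inverse (real (Suc m')) < e" for m m' e
  proof -
    have "(1/2 :: real) \<in> \<rat>" by simp
    then have mid: "(\<lambda>x. (1/2) * (s m x + s m' x)) \<in> W"
      using scale[OF _ add[OF s(1)[of m] s(1)[of m']], of "1/2"] by simp
    show ?thesis
      using parallelogram[OF f sH[of m] sH[of m']] d[OF mid] s(2)[of m] s(2)[of m'] that
      unfolding N_def by linarith
  qed
  have "\<exists>p\<in>H. (\<lambda>m. nrm (\<lambda>x. s m x - p x)) \<longlonglongrightarrow> 0"
  proof (rule complete[OF sH])
    fix e :: real assume e: "0 < e"
    have "0 < e\<^sup>2 / 4" using e by simp
    then obtain m0 where m0: "inverse (real (Suc m0)) < e\<^sup>2 / 4"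
      using reals_Archimedean by blast
    have "nrm (\<lambda>x. s m x - s m' x) < e" if "m \<ge> m0" "m' \<ge> m0" for m m'
    proof -
      have "inverse (real (Suc i)) < e\<^sup>2 / 4" if "i \<ge> m0" for i
      proof -
        have "inverse (real (Suc i)) \<le> inverse (real (Suc m0))"
          using that by (intro le_imp_inverse_le) auto
        with m0 show ?thesis by linarith
      qed
      then have "ip (\<lambda>x. s m x - s m' x) (\<lambda>x. s m x - s m' x) < e\<^sup>2"
        using close[of m "e\<^sup>2 / 4" m'] that by simp
      then show ?thesis
        unfolding fun_norm_def using e by (intro real_less_lsqrt ip_nonneg diff_mem sH) auto
    qed
    then show "\<exists>m0. \<forall>m\<ge>m0. \<forall>m'\<ge>m0. nrm (\<lambda>x. s m x - s m' x) < e" by blast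
  qed
  then obtain p where p: "p \<in> H" "(\<lambda>m. nrm (\<lambda>x. s m x - p x)) \<longlonglongrightarrow> 0" by blast
  \<comment> \<open>First-order condition for the limit p: moving \<open>s m\<close> by
    \<open>q * u\<close> cannot bring the squared distance below d, and the slack 1/(m+1) of
    \<open>s m\<close> vanishes in the limit.\<close>
  have le: "2 * q * ip (\<lambda>x. f x - p x) u \<le> q\<^sup>2 * ip u u" if u: "u \<in> W" and q: "q \<in> \<rat>" for u q
  proof -
    have uH: "u \<in> H" using u W by blast
    have "(\<lambda>m. ip (\<lambda>x. s m x - p x) u) \<longlonglongrightarrow> 0"
    proof (rule Lim_null_comparison)
      show "(\<lambda>m. nrm (\<lambda>x. s m x - p x) * nrm u) \<longlonglongrightarrow> 0"
        using tendsto_mult_right[OF p(2), of "nrm u"] by (simp add: mult.commute)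
      show "\<forall>\<^sub>F m in sequentially. norm (ip (\<lambda>x. s m x - p x) u) \<le> nrm (\<lambda>x. s m x - p x) * nrm u"
        unfolding real_norm_def by (intro always_eventually allI ip_Cauchy_Schwarz diff_mem sH p uH)
    qed
    then have "(\<lambda>m. 2 * q * (ip (\<lambda>x. f x - p x) u - ip (\<lambda>x. s m x - p x) u) - q\<^sup>2 * ip u u)
        \<longlonglongrightarrow> 2 * q * (ip (\<lambda>x. f x - p x) u - 0) - q\<^sup>2 * ip u u"
      by (intro tendsto_intros)
    moreover have "(\<lambda>m. inverse (real (Suc m))) \<longlonglongrightarrow> 0"
      by (rule LIMSEQ_inverse_real_of_nat)
    moreover have "2 * q * (ip (\<lambda>x. f x - p x) u - ip (\<lambda>x. s m x - p x) u) - q\<^sup>2 * ip u u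
        \<le> inverse (real (Suc m))" for m
    proof -
      have "(\<lambda>x. s m x + q * u x) \<in> W" by (intro add scale s u q)
      then have "d \<le> N (\<lambda>x. s m x + q * u x)" by (rule d)
      also have "\<dots> = N (s m) - 2 * q * (ip f u - ip (s m) u) + q\<^sup>2 * ip u u"
        unfolding N_def using f sH[of m] uH
        by (simp add: ip_simps ip_commute[of u f] ip_commute[of u "s m"] ip_commute[of f "s m"]
            algebra_simps power2_eq_square)
      finally show ?thesis
        using s(2)[of m] f sH[of m] p(1) uH by (simp add: ip_diff algebra_simps)
    qed
    ultimately have "2 * q * (ip (\<lambda>x. f x - p x) u - 0) - q\<^sup>2 * ip u u \<le> 0"
      by (intro LIMSEQ_le) auto
    then show ?thesis by simp
  qed
  have "ip (\<lambda>x. f x - p x) u = 0" if u: "u \<in> W" for u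
  proof -
    let ?c = "ip (\<lambda>x. f x - p x) u"
    \<comment> \<open>Insert q = 1/(m+1) and its negative, then divide by 1/(m+1).\<close>
    have "\<bar>2 * ?c\<bar> \<le> inverse (real (Suc m)) * ip u u" for m
    proof -
      define r where "r = inverse (real (Suc m))"
      have r: "r \<in> \<rat>" "0 < r" by (simp_all add: r_def)
      then have "r * (2 * ?c) \<le> r * (r * ip u u)" "r * (- (2 * ?c)) \<le> r * (r * ip u u)"
        using le[OF u r(1)] le[OF u, of "- r"] by (simp_all add: power2_eq_square mult_ac)
      then show ?thesis
        using r(2) unfolding r_def[symmetric] by (simp only: mult_le_cancel_left_pos abs_le_iff)
    qed
    moreover have "(\<lambda>m. inverse (real (Suc m)) * ip u u) \<longlonglongrightarrow> 0"
      using tendsto_mult_right[OF LIMSEQ_inverse_real_of_nat] by simp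
    ultimately have "\<bar>2 * ?c\<bar> \<le> 0"
      by (intro LIMSEQ_le_const) auto
    then show ?thesis by simp
  qed
  with p s(1) show ?thesis by (intro that[of p s])
qed

lemma Bessel:
  assumes E: "finite E" "E \<subseteq> H" and orth: "\<And>e e'. e \<in> E \<Longrightarrow> e' \<in> E \<Longrightarrow> ip e e' = (if e = e' then 1 else 0)"
    and f: "f \<in> H"
  shows "(\<Sum>e\<in>E. (ip f e)\<^sup>2) \<le> ip f f"
proof -
  define g where "g = (\<lambda>x. \<Sum>e\<in>E. ip f e * e x)"
  have g: "g \<in> H" unfolding g_def by (intro sum_mem scale_mem) (use E in auto)
  have ipg: "ip h g = (\<Sum>e\<in>E. ip f e * ip h e)" if "h \<in> H" for h
  proof -
    have "ip h g = (\<Sum>e\<in>E. ip h (\<lambda>x. ip f e * e x))"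
      unfolding g_def by (rule ip_sum_right[OF scale_mem that]) (use E in auto)
    also have "\<dots> = (\<Sum>e\<in>E. ip f e * ip h e)"
      using E that by (intro sum.cong) (auto simp: ip_scale_right)
    finally show ?thesis .
  qed
  have "ip g e = ip f e" if "e \<in> E" for e
  proof -
    have "ip g e = ip e g" using that E g by (intro ip_commute) auto
    also have "\<dots> = (\<Sum>e'\<in>E. ip f e' * (if e = e' then 1 else 0))"
      using that E by (subst ipg) (auto intro!: sum.cong simp: orth)
    also have "\<dots> = ip f e"
      using E that by (simp add: if_distrib[where f="\<lambda>x. _ * x"] cong: if_cong)
    finally show ?thesis .
  qed
  then have gg: "ip g g = (\<Sum>e\<in>E. (ip f e)\<^sup>2)"
    by (simp add: ipg g power2_eq_square)
  have "0 \<le> ip (\<lambda>x. f x - g x) (\<lambda>x. f x - g x)" by (intro ip_nonneg diff_mem f g)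
  also have "\<dots> = ip f f - 2 * ip f g + ip g g"
    using f g by (simp add: ip_simps ip_commute[of g f])
  also have "ip f g = (\<Sum>e\<in>E. (ip f e)\<^sup>2)" by (simp add: ipg f power2_eq_square)
  finally show ?thesis by (simp add: gg)
qed

end

text \<open>Joint measurability of k makes combinations of sections at the sample points measurable
  in the sample and the argument together, and likewise their norms.\<close>

locale bounded_rkhs = rkhs "space X" k H ip
  for X :: "'x measure" and k H ip +
  fixes K :: real
  assumes k_measurable: "(\<lambda>(x, y). k x y) \<in> borel_measurable (X \<Otimes>\<^sub>M X)"
    and k_bound: "x \<in> space X \<Longrightarrow> fun_norm ip (kernel_section (space X) k x) \<le> K"
begin

abbreviation "\<phi> \<equiv> kernel_section (space X) k"

section \<open>Evaluation, measurability and Rademacher averages for a bounded kernel\<close>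

lemma ip_section: "x \<in> space X \<Longrightarrow> y \<in> space X \<Longrightarrow> ip (\<phi> x) (\<phi> y) = k x y"
  using kernel by (simp add: reproducing section_mem) (simp add: kernel_section_def pos_def_kernel_def)

text \<open>Cauchy-Schwarz against the section at x. Convergence in the norm of H is therefore
  uniform on \<open>space X\<close>.\<close>

lemma abs_eval_le: "f \<in> H \<Longrightarrow> x \<in> space X \<Longrightarrow> \<bar>f x\<bar> \<le> nrm f * K"
  using ip_Cauchy_Schwarz[of f "\<phi> x"] k_bound[of x] mult_left_mono[of "nrm (\<phi> x)" K "nrm f"]
  by (force simp: section_mem reproducing nrm_nonneg)

lemma section_measurable: "x \<in> space X \<Longrightarrow> \<phi> x \<in> borel_measurable X"
proof (subst measurable_cong)
  assume x: "x \<in> space X"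
  show "(\<lambda>y. k y x) \<in> borel_measurable X"
    using measurable_compose[OF _ k_measurable, of "\<lambda>y. (y, x)" X] x by simp
qed (simp add: kernel_section_def)

text \<open>Project f onto the measurable members of H. The projection p is a pointwise limit of
  such members, hence measurable; f - p is orthogonal to every section, since the sections are
  measurable members themselves, and so vanishes on \<open>space X\<close>. This argument works for
  non-separable H.\<close>

lemma H_measurable:
  assumes f: "f \<in> H" shows "f \<in> borel_measurable X"
proof -
  let ?W = "{h \<in> H. h \<in> borel_measurable X}"
  obtain p s where p: "p \<in> H" "\<And>m. s m \<in> ?W" "(\<lambda>m. nrm (\<lambda>x. s m x - p x)) \<longlonglongrightarrow> 0"
    and orth: "\<And>u. u \<in> ?W \<Longrightarrow> ip (\<lambda>x. f x - p x) u = 0"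
    by (rule projection[of ?W f]) (use f zero_mem in \<open>auto intro: add_mem scale_mem\<close>)
  have "p \<in> borel_measurable X"
  proof (rule borel_measurable_LIMSEQ_real)
    fix x assume x: "x \<in> space X"
    show "(\<lambda>m. s m x) \<longlonglongrightarrow> p x"
    proof (rule LIM_zero_cancel, rule Lim_null_comparison)
      show "(\<lambda>m. nrm (\<lambda>x. s m x - p x) * K) \<longlonglongrightarrow> 0"
        using tendsto_mult_left[OF p(3), of K] by (simp add: mult.commute)
      show "\<forall>\<^sub>F m in sequentially. norm (s m x - p x) \<le> nrm (\<lambda>x. s m x - p x) * K"
        using p(1,2) abs_eval_le[OF diff_mem x] by (auto intro!: always_eventually)
    qed
  qed (use p in auto)
  moreover have "f x = p x" if x: "x \<in> space X" for x
    using orth[of "\<phi> x"] x f p(1) by (simp add: section_mem section_measurable reproducing diff_mem)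
  ultimately show ?thesis by (subst measurable_cong) auto
qed

text \<open>By the reproducing property the signed sum is the inner product of h with
  \<open>v A\<close>, which does not involve h. The matrix m is the Gram matrix of the weighted
  sections, and its diagonal is at most K^2 times the squared weights.\<close>

lemma rademacher_ball_le:
  assumes I: "finite I" and x: "\<And>t. t \<in> I \<Longrightarrow> x t \<in> space X" and R: "0 \<le> R" and K: "0 \<le> K"
  shows "rademacher I (rkhs_ball H ip R) (\<lambda>t h. a t * h (x t)) \<le> R * K * sqrt (\<Sum>t\<in>I. (a t)\<^sup>2)"
proof -
  define m where "m s t = a s * a t * k (x s) (x t)" for s t
  define v where "v A = (\<lambda>y. \<Sum>t\<in>I. (rsign A t * a t) * \<phi> (x t) y)" for A
  have v: "v A \<in> H" for A
    unfolding v_def by (intro sum_mem scale_mem section_mem x)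
  have ip_v: "ip h (v A) = (\<Sum>t\<in>I. rsign A t * (a t * h (x t)))" if "h \<in> H" for A h
  proof -
    have "ip h (v A) = (\<Sum>t\<in>I. ip h (\<lambda>y. (rsign A t * a t) * \<phi> (x t) y))"
      unfolding v_def by (intro ip_sum_right that scale_mem section_mem x)
    also have "\<dots> = (\<Sum>t\<in>I. rsign A t * (a t * h (x t)))"
      using that x by (intro sum.cong refl) (simp add: ip_scale_right section_mem reproducing)
    finally show ?thesis .
  qed
  have vv: "ip (v A) (v A) = (\<Sum>s\<in>I. \<Sum>t\<in>I. rsign A s * rsign A t * m s t)" for A
  proof -
    have "ip (v A) (v A) = (\<Sum>s\<in>I. rsign A s * (a s * (\<Sum>t\<in>I. (rsign A t * a t) * \<phi> (x t) (x s))))"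
      by (subst ip_v[OF v]) (simp add: v_def)
    also have "\<dots> = (\<Sum>s\<in>I. \<Sum>t\<in>I. rsign A s * rsign A t * m s t)"
      using x by (intro sum.cong refl) (simp add: sum_distrib_left m_def kernel_section_def mult_ac)
    finally show ?thesis .
  qed
  have "rademacher I (rkhs_ball H ip R) (\<lambda>t h. a t * h (x t)) \<le> R * sqrt (\<Sum>t\<in>I. m t t)"
  proof (rule rademacher_le_quadratic[where m=m, OF I _ R])
    show "rkhs_ball H ip R \<noteq> {}"
      using zero_mem R by (auto simp: rkhs_ball_def fun_norm_def ip_zero intro!: exI[of _ "\<lambda>_. 0"])
    show "0 \<le> (\<Sum>s\<in>I. \<Sum>t\<in>I. rsign A s * rsign A t * m s t)" for A
      using ip_nonneg[OF v[of A]] by (simp only: vv)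
  next
    fix A h assume "h \<in> rkhs_ball H ip R"
    then have h: "h \<in> H" "nrm h \<le> R" by (auto simp: rkhs_ball_def)
    have "(\<Sum>t\<in>I. rsign A t * (a t * h (x t))) \<le> nrm h * nrm (v A)"
      using ip_Cauchy_Schwarz[OF h(1) v, of A] by (simp add: ip_v h)
    also have "\<dots> \<le> R * nrm (v A)" by (intro mult_right_mono h nrm_nonneg v)
    finally show "(\<Sum>t\<in>I. rsign A t * (a t * h (x t))) \<le>
        R * sqrt (\<Sum>s\<in>I. \<Sum>t\<in>I. rsign A s * rsign A t * m s t)"
      by (simp add: fun_norm_def vv)
  qed
  also have "(\<Sum>t\<in>I. m t t) \<le> K\<^sup>2 * (\<Sum>t\<in>I. (a t)\<^sup>2)"
    unfolding sum_distrib_left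
  proof (rule sum_mono)
    fix t assume t: "t \<in> I"
    have "k (x t) (x t) = (nrm (\<phi> (x t)))\<^sup>2"
      by (simp add: nrm_square section_mem ip_section x t)
    also have "\<dots> \<le> K\<^sup>2"
      by (intro power_mono k_bound nrm_nonneg section_mem x t)
    finally show "m t t \<le> K\<^sup>2 * (a t)\<^sup>2"
      by (simp add: m_def mult.commute[of "K\<^sup>2"] power2_eq_square[of "a t"] mult_left_mono)
  qed
  then have "R * sqrt (\<Sum>t\<in>I. m t t) \<le> R * sqrt (K\<^sup>2 * (\<Sum>t\<in>I. (a t)\<^sup>2))"
    by (intro mult_left_mono R) simp
  also have "\<dots> = R * K * sqrt (\<Sum>t\<in>I. (a t)\<^sup>2)"
    using K by (simp add: real_sqrt_mult)
  finally show ?thesis by simp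
qed

text \<open>The embedding of \<open>H\<close> into the spaces \<open>L\<^sup>2(\<mu> t)\<close> is Hilbert-Schmidt, since the kernel
  is bounded; so its kernel has a countable-dimensional complement even if \<open>H\<close> is not separable.\<close>

lemma countable_null_complement:
  fixes \<mu> :: "'t \<Rightarrow> 'x measure"
  assumes J: "finite J" and \<mu>: "\<And>t. t \<in> J \<Longrightarrow> prob_space (\<mu> t)" "\<And>t. t \<in> J \<Longrightarrow> sets (\<mu> t) = sets X"
  obtains E where "countable E" "E \<subseteq> H"
    "\<And>f t. f \<in> H \<Longrightarrow> (\<And>e. e \<in> E \<Longrightarrow> ip f e = 0) \<Longrightarrow> t \<in> J \<Longrightarrow> (\<integral>x. (f x)\<^sup>2 \<partial>\<mu> t) = 0"
proof -
  \<comment> \<open>The sum of the squared L2 norms; what has to be found is a countable E such that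
    every f orthogonal to E has Q f = 0.\<close>
  define Q where "Q f = (\<Sum>t\<in>J. \<integral>x. (f x)\<^sup>2 \<partial>\<mu> t)" for f :: "'x \<Rightarrow> real"
  have sp: "space (\<mu> t) = space X" if "t \<in> J" for t
    using \<mu>(2)[OF that] by (rule sets_eq_imp_space_eq)
  have int: "integrable (\<mu> t) (\<lambda>x. (f x)\<^sup>2)" if "t \<in> J" "f \<in> H" for t f
  proof (rule finite_measure.integrable_const_bound)
    show "finite_measure (\<mu> t)" using \<mu>(1)[OF that(1)] by (rule prob_space.finite_measure)
    show "AE x in \<mu> t. norm ((f x)\<^sup>2) \<le> (nrm f * K)\<^sup>2"
      using abs_eval_le[OF that(2)] sp[OF that(1)] abs_ge_self[of "nrm f * K"]
      by (intro AE_I2) (fastforce simp: abs_le_square_iff[symmetric] intro: order_trans)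
    have "f \<in> borel_measurable (\<mu> t)"
      using H_measurable[OF that(2)] by (simp add: measurable_cong_sets[OF \<mu>(2)[OF that(1)] refl])
    then show "(\<lambda>x. (f x)\<^sup>2) \<in> borel_measurable (\<mu> t)" by simp
  qed
  \<comment> \<open>Orthonormal systems on which Q is at least 1/(p+1) throughout.\<close>
  define on where "on p E \<longleftrightarrow> finite E \<and> E \<subseteq> H \<and> (\<forall>e\<in>E. 1 / real (Suc p) \<le> Q e) \<and>
     (\<forall>e\<in>E. \<forall>e'\<in>E. ip e e' = (if e = e' then 1 else 0))" for p E
  \<comment> \<open>A trace estimate: by Bessel's inequality for the section at x, the sum of the
    squares of e(x) over e in E is at most K^2. Integrating bounds the sum of Q over the system by
    \<open>card J\<close> times K^2, whereas every member contributes at least 1/(p+1).\<close>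
  have card_le: "real (card E) \<le> real (Suc p) * (real (card J) * K\<^sup>2)" if "on p E" for p E
  proof -
    have E: "finite E" "E \<subseteq> H" "\<And>e. e \<in> E \<Longrightarrow> 1 / real (Suc p) \<le> Q e"
        "\<And>e e'. e \<in> E \<Longrightarrow> e' \<in> E \<Longrightarrow> ip e e' = (if e = e' then 1 else 0)"
      using that by (auto simp: on_def)
    have "real (card E) / real (Suc p) = (\<Sum>e\<in>E. 1 / real (Suc p))" by simp
    also have "\<dots> \<le> (\<Sum>e\<in>E. Q e)" by (intro sum_mono E)
    also have "\<dots> = (\<Sum>t\<in>J. \<Sum>e\<in>E. \<integral>x. (e x)\<^sup>2 \<partial>\<mu> t)"
      unfolding Q_def by (rule sum.swap)
    also have "\<dots> \<le> (\<Sum>t\<in>J. K\<^sup>2)"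
    proof (rule sum_mono)
      fix t assume t: "t \<in> J"
      have "(\<Sum>e\<in>E. \<integral>x. (e x)\<^sup>2 \<partial>\<mu> t) = (\<integral>x. (\<Sum>e\<in>E. (e x)\<^sup>2) \<partial>\<mu> t)"
        using E int[OF t] by (intro Bochner_Integration.integral_sum[symmetric]) auto
      also have "\<dots> \<le> K\<^sup>2"
      proof (rule prob_space.integral_le_const[OF \<mu>(1)[OF t] _ AE_I2])
        show "integrable (\<mu> t) (\<lambda>x. \<Sum>e\<in>E. (e x)\<^sup>2)"
          using E int[OF t] by (intro Bochner_Integration.integrable_sum) auto
        fix x assume "x \<in> space (\<mu> t)"
        then have x: "x \<in> space X" by (simp add: sp t)
        have "(\<Sum>e\<in>E. (e x)\<^sup>2) = (\<Sum>e\<in>E. (ip (\<phi> x) e)\<^sup>2)"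
          using E(2) x by (intro sum.cong) (auto simp: ip_commute[OF section_mem] reproducing)
        also have "\<dots> \<le> (nrm (\<phi> x))\<^sup>2"
          using Bessel[OF E(1,2,4) section_mem[OF x]] by (simp add: nrm_square section_mem x)
        also have "\<dots> \<le> K\<^sup>2" by (intro power_mono k_bound nrm_nonneg section_mem x)
        finally show "(\<Sum>e\<in>E. (e x)\<^sup>2) \<le> K\<^sup>2" .
      qed
      finally show "(\<Sum>e\<in>E. \<integral>x. (e x)\<^sup>2 \<partial>\<mu> t) \<le> K\<^sup>2" .
    qed
    finally show ?thesis by (simp add: field_simps)
  qed
  \<comment> \<open>The uniform bound on the cardinality provides a largest such system for each p;
    their union over p is the set sought.\<close>
  have "\<exists>E. on p E \<and> (\<forall>E'. on p E' \<longrightarrow> card E' \<le> card E)" for p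
  proof -
    obtain b where b: "real (Suc p) * (real (card J) * K\<^sup>2) < real b" using reals_Archimedean2 by blast
    have "\<forall>E. on p E \<longrightarrow> card E < b" using card_le[of p] b by force
    moreover have "on p {}" by (simp add: on_def)
    ultimately show ?thesis by (intro ex_has_greatest_nat[of "on p" "{}" card b]) auto
  qed
  then obtain E where E: "\<And>p. on p (E p)" "\<And>p E'. on p E' \<Longrightarrow> card E' \<le> card (E p)" by metis
  show ?thesis
  proof (rule that[of "\<Union>p. E p"])
    show "countable (\<Union>p. E p)" "(\<Union>p. E p) \<subseteq> H"
      using E(1) unfolding on_def by (blast intro: countable_finite)+
  next
    fix f t assume f: "f \<in> H" and orth: "\<And>e. e \<in> (\<Union>p. E p) \<Longrightarrow> ip f e = 0" and t: "t \<in> J"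
    have "Q f \<le> 0"
    proof (rule ccontr)
      assume "\<not> Q f \<le> 0"
      then have Qf: "0 < Q f" by simp
      have f0: "ip f f \<noteq> 0"
      proof
        assume "ip f f = 0"
        then have "f = (\<lambda>_. 0)" by (rule ip_definite[OF f])
        with Qf show False by (simp add: Q_def)
      qed
      then have N: "0 < nrm f" using f ip_nonneg[OF f] by (simp add: fun_norm_def)
      \<comment> \<open>If Q f > 0, the normalised f is a unit vector orthogonal to every
        \<open>E p\<close>, and for some p it could be added to \<open>E p\<close>, against
        maximality.\<close>
      define g where "g = (\<lambda>x. (1 / nrm f) * f x)"
      have g: "g \<in> H" unfolding g_def by (rule scale_mem[OF f])
      have "Q g = Q f / (nrm f)\<^sup>2"
        unfolding Q_def g_def power_mult_distrib by (simp add: sum_divide_distrib power_divide)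
      with Qf N have "0 < Q g" by simp
      then obtain p where p: "inverse (real (Suc p)) < Q g" using reals_Archimedean by blast
      have gg: "ip g g = 1"
      proof -
        define a where "a = 1 / nrm f"
        have "ip g g = a * (a * ip f f)"
          unfolding g_def a_def[symmetric] using f by (simp add: ip_scale ip_scale_right scale_mem)
        then show ?thesis using f0 N nrm_square[OF f] by (simp add: a_def power2_eq_square)
      qed
      have ge: "ip g e = 0" if "e \<in> E p" for e
        using that E(1)[of p] orth[of e] f unfolding g_def
        by (subst ip_scale) (auto simp: on_def)
      then have ge': "ip e g = 0" if "e \<in> E p" for e
        using that E(1)[of p] ip_commute[OF g, of e] by (auto simp: on_def)
      have gE: "g \<notin> E p" using ge[of g] gg by auto
      have "on p (insert g (E p))"
        using E(1)[of p] g p gg ge ge' gE unfolding on_def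
        by (auto simp: inverse_eq_divide)
      from E(2)[OF this] gE E(1)[of p] show False
        by (simp add: on_def)
    qed
    moreover have "(\<integral>x. (f x)\<^sup>2 \<partial>\<mu> t) \<le> Q f"
      unfolding Q_def by (rule member_le_sum[OF t]) (use J in auto)
    moreover have "0 \<le> (\<integral>x. (f x)\<^sup>2 \<partial>\<mu> t)" by simp
    ultimately show "(\<integral>x. (f x)\<^sup>2 \<partial>\<mu> t) = 0" by linarith
  qed
qed

end

section \<open>Norms of projections and the separating family of a ball\<close>

context hilbert_function_space begin

text \<open>The vector p is only a limit of the \<open>s m\<close>, so orthogonality of f - p to p
  itself is obtained by passing to the limit; then Cauchy-Schwarz applies to ip p p = ip f
  p.\<close>

lemma nrm_projection_le:
  assumes f: "f \<in> H" and p: "p \<in> H" and s: "\<And>m. s m \<in> H" and lim: "(\<lambda>m. nrm (\<lambda>x. s m x - p x)) \<longlonglongrightarrow> 0"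
    and orth: "\<And>m. ip (\<lambda>x. f x - p x) (s m) = 0"
  shows "nrm p \<le> nrm f"
proof -
  have "\<bar>ip (\<lambda>x. f x - p x) p\<bar> \<le> nrm (\<lambda>x. f x - p x) * nrm (\<lambda>x. s m x - p x)" for m
  proof -
    have "ip (\<lambda>x. f x - p x) p = - ip (\<lambda>x. f x - p x) (\<lambda>x. s m x - p x)"
      using orth[of m] ip_diff_right[OF s[of m] p diff_mem[OF f p]] by simp
    then show ?thesis
      using ip_Cauchy_Schwarz[OF diff_mem[OF f p] diff_mem[OF s[of m] p]] by simp
  qed
  moreover have "(\<lambda>m. nrm (\<lambda>x. f x - p x) * nrm (\<lambda>x. s m x - p x)) \<longlonglongrightarrow> 0"
    using tendsto_mult_left[OF lim, of "nrm (\<lambda>x. f x - p x)"] by simp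
  ultimately have "\<bar>ip (\<lambda>x. f x - p x) p\<bar> \<le> 0"
    by (intro LIMSEQ_le_const) auto
  then have "ip p p = ip f p" using f p by (simp add: ip_diff)
  then have "nrm p * nrm p \<le> nrm f * nrm p"
    using ip_Cauchy_Schwarz[OF f p] nrm_square[OF p] by (simp add: power2_eq_square)
  then show ?thesis
    using nrm_nonneg[OF p] nrm_nonneg[OF f] mult_le_cancel_right[of "nrm p" "nrm p" "nrm f"] by linarith
qed

end

context bounded_rkhs begin

text \<open>A single projection p of h, onto the closed span of E together with the sections at the
  sample, agrees with h at the sample points and almost everywhere under each law. It is
  approximated in norm by rational combinations, which form a countable family with explicit
  dependence on the sample, and a retraction brings these back into the ball.\<close>

lemma separating_family_ball:
  fixes \<mu> :: "'t \<Rightarrow> 'x measure"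
  assumes I: "finite I" and \<mu>: "\<And>t. prob_space (\<mu> t)" and sets_\<mu>: "\<And>t. sets (\<mu> t) = sets X" and R: "0 \<le> R"
  shows "\<exists>\<gamma>. separating_family X (rkhs_ball H ip R) I \<mu> \<gamma>"
proof -
  obtain E where E: "countable E" "E \<subseteq> H" and null:
    "\<And>f t. f \<in> H \<Longrightarrow> (\<And>e. e \<in> E \<Longrightarrow> ip f e = 0) \<Longrightarrow> t \<in> I \<Longrightarrow> (\<integral>x. (f x)\<^sup>2 \<partial>\<mu> t) = 0"
    by (rule countable_null_complement[where \<mu>=\<mu>, OF I \<mu> sets_\<mu>]) (rule that; blast)
  have sp: "space (\<mu> t) = space X" for t
    using sets_\<mu> by (rule sets_eq_imp_space_eq)
  have x_sp: "x t \<in> space X" if "x \<in> space (PiM I \<mu>)" "t \<in> I" for x t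
    using that by (auto simp: space_PiM sp)
  \<comment> \<open>The rational span is written through lists, which makes its countability and its
    closure under addition immediate.\<close>
  define comb :: "(real \<times> ('x \<Rightarrow> real)) list \<Rightarrow> 'x \<Rightarrow> real"
    where "comb l y = (\<Sum>(q, e)\<leftarrow>l. q * e y)" for l y
  define W0 where "W0 = comb ` lists (\<rat> \<times> E)"
  have W0_H: "W0 \<subseteq> H"
  proof -
    have "comb l \<in> H" if "l \<in> lists (\<rat> \<times> E)" for l
      using that
    proof (induction l)
      case (Cons qe l)
      obtain q e where "qe = (q, e)" by (cases qe)
      with Cons E have "(\<lambda>y. q * e y + comb l y) \<in> H" by (intro add_mem scale_mem) auto
      then show ?case by (simp add: comb_def[abs_def] \<open>qe = (q, e)\<close>)
    qed (simp add: comb_def[abs_def] zero_mem)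
    then show ?thesis by (auto simp: W0_def)
  qed
  have W0_add: "(\<lambda>y. u y + v y) \<in> W0" if "u \<in> W0" "v \<in> W0" for u v
  proof -
    from that obtain l l' where l: "l \<in> lists (\<rat> \<times> E)" "l' \<in> lists (\<rat> \<times> E)" "u = comb l" "v = comb l'"
      by (auto simp: W0_def)
    then have "(\<lambda>y. u y + v y) = comb (l @ l')" by (simp add: comb_def fun_eq_iff)
    with l show ?thesis unfolding W0_def by (intro image_eqI[of _ _ "l @ l'"]) auto
  qed
  have W0_scale: "(\<lambda>y. q * u y) \<in> W0" if "q \<in> \<rat>" "u \<in> W0" for u q
  proof -
    from that obtain l where l: "l \<in> lists (\<rat> \<times> E)" "u = comb l" by (auto simp: W0_def)
    let ?l = "map (\<lambda>(r, e). (q * r, e)) l"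
    have "(\<lambda>y. q * u y) = comb ?l"
      by (simp add: l(2) comb_def fun_eq_iff sum_list_const_mult[symmetric] o_def case_prod_beta' mult.assoc)
    moreover have "?l \<in> lists (\<rat> \<times> E)" using l(1) that(1) by (induction l) auto
    ultimately show ?thesis unfolding W0_def by blast
  qed
  have W0_zero: "(\<lambda>_. 0) \<in> W0"
    unfolding W0_def by (rule image_eqI[of _ _ "[]"]) (auto simp: comb_def)
  have W0_E: "e \<in> W0" if "e \<in> E" for e
    unfolding W0_def using that by (intro image_eqI[of _ _ "[(1, e)]"]) (auto simp: comb_def)
  \<comment> \<open>An index is a fixed element of the rational span of E together with rational
    coefficients for the sections; the sections vary with the sample, so only their coefficients are
    enumerated.\<close>
  define Idx where "Idx = W0 \<times> (PiE I (\<lambda>_. \<rat> :: real set))"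
  have Idx: "countable Idx" "Idx \<noteq> {}"
  proof -
    have "countable W0"
      unfolding W0_def by (intro countable_image countable_lists countable_SIGMA countable_rat E)
    then show "countable Idx"
      unfolding Idx_def by (intro countable_SIGMA countable_PiE I countable_rat)
    have "((\<lambda>_. 0), \<lambda>t\<in>I. 0) \<in> Idx" by (auto simp: Idx_def W0_zero)
    then show "Idx \<noteq> {}" by blast
  qed
  define \<sigma> where "\<sigma> wb x = (\<lambda>y. fst wb y + (\<Sum>t\<in>I. snd wb t * \<phi> (x t) y))"
    for wb :: "('x \<Rightarrow> real) \<times> ('t \<Rightarrow> real)" and x
  \<comment> \<open>The squared norm of \<open>\<sigma> wb x\<close>. The inner product is an
    abstract function, so its measurability in x is obtained from this expansion, which leaves only
    kernel values and values of one fixed member of H.\<close>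
  define n2 where "n2 wb x = ip (fst wb) (fst wb) + 2 * (\<Sum>t\<in>I. snd wb t * fst wb (x t)) +
      (\<Sum>s\<in>I. snd wb s * (\<Sum>t\<in>I. snd wb t * k (x t) (x s)))"
    for wb :: "('x \<Rightarrow> real) \<times> ('t \<Rightarrow> real)" and x
  \<comment> \<open>Radial retraction onto the ball, because combinations close to p may lie
    slightly outside. For R = 0 the factor is 0, also in the case 0/0.\<close>
  define \<gamma> where "\<gamma> i x = (\<lambda>y. (R / max R (sqrt (n2 (from_nat_into Idx i) x))) * \<sigma> (from_nat_into Idx i) x y)"
    for i x
  have idx: "from_nat_into Idx i \<in> Idx" for i
    by (rule from_nat_into[OF Idx(2)])
  have sec_H: "(\<lambda>y. \<Sum>t\<in>I. b t * \<phi> (x t) y) \<in> H" if "x \<in> space (PiM I \<mu>)" for b x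
    using that by (intro sum_mem scale_mem section_mem x_sp)
  have \<sigma>_H: "\<sigma> wb x \<in> H" if "wb \<in> Idx" "x \<in> space (PiM I \<mu>)" for wb x
    unfolding \<sigma>_def using that W0_H by (intro add_mem sec_H) (auto simp: Idx_def)
  have ip_sec: "ip h (\<lambda>y. \<Sum>t\<in>I. b t * \<phi> (x t) y) = (\<Sum>t\<in>I. b t * h (x t))"
    if h: "h \<in> H" and x: "x \<in> space (PiM I \<mu>)" for h b x
  proof -
    have "ip h (\<lambda>y. \<Sum>t\<in>I. b t * \<phi> (x t) y) = (\<Sum>t\<in>I. ip h (\<lambda>y. b t * \<phi> (x t) y))"
      using x by (intro ip_sum_right h scale_mem section_mem x_sp)
    also have "\<dots> = (\<Sum>t\<in>I. b t * h (x t))"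
      using x_sp[OF x] h by (intro sum.cong refl) (simp add: ip_scale_right section_mem reproducing)
    finally show ?thesis .
  qed
  have n2: "ip (\<sigma> wb x) (\<sigma> wb x) = n2 wb x" if wb: "wb \<in> Idx" and x: "x \<in> space (PiM I \<mu>)" for wb x
  proof -
    let ?v = "\<lambda>y. \<Sum>t\<in>I. snd wb t * \<phi> (x t) y"
    have w: "fst wb \<in> H" using wb W0_H by (auto simp: Idx_def)
    have v: "?v \<in> H" by (rule sec_H[OF x])
    have "ip (\<sigma> wb x) (\<sigma> wb x) = ip (fst wb) (fst wb) + 2 * ip (fst wb) ?v + ip ?v ?v"
      unfolding \<sigma>_def using ip_commute[OF v w] w v by (simp only: ip_simps)
    also have "ip (fst wb) ?v = (\<Sum>t\<in>I. snd wb t * fst wb (x t))" by (rule ip_sec[OF w x])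
    also have "ip ?v ?v = (\<Sum>s\<in>I. snd wb s * (\<Sum>t\<in>I. snd wb t * \<phi> (x t) (x s)))" by (rule ip_sec[OF v x])
    also have "\<dots> = (\<Sum>s\<in>I. snd wb s * (\<Sum>t\<in>I. snd wb t * k (x t) (x s)))"
    proof (intro sum.cong refl arg_cong2[where f="(*)"])
      fix s t assume "s \<in> I" "t \<in> I"
      then have "x s \<in> space X" "x t \<in> space X" using x_sp[OF x] by auto
      then show "\<phi> (x t) (x s) = k (x t) (x s)"
        using reproducing[OF section_mem] ip_section by metis
    qed
    finally show ?thesis by (simp add: n2_def)
  qed
  have \<gamma>_scale: "nrm (\<lambda>y. \<gamma> i x y - \<sigma> (from_nat_into Idx i) x y) = max 0 (nrm (\<sigma> (from_nat_into Idx i) x) - R)"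
    and \<gamma>_mem: "\<gamma> i x \<in> rkhs_ball H ip R"
    if x: "x \<in> space (PiM I \<mu>)" for i x
  proof -
    let ?s = "\<sigma> (from_nat_into Idx i) x"
    define r where "r = R / max R (nrm ?s)"
    have s: "?s \<in> H" by (rule \<sigma>_H[OF idx x])
    have \<gamma>: "\<gamma> i x = (\<lambda>y. r * ?s y)"
      by (simp add: \<gamma>_def r_def fun_norm_def n2[OF idx x])
    have "(\<lambda>y. \<gamma> i x y - ?s y) = (\<lambda>y. (r - 1) * ?s y)" by (simp add: \<gamma> algebra_simps)
    then have "nrm (\<lambda>y. \<gamma> i x y - ?s y) = \<bar>r - 1\<bar> * nrm ?s" by (simp only: nrm_scale[OF s])
    also have "\<dots> = max 0 (nrm ?s - R)"
    proof (cases "nrm ?s \<le> R")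
      case True
      then show ?thesis using nrm_nonneg[OF s] R by (cases "R = 0") (auto simp: r_def max_def)
    next
      case False
      then have "0 < nrm ?s" "r = R / nrm ?s" "r \<le> 1" using R by (auto simp: r_def max_def)
      then show ?thesis using False by (auto simp: abs_if field_simps)
    qed
    finally show "nrm (\<lambda>y. \<gamma> i x y - ?s y) = max 0 (nrm ?s - R)" .
    have "nrm (\<gamma> i x) = r * nrm ?s"
      unfolding \<gamma> nrm_scale[OF s] using R by (simp add: r_def)
    also have "\<dots> \<le> R"
    proof (cases "nrm ?s \<le> R")
      case True
      then show ?thesis using nrm_nonneg[OF s] R by (cases "R = 0") (auto simp: r_def max_def)
    next
      case False
      then show ?thesis using R by (auto simp: r_def max_def)
    qed
    finally show "\<gamma> i x \<in> rkhs_ball H ip R"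
      unfolding rkhs_ball_def using scale_mem[OF s, of r] \<gamma> by simp
  qed
  have comp: "(\<lambda>x. x t) \<in> PiM I \<mu> \<rightarrow>\<^sub>M X" if "t \<in> I" for t
    using measurable_component_singleton[OF that, of \<mu>] by (simp add: measurable_cong_sets[OF refl sets_\<mu>])
  have k_meas: "(\<lambda>z. k (f z) (g z)) \<in> borel_measurable M" if "f \<in> M \<rightarrow>\<^sub>M X" "g \<in> M \<rightarrow>\<^sub>M X" for f g M
    using measurable_compose[OF measurable_Pair[OF that] k_measurable] by simp
  have n2_meas: "n2 wb \<in> borel_measurable (PiM I \<mu>)" if "wb \<in> Idx" for wb
  proof -
    have "fst wb \<in> borel_measurable X" using that W0_H by (intro H_measurable) (auto simp: Idx_def)
    then show ?thesis
      unfolding n2_def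
      by (intro borel_measurable_add borel_measurable_sum borel_measurable_times borel_measurable_const
          k_meas comp) (auto intro: measurable_compose[OF comp])
  qed
  have \<sigma>_meas: "(\<lambda>(x, y). \<sigma> wb x y) \<in> borel_measurable (PiM I \<mu> \<Otimes>\<^sub>M X)" if "wb \<in> Idx" for wb
  proof -
    have "fst wb \<in> borel_measurable X" using that W0_H by (intro H_measurable) (auto simp: Idx_def)
    then have "(\<lambda>z. fst wb (snd z) + (\<Sum>t\<in>I. snd wb t * k (snd z) (fst z t))) \<in> borel_measurable (PiM I \<mu> \<Otimes>\<^sub>M X)"
      by (intro borel_measurable_add borel_measurable_sum borel_measurable_times borel_measurable_const
          k_meas measurable_compose[OF measurable_fst comp] measurable_snd
          measurable_compose[OF measurable_snd])
    then show ?thesis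
    proof (rule measurable_cong[THEN iffD1, rotated])
      fix z assume "z \<in> space (PiM I \<mu> \<Otimes>\<^sub>M X)"
      then show "fst wb (snd z) + (\<Sum>t\<in>I. snd wb t * k (snd z) (fst z t)) = (case z of (x, y) \<Rightarrow> \<sigma> wb x y)"
        by (cases z) (simp add: \<sigma>_def kernel_section_def space_pair_measure)
    qed
  qed
  have "separating_family X (rkhs_ball H ip R) I \<mu> \<gamma>"
    unfolding separating_family_def
  proof (intro conjI allI ballI impI)
    fix i
    show "(\<lambda>(x, y). \<gamma> i x y) \<in> borel_measurable (PiM I \<mu> \<Otimes>\<^sub>M X)"
      unfolding \<gamma>_def case_prod_beta'
      using measurable_compose[OF measurable_fst n2_meas[OF idx[of i]]] \<sigma>_meas[OF idx[of i]]
      by (intro borel_measurable_times borel_measurable_divide borel_measurable_max borel_measurable_const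
          measurable_compose[OF _ borel_measurable_sqrt]) (simp_all add: case_prod_beta')
    show "\<gamma> i x \<in> rkhs_ball H ip R" if "x \<in> space (PiM I \<mu>)" for x
      by (rule \<gamma>_mem[OF that])
  next
    fix x h and e :: real
    assume x: "x \<in> space (PiM I \<mu>)" and hR: "h \<in> rkhs_ball H ip R" and e: "0 < e"
    have h: "h \<in> H" "nrm h \<le> R" using hR by (auto simp: rkhs_ball_def)
    define W where "W = (\<lambda>wb. \<sigma> wb x) ` Idx"
    have W_H: "W \<subseteq> H" using \<sigma>_H[OF _ x] by (auto simp: W_def)
    have W_I: "(\<lambda>y. w y + (\<Sum>t\<in>I. b t * \<phi> (x t) y)) \<in> W" if "w \<in> W0" "\<And>t. t \<in> I \<Longrightarrow> b t \<in> \<rat>" for w b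
      unfolding W_def
    proof (rule image_eqI[of _ _ "(w, restrict b I)"])
      show "(w, restrict b I) \<in> Idx" using that by (auto simp: Idx_def)
      show "(\<lambda>y. w y + (\<Sum>t\<in>I. b t * \<phi> (x t) y)) = \<sigma> (w, restrict b I) x"
        by (simp add: \<sigma>_def cong: sum.cong)
    qed
    have W_E: "\<exists>w\<in>W0. \<exists>b. (\<forall>t\<in>I. b t \<in> \<rat>) \<and> u = (\<lambda>y. w y + (\<Sum>t\<in>I. b t * \<phi> (x t) y))" if u: "u \<in> W" for u
    proof -
      from u obtain w b where wb: "(w, b) \<in> Idx" and u: "u = \<sigma> (w, b) x"
        unfolding W_def by auto
      from wb have "w \<in> W0" "\<forall>t\<in>I. b t \<in> \<rat>" by (auto simp: Idx_def)
      with u show ?thesis unfolding \<sigma>_def by auto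
    qed
    obtain p s where p: "p \<in> H" "\<And>m. s m \<in> W" "(\<lambda>m. nrm (\<lambda>x. s m x - p x)) \<longlonglongrightarrow> 0"
      and orth: "\<And>u. u \<in> W \<Longrightarrow> ip (\<lambda>x. h x - p x) u = 0"
    proof (rule projection[OF W_H])
      show "W \<noteq> {}" using Idx(2) by (simp add: W_def)
      fix u assume u: "u \<in> W"
      obtain w b where wb: "w \<in> W0" "\<forall>t\<in>I. b t \<in> \<rat>" "u = (\<lambda>y. w y + (\<Sum>t\<in>I. b t * \<phi> (x t) y))"
        using W_E[OF u] by blast
      show "(\<lambda>y. u y + v y) \<in> W" if v: "v \<in> W" for v
      proof -
        obtain w' b' where wb': "w' \<in> W0" "\<forall>t\<in>I. b' t \<in> \<rat>" "v = (\<lambda>y. w' y + (\<Sum>t\<in>I. b' t * \<phi> (x t) y))"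
          using W_E[OF v] by blast
        have "(\<lambda>y. u y + v y) = (\<lambda>y. (w y + w' y) + (\<Sum>t\<in>I. (b t + b' t) * \<phi> (x t) y))"
          by (simp add: wb(3) wb'(3) fun_eq_iff distrib_right sum.distrib)
        also have "\<dots> \<in> W"
          using wb wb' by (intro W_I W0_add) auto
        finally show ?thesis .
      qed
      show "(\<lambda>y. q * u y) \<in> W" if q: "q \<in> \<rat>" for q
      proof -
        have "(\<lambda>y. q * u y) = (\<lambda>y. (q * w y) + (\<Sum>t\<in>I. (q * b t) * \<phi> (x t) y))"
          by (simp add: wb(3) fun_eq_iff distrib_left sum_distrib_left mult.assoc)
        also have "\<dots> \<in> W"
          using wb q by (intro W_I W0_scale) auto
        finally show ?thesis .
      qed
    qed (use h in auto)
    have sH: "s m \<in> H" for m using p(2) W_H by blast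
    have pR: "nrm p \<le> R"
      using nrm_projection_le[OF h(1) p(1) sH p(3) orth[OF p(2)]] h(2) by simp
    \<comment> \<open>The section at a sample point belongs to W, by the coefficient 1 at t and 0
      elsewhere, so h - p is orthogonal to it.\<close>
    have eq_sample: "p (x t) = h (x t)" if t: "t \<in> I" for t
    proof -
      have "(\<lambda>y. 0 + (\<Sum>t'\<in>I. (if t' = t then 1 else 0) * \<phi> (x t') y)) \<in> W"
        by (intro W_I W0_zero) auto
      then have "\<phi> (x t) \<in> W"
        using I t by (simp add: if_distrib[where f="\<lambda>c. c * _"] cong: if_cong)
      then show ?thesis
        using orth[of "\<phi> (x t)"] h p x_sp[OF x t] by (simp add: reproducing diff_mem)
    qed
    \<comment> \<open>Here E was chosen for this purpose: h - p is orthogonal to E, so it has L2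
      norm 0.\<close>
    have eq_ae: "AE y in \<mu> t. h y = p y" if t: "t \<in> I" for t
    proof -
      have hp: "(\<lambda>y. h y - p y) \<in> H" by (intro diff_mem h p)
      have "ip (\<lambda>y. h y - p y) e = 0" if "e \<in> E" for e
      proof (rule orth)
        show "e \<in> W" using W_I[OF W0_E[OF that], of "\<lambda>_. 0"] by simp
      qed
      then have "(\<integral>y. (h y - p y)\<^sup>2 \<partial>\<mu> t) = 0"
        using null[OF hp _ t] by blast
      moreover have m: "(\<lambda>y. h y - p y) \<in> borel_measurable (\<mu> t)"
        using H_measurable[OF hp] by (simp add: measurable_cong_sets[OF sets_\<mu> refl])
      moreover have "integrable (\<mu> t) (\<lambda>y. (h y - p y)\<^sup>2)"
      proof (rule finite_measure.integrable_const_bound)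
        show "finite_measure (\<mu> t)" using \<mu> by (rule prob_space.finite_measure)
        show "AE y in \<mu> t. norm ((h y - p y)\<^sup>2) \<le> (nrm (\<lambda>y. h y - p y) * K)\<^sup>2"
          using abs_eval_le[OF hp] abs_ge_self[of "nrm (\<lambda>y. h y - p y) * K"]
          by (intro AE_I2) (fastforce simp: sp abs_le_square_iff[symmetric] intro: order_trans)
      qed (use m in simp)
      ultimately show ?thesis
        by (subst (asm) integral_nonneg_eq_0_iff_AE) auto
    qed
    \<comment> \<open>As p lies in the ball, \<open>s m\<close> leaves it by less than \<tau>, and
      the retraction moves it by at most \<tau>. The total error 2 \<tau> in norm becomes at most e
      in values; the summand 1 keeps the denominator positive.\<close>
    define \<tau> where "\<tau> = e / (2 * (\<bar>K\<bar> + 1))"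
    have \<tau>: "0 < \<tau>" using e by (simp add: \<tau>_def)
    obtain m where m: "nrm (\<lambda>y. s m y - p y) < \<tau>"
      using order_tendstoD(2)[OF p(3) \<tau>] by (auto simp: eventually_sequentially)
    obtain i where i: "s m = \<sigma> (from_nat_into Idx i) x"
    proof -
      from p(2)[of m] obtain wb where wb: "wb \<in> Idx" "s m = \<sigma> wb x" by (auto simp: W_def)
      from from_nat_into_surj[OF Idx(1) wb(1)] obtain i where "from_nat_into Idx i = wb" by blast
      with wb(2) that show thesis by auto
    qed
    have \<gamma>H: "\<gamma> i x \<in> H" using \<gamma>_mem[OF x, of i] by (simp add: rkhs_ball_def)
    have \<gamma>p: "(\<lambda>y. \<gamma> i x y - p y) \<in> H" by (intro diff_mem \<gamma>H p)
    have "nrm (s m) \<le> nrm (\<lambda>y. s m y - p y) + nrm p"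
      using nrm_triangle[OF diff_mem[OF sH[of m] p(1)] p(1)] by simp
    then have "nrm (\<lambda>y. \<gamma> i x y - s m y) \<le> \<tau>"
      using \<gamma>_scale[OF x, of i] m pR \<tau> unfolding i by linarith
    then have "nrm (\<lambda>y. \<gamma> i x y - p y) \<le> 2 * \<tau>"
      using nrm_triangle[OF diff_mem[OF \<gamma>H sH[of m]] diff_mem[OF sH[of m] p(1)]] m by simp
    then have close: "\<bar>\<gamma> i x y - p y\<bar> \<le> e" if y: "y \<in> space X" for y
    proof -
      have "\<bar>\<gamma> i x y - p y\<bar> \<le> nrm (\<lambda>y. \<gamma> i x y - p y) * K" by (rule abs_eval_le[OF \<gamma>p y])
      also have "\<dots> \<le> nrm (\<lambda>y. \<gamma> i x y - p y) * (\<bar>K\<bar> + 1)"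
        by (intro mult_left_mono nrm_nonneg \<gamma>p) simp
      also have "\<dots> \<le> 2 * \<tau> * (\<bar>K\<bar> + 1)"
        by (intro mult_right_mono) (use \<open>nrm (\<lambda>y. \<gamma> i x y - p y) \<le> 2 * \<tau>\<close> in auto)
      also have "\<dots> = e" by (simp add: \<tau>_def field_simps) 
      finally show ?thesis .
    qed
    show "\<exists>i. \<forall>t\<in>I. \<bar>\<gamma> i x (x t) - h (x t)\<bar> \<le> e \<and> (\<integral>y. \<bar>\<gamma> i x y - h y\<bar> \<partial>\<mu> t) \<le> e"
    proof (intro exI[of _ i] ballI conjI)
      fix t assume t: "t \<in> I"
      show "\<bar>\<gamma> i x (x t) - h (x t)\<bar> \<le> e"
        using close[OF x_sp[OF x t]] by (simp add: eq_sample[OF t])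
      have meas: "f \<in> borel_measurable (\<mu> t)" if "f \<in> H" for f
        using H_measurable[OF that] by (simp add: measurable_cong_sets[OF sets_\<mu> refl])
      have "(\<integral>y. \<bar>\<gamma> i x y - h y\<bar> \<partial>\<mu> t) = (\<integral>y. \<bar>\<gamma> i x y - p y\<bar> \<partial>\<mu> t)"
        by (rule integral_cong_AE) (use eq_ae[OF t] meas \<gamma>H h p in auto)
      also have "\<dots> \<le> e"
      proof (rule prob_space.integral_le_const[OF \<mu> _ AE_I2])
        show "integrable (\<mu> t) (\<lambda>y. \<bar>\<gamma> i x y - p y\<bar>)"
        proof (rule finite_measure.integrable_const_bound)
          show "finite_measure (\<mu> t)" using \<mu> by (rule prob_space.finite_measure)
          show "AE y in \<mu> t. norm \<bar>\<gamma> i x y - p y\<bar> \<le> e" using close by (intro AE_I2) (simp add: sp)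
        qed (use meas[OF \<gamma>p] in simp)
      qed (use close sp in auto)
      finally show "(\<integral>y. \<bar>\<gamma> i x y - h y\<bar> \<partial>\<mu> t) \<le> e" .
    qed
  qed
  then show ?thesis by blast
qed

end

section \<open>Multilayer perceptrons\<close>

text \<open>The assumption \<open>\<mu>_zero\<close> yields, in each layer, the element on which all
  terms of the activated Rademacher sums vanish, as \<open>rademacher_abs\<close> requires.\<close>

locale bounded_mlp =
  fixes D :: "(real ^ 'd) set" and \<alpha> \<beta> :: real and \<mu> :: "real \<Rightarrow> real"
  assumes D_bound: "x \<in> D \<Longrightarrow> norm x \<le> \<alpha>" and \<beta>_pos: "0 < \<beta>"
    and \<mu>_lipschitz: "1-lipschitz_on UNIV \<mu>"
    and \<mu>_zero: "1 \<le> m \<Longrightarrow> \<exists>h\<in>mlp \<beta> \<mu> m. \<forall>x\<in>D. \<mu> (h x) = 0"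
begin

abbreviation MLP :: "nat \<Rightarrow> (real ^ 'd \<Rightarrow> real) set" where "MLP \<equiv> mlp \<beta> \<mu>"

section \<open>Size, continuity and countable density of the perceptron classes\<close>

lemma \<mu>_diff_le: "\<bar>\<mu> a - \<mu> b\<bar> \<le> \<bar>a - b\<bar>"
  using lipschitz_onD[OF \<mu>_lipschitz, of a b] by (simp add: dist_real_def)

lemma mlp_Suc:
  assumes "1 \<le> m"
  shows "MLP (Suc m) =
    {(\<lambda>x. \<Sum>j\<in>UNIV. v $ j * \<mu> (f j x)) | (v :: real ^ 'd) f. (\<Sum>j\<in>UNIV. \<bar>v $ j\<bar>) \<le> \<beta> \<and> (\<forall>j. f j \<in> MLP m)}"
  using assms by (cases m) simp_all

lemma mlp_SucE:
  assumes "1 \<le> m" "h \<in> MLP (Suc m)"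
  obtains v :: "real ^ 'd" and f where "h = (\<lambda>x. \<Sum>j\<in>UNIV. v $ j * \<mu> (f j x))"
    "(\<Sum>j\<in>UNIV. \<bar>v $ j\<bar>) \<le> \<beta>" "\<And>j. f j \<in> MLP m"
  using assms(2) unfolding mlp_Suc[OF assms(1)] by blast

text \<open>Obtained from zero outer weights. It concerns the network itself, in contrast to
  \<open>\<mu>_zero\<close>, which concerns its value after activation.\<close>

lemma mlp_zero: "1 \<le> m \<Longrightarrow> \<exists>z\<in>MLP m. \<forall>x :: real ^ 'd. z x = 0"
proof (induction m rule: nat_induct_at_least)
  case base
  have "(\<lambda>x :: real ^ 'd. x \<bullet> 0) \<in> MLP 1" using \<beta>_pos by (auto intro!: exI[of _ 0])
  then show ?case by (rule bexI[rotated]) simp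
next
  case (Suc m)
  then obtain z where z: "z \<in> MLP m" by blast
  have "(\<lambda>x :: real ^ 'd. \<Sum>j\<in>UNIV. 0 $ j * \<mu> (z x)) \<in> MLP (Suc m)"
    unfolding mlp_Suc[OF Suc.hyps] using z \<beta>_pos
    by (intro CollectI exI[of _ 0] exI[of _ "\<lambda>_. z"]) simp
  then show ?case by (rule bexI[rotated]) simp
qed

text \<open>Hoelder's inequality for the l1 ball of outer weights. It gives the size of a layer, the
  stability under perturbing units, and the reduction of a layer to a single unit.\<close>

lemma sum_abs_mult_le:
  fixes v :: "real ^ 'd"
  assumes "(\<Sum>j\<in>UNIV. \<bar>v $ j\<bar>) \<le> \<beta>" "\<And>j. \<bar>s j\<bar> \<le> c" "0 \<le> c"
  shows "\<bar>\<Sum>j\<in>UNIV. v $ j * s j\<bar> \<le> \<beta> * c"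
proof -
  have "\<bar>\<Sum>j\<in>UNIV. v $ j * s j\<bar> \<le> (\<Sum>j\<in>UNIV. \<bar>v $ j\<bar> * c)"
    by (rule order_trans[OF sum_abs]) (auto simp: abs_mult intro!: sum_mono mult_left_mono assms)
  also have "\<dots> \<le> \<beta> * c"
    unfolding sum_distrib_right[symmetric] by (intro mult_right_mono assms)
  finally show ?thesis .
qed

lemma mlp_bounded: "1 \<le> m \<Longrightarrow> \<exists>c\<ge>0. \<forall>h\<in>MLP m. \<forall>x\<in>D. \<bar>h x\<bar> \<le> c"
proof (induction m rule: nat_induct_at_least)
  case base
  have "\<bar>x \<bullet> v\<bar> \<le> \<bar>\<alpha>\<bar> * \<beta>" if "x \<in> D" "norm v \<le> \<beta>" for x v
  proof -
    have "norm x * norm v \<le> \<bar>\<alpha>\<bar> * \<beta>"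
      using D_bound[OF that(1)] by (intro mult_mono that) auto
    then show ?thesis using Cauchy_Schwarz_ineq2[of x v] by simp
  qed
  then show ?case using \<beta>_pos by (intro exI[of _ "\<bar>\<alpha>\<bar> * \<beta>"]) auto
next
  case (Suc m)
  then obtain c where c: "0 \<le> c" "\<And>h x. h \<in> MLP m \<Longrightarrow> x \<in> D \<Longrightarrow> \<bar>h x\<bar> \<le> c" by blast
  show ?case
  proof (intro exI[of _ "\<beta> * (\<bar>\<mu> 0\<bar> + c)"] conjI ballI)
    show "0 \<le> \<beta> * (\<bar>\<mu> 0\<bar> + c)" using \<beta>_pos c by simp
    fix h x assume h: "h \<in> MLP (Suc m)" and x: "x \<in> D"
    obtain v :: "real ^ 'd" and f
      where h: "h = (\<lambda>x. \<Sum>j\<in>UNIV. v $ j * \<mu> (f j x))" "(\<Sum>j\<in>UNIV. \<bar>v $ j\<bar>) \<le> \<beta>"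
        "\<And>j. f j \<in> MLP m" by (rule mlp_SucE[OF Suc.hyps h]) (rule that)
    have "\<bar>\<mu> (f j x)\<bar> \<le> \<bar>\<mu> 0\<bar> + c" for j
      using \<mu>_diff_le[of "f j x" 0] c(2)[OF h(3)[of j] x] by linarith
    then show "\<bar>h x\<bar> \<le> \<beta> * (\<bar>\<mu> 0\<bar> + c)"
      unfolding h(1) using c by (intro sum_abs_mult_le h) auto
  qed
qed

lemma mlp_continuous: "1 \<le> m \<Longrightarrow> h \<in> MLP m \<Longrightarrow> continuous_on UNIV (h :: real ^ 'd \<Rightarrow> real)"
proof (induction m arbitrary: h rule: nat_induct_at_least)
  case base
  then show ?case by (auto intro!: continuous_intros)
next
  case (Suc m)
  obtain v :: "real ^ 'd" and f
    where h: "h = (\<lambda>x. \<Sum>j\<in>UNIV. v $ j * \<mu> (f j x))" "\<And>j. f j \<in> MLP m"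
    by (rule mlp_SucE[OF Suc.hyps Suc.prems]) (rule that)
  have "continuous_on UNIV (\<lambda>x. \<mu> (f j x))" for j
    by (rule continuous_on_compose2[OF lipschitz_on_continuous_on[OF \<mu>_lipschitz] Suc.IH[OF h(2)]]) simp
  then show ?case unfolding h by (intro continuous_intros)
qed

lemma mlp_measurable: "1 \<le> m \<Longrightarrow> h \<in> MLP m \<Longrightarrow> h \<in> borel_measurable (restrict_space borel D)"
  by (rule borel_measurable_continuous_on_restrict) (rule continuous_on_subset[OF mlp_continuous], auto)

text \<open>Induction on the depth, with density in the uniform norm on D. The weights come from a
  countable dense subset of the admissible weights itself, so the approximating networks stay in the
  class; as a layer has finitely many units, the choices of inner networks remain countable.\<close>

lemma mlp_countable_dense:
  "1 \<le> m \<Longrightarrow> \<exists>Q\<subseteq>MLP m. countable Q \<and>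
     (\<forall>h\<in>MLP m. \<forall>e>0. \<exists>q\<in>Q. \<forall>x\<in>D. \<bar>h x - q x\<bar> \<le> e)"
proof (induction m rule: nat_induct_at_least)
  case base
  obtain B :: "(real ^ 'd) set" where B: "countable B" "B \<subseteq> cball 0 \<beta>" "cball 0 \<beta> \<subseteq> closure B"
    by (rule separable)
  have "\<exists>v\<in>B. \<forall>x\<in>D. \<bar>h x - x \<bullet> v\<bar> \<le> e" if hm: "h \<in> MLP 1" and e: "0 < e" for h e
  proof -
    from hm obtain v where h: "h = (\<lambda>x. x \<bullet> v)" "norm v \<le> \<beta>" by auto
    then have "v \<in> closure B" using B(3) by auto
    moreover have "0 < e / (\<bar>\<alpha>\<bar> + 1)" using e by simp
    ultimately obtain v' where v': "v' \<in> B" "dist v' v < e / (\<bar>\<alpha>\<bar> + 1)"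
      unfolding closure_approachable by blast
    have "\<bar>h x - x \<bullet> v'\<bar> \<le> e" if x: "x \<in> D" for x
    proof -
      have "\<bar>h x - x \<bullet> v'\<bar> = \<bar>x \<bullet> (v - v')\<bar>" by (simp add: h inner_diff_right)
      also have "\<dots> \<le> norm x * norm (v - v')" by (rule Cauchy_Schwarz_ineq2)
      also have "\<dots> \<le> (\<bar>\<alpha>\<bar> + 1) * (e / (\<bar>\<alpha>\<bar> + 1))"
        using v'(2) D_bound[OF x] by (intro mult_mono) (auto simp: dist_norm norm_minus_commute)
      finally show ?thesis by simp
    qed
    with v'(1) show ?thesis by blast
  qed
  then show ?case
    using B by (intro exI[of _ "(\<lambda>v x. x \<bullet> v) ` B"]) (auto simp: subset_iff)
next
  case (Suc m)
  then obtain Q where Q: "Q \<subseteq> MLP m" "countable Q"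
    and dense: "\<And>h e. h \<in> MLP m \<Longrightarrow> 0 < e \<Longrightarrow> \<exists>q\<in>Q. \<forall>x\<in>D. \<bar>h x - q x\<bar> \<le> e" by blast
  obtain c where c: "0 \<le> c" "\<And>h x. h \<in> MLP m \<Longrightarrow> x \<in> D \<Longrightarrow> \<bar>h x\<bar> \<le> c"
    using mlp_bounded[OF Suc.hyps] by blast
  let ?V = "{v :: real ^ 'd. (\<Sum>j\<in>UNIV. \<bar>v $ j\<bar>) \<le> \<beta>}"
  obtain B where B: "countable B" "B \<subseteq> ?V" "?V \<subseteq> closure B" by (rule separable)
  define net where "net = (\<lambda>(v :: real ^ 'd, f) x. \<Sum>j\<in>UNIV. v $ j * \<mu> (f j (x :: real ^ 'd)))"
  define Q' where "Q' = net ` (B \<times> (PiE UNIV (\<lambda>_. Q)))"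
  show ?case
  proof (intro exI[of _ Q'] conjI ballI allI impI)
    show "Q' \<subseteq> MLP (Suc m)"
      unfolding Q'_def mlp_Suc[OF Suc.hyps] net_def using B(2) Q(1) by fastforce
    show "countable Q'"
      unfolding Q'_def by (intro countable_image countable_SIGMA countable_PiE B Q) auto
  next
    fix h and e :: real assume h: "h \<in> MLP (Suc m)" and e: "0 < e"
    obtain v :: "real ^ 'd" and f
      where h: "h = (\<lambda>x. \<Sum>j\<in>UNIV. v $ j * \<mu> (f j x))" "(\<Sum>j\<in>UNIV. \<bar>v $ j\<bar>) \<le> \<beta>"
        "\<And>j. f j \<in> MLP m" by (rule mlp_SucE[OF Suc.hyps h]) (rule that)
    \<comment> \<open>Perturbing the weights costs at most CARD('d) (|\<mu> 0| + c) \<tau> and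
      perturbing the units at most \<beta> \<tau>; the choice makes the sum e.\<close>
    define \<tau> where "\<tau> = e / (real CARD('d) * (\<bar>\<mu> 0\<bar> + c) + \<beta>)"
    have den: "0 < real CARD('d) * (\<bar>\<mu> 0\<bar> + c) + \<beta>"
      using c \<beta>_pos by (intro add_nonneg_pos) auto
    have \<tau>: "0 < \<tau>" using e den by (simp add: \<tau>_def)
    have "v \<in> closure B" using B(3) h(2) by auto
    then obtain v' where v': "v' \<in> B" "dist v' v < \<tau>"
      using \<tau> unfolding closure_approachable by blast
    have "\<forall>j. \<exists>q\<in>Q. \<forall>x\<in>D. \<bar>f j x - q x\<bar> \<le> \<tau>" using dense[OF h(3) \<tau>] by blast
    then obtain q where q: "\<And>j. q j \<in> Q" "\<And>j x. x \<in> D \<Longrightarrow> \<bar>f j x - q j x\<bar> \<le> \<tau>" by metis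
    have "\<bar>h x - net (v', q) x\<bar> \<le> e" if x: "x \<in> D" for x
    proof -
      have "h x - net (v', q) x = (\<Sum>j\<in>UNIV. (v $ j - v' $ j) * \<mu> (f j x)) +
          (\<Sum>j\<in>UNIV. v' $ j * (\<mu> (f j x) - \<mu> (q j x)))"
        by (simp add: h net_def algebra_simps flip: sum.distrib sum_subtractf)
      also have "\<bar>\<dots>\<bar> \<le> \<bar>\<Sum>j\<in>UNIV. (v $ j - v' $ j) * \<mu> (f j x)\<bar> + \<bar>\<Sum>j\<in>UNIV. v' $ j * (\<mu> (f j x) - \<mu> (q j x))\<bar>"
        by (rule abs_triangle_ineq)
      also have "\<bar>\<Sum>j\<in>UNIV. (v $ j - v' $ j) * \<mu> (f j x)\<bar> \<le> (\<Sum>j\<in>(UNIV :: 'd set). \<tau> * (\<bar>\<mu> 0\<bar> + c))"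
      proof (rule order_trans[OF sum_abs], rule sum_mono)
        fix j
        have "\<bar>\<mu> (f j x)\<bar> \<le> \<bar>\<mu> 0\<bar> + c"
          using \<mu>_diff_le[of "f j x" 0] c(2)[OF h(3)[of j] x] by linarith
        moreover have "\<bar>v $ j - v' $ j\<bar> \<le> \<tau>"
          using component_le_norm_cart[of "v - v'" j] v'(2) by (simp add: dist_norm norm_minus_commute)
        ultimately show "\<bar>(v $ j - v' $ j) * \<mu> (f j x)\<bar> \<le> \<tau> * (\<bar>\<mu> 0\<bar> + c)"
          unfolding abs_mult using \<tau> by (intro mult_mono) auto
      qed
      also have "\<bar>\<Sum>j\<in>UNIV. v' $ j * (\<mu> (f j x) - \<mu> (q j x))\<bar> \<le> \<beta> * \<tau>"
      proof (rule sum_abs_mult_le)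
        show "(\<Sum>j\<in>UNIV. \<bar>v' $ j\<bar>) \<le> \<beta>" using v'(1) B(2) by auto
        show "\<bar>\<mu> (f j x) - \<mu> (q j x)\<bar> \<le> \<tau>" for j
          using \<mu>_diff_le[of "f j x" "q j x"] q(2)[OF x, of j] by linarith
      qed (use \<tau> in simp)
      also have "(\<Sum>j\<in>(UNIV :: 'd set). \<tau> * (\<bar>\<mu> 0\<bar> + c)) + \<beta> * \<tau> = \<tau> * (real CARD('d) * (\<bar>\<mu> 0\<bar> + c) + \<beta>)"
        by (simp add: algebra_simps)
      also have "\<dots> = e" using den by (simp add: \<tau>_def)
      finally show ?thesis by simp
    qed
    moreover have "net (v', q) \<in> Q'" using v'(1) q(1) by (auto simp: Q'_def)
    ultimately show "\<exists>q\<in>Q'. \<forall>x\<in>D. \<bar>h x - q x\<bar> \<le> e" by blast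
  qed
qed

text \<open>Uniform density controls both the sample values and the means, so one enumeration serves
  all samples.\<close>

lemma separating_family_mlp:
  fixes \<nu> :: "'t \<Rightarrow> (real ^ 'd) measure"
  assumes m: "1 \<le> m" and \<nu>: "\<And>t. prob_space (\<nu> t)" and sets_\<nu>: "\<And>t. sets (\<nu> t) = sets (restrict_space borel D)"
  shows "\<exists>\<gamma>. separating_family (restrict_space borel D) (MLP m) I \<nu> \<gamma>"
proof -
  let ?X = "restrict_space borel D"
  obtain Q where Q: "Q \<subseteq> MLP m" "countable Q"
    and dense: "\<And>h e. h \<in> MLP m \<Longrightarrow> 0 < e \<Longrightarrow> \<exists>q\<in>Q. \<forall>x\<in>D. \<bar>h x - q x\<bar> \<le> e"
    using mlp_countable_dense[OF m] by blast
  have "Q \<noteq> {}" using mlp_zero[OF m] dense[OF _ zero_less_one] by blast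
  then have mem: "from_nat_into Q i \<in> Q" for i by (rule from_nat_into)
  have sp: "space (\<nu> t) = D" for t
    using sets_eq_imp_space_eq[OF sets_\<nu>[of t]] by (simp add: space_restrict_space)
  have meas: "h \<in> borel_measurable (\<nu> t)" if "h \<in> MLP m" for h t
    using mlp_measurable[OF m that] by (simp add: measurable_cong_sets[OF sets_\<nu> refl])
  have "separating_family ?X (MLP m) I \<nu> (\<lambda>i _. from_nat_into Q i)"
    unfolding separating_family_def
  proof (intro conjI allI ballI impI)
    fix i
    have "from_nat_into Q i \<in> borel_measurable ?X"
      using mem Q(1) by (intro mlp_measurable[OF m]) auto
    from measurable_compose[OF measurable_snd this]
    show "(\<lambda>(x, y). from_nat_into Q i y) \<in> borel_measurable (PiM I \<nu> \<Otimes>\<^sub>M ?X)"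
      by (simp add: case_prod_beta')
    show "from_nat_into Q i \<in> MLP m" using mem Q(1) by auto
  next
    fix x :: "'t \<Rightarrow> real ^ 'd" and h and e :: real
    assume x: "x \<in> space (PiM I \<nu>)" and h: "h \<in> MLP m" and e: "0 < e"
    from dense[OF h e] obtain q where q: "q \<in> Q" "\<And>x. x \<in> D \<Longrightarrow> \<bar>h x - q x\<bar> \<le> e" by blast
    from from_nat_into_surj[OF Q(2) q(1)] obtain i where i: "from_nat_into Q i = q" by blast
    have q': "\<bar>q y - h y\<bar> \<le> e" if "y \<in> D" for y using q(2)[OF that] by (simp add: abs_minus_commute)
    have qm: "q \<in> MLP m" using q Q by auto
    have "(\<integral>y. \<bar>q y - h y\<bar> \<partial>\<nu> t) \<le> e" for t
    proof (rule prob_space.integral_le_const[OF \<nu> _ AE_I2])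
      show "integrable (\<nu> t) (\<lambda>y. \<bar>q y - h y\<bar>)"
      proof (rule finite_measure.integrable_const_bound)
        show "finite_measure (\<nu> t)" using \<nu> by (rule prob_space.finite_measure)
        show "AE y in \<nu> t. norm \<bar>q y - h y\<bar> \<le> e" using q' by (intro AE_I2) (simp add: sp)
      qed (use meas[OF qm] meas[OF h] in simp)
    qed (use q' sp in auto)
    moreover have "\<bar>q (x t) - h (x t)\<bar> \<le> e" if "t \<in> I" for t
      using x that sp by (intro q') (auto simp: space_PiM)
    ultimately show "\<exists>i. \<forall>t\<in>I. \<bar>from_nat_into Q i (x t) - h (x t)\<bar> \<le> e \<and>
        (\<integral>y. \<bar>from_nat_into Q i y - h y\<bar> \<partial>\<nu> t) \<le> e"
      using i by (intro exI[of _ i]) simp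
  qed
  then show ?thesis by blast
qed

text \<open>The linear layer contributes \<alpha> \<beta> by Cauchy-Schwarz. Each further layer
  costs 2 \<beta>: the factor \<beta> reduces it to one unit, the factor 2 removes the absolute
  value, and contraction then drops the activation at no cost. The weights are arbitrary because
  masked weights are inserted later.\<close>

lemma rademacher_mlp_le:
  assumes m: "1 \<le> m" and I: "finite I" and x: "\<And>t. t \<in> I \<Longrightarrow> x t \<in> D" and \<alpha>: "0 \<le> \<alpha>"
  shows "rademacher I (MLP m) (\<lambda>t h. a t * h (x t)) \<le>
    \<alpha> * \<beta> * (2 * \<beta>) ^ (m - 1) * sqrt (\<Sum>t\<in>I. (a t)\<^sup>2)"
  using m
proof (induction m rule: nat_induct_at_least)
  case base
  define mm where "mm s t = (a s *\<^sub>R x s) \<bullet> (a t *\<^sub>R x t)" for s t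
  define v where "v A = (\<Sum>t\<in>I. (rsign A t * a t) *\<^sub>R x t)" for A
  have vv: "(\<Sum>s\<in>I. \<Sum>t\<in>I. rsign A s * rsign A t * mm s t) = (norm (v A))\<^sup>2" for A
    unfolding power2_norm_eq_inner v_def mm_def
    by (simp add: inner_sum_left inner_sum_right sum_distrib_left mult_ac inner_commute)
  have "rademacher I (MLP 1) (\<lambda>t h. a t * h (x t)) \<le> \<beta> * sqrt (\<Sum>t\<in>I. mm t t)"
  proof (rule rademacher_le_quadratic[where m=mm, OF I])
    show "MLP 1 \<noteq> {}" using mlp_zero[of 1] by auto
    show "0 \<le> \<beta>" using \<beta>_pos by simp
    show "0 \<le> (\<Sum>s\<in>I. \<Sum>t\<in>I. rsign A s * rsign A t * mm s t)" for A by (simp add: vv)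
  next
    fix A h assume "h \<in> MLP 1"
    then obtain u where u: "h = (\<lambda>x. x \<bullet> u)" "norm u \<le> \<beta>" by auto
    have "(\<Sum>t\<in>I. rsign A t * (a t * h (x t))) = v A \<bullet> u"
      by (simp add: u v_def inner_sum_left mult.assoc)
    also have "\<dots> \<le> norm (v A) * norm u" by (rule norm_cauchy_schwarz)
    also have "\<dots> \<le> norm (v A) * \<beta>" by (intro mult_left_mono u) simp
    finally show "(\<Sum>t\<in>I. rsign A t * (a t * h (x t))) \<le>
        \<beta> * sqrt (\<Sum>s\<in>I. \<Sum>t\<in>I. rsign A s * rsign A t * mm s t)"
      by (simp add: vv mult.commute[of _ \<beta>])
  qed
  also have "(\<Sum>t\<in>I. mm t t) \<le> \<alpha>\<^sup>2 * (\<Sum>t\<in>I. (a t)\<^sup>2)"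
    unfolding sum_distrib_left
  proof (rule sum_mono)
    fix t assume t: "t \<in> I"
    have "(norm (x t))\<^sup>2 \<le> \<alpha>\<^sup>2" by (intro power_mono D_bound x t) simp
    then show "mm t t \<le> \<alpha>\<^sup>2 * (a t)\<^sup>2"
      using mult_right_mono[of "(norm (x t))\<^sup>2" "\<alpha>\<^sup>2" "(a t)\<^sup>2"]
      by (simp add: mm_def power2_eq_square[of "a t"] power2_norm_eq_inner mult_ac)
  qed
  then have "\<beta> * sqrt (\<Sum>t\<in>I. mm t t) \<le> \<beta> * sqrt (\<alpha>\<^sup>2 * (\<Sum>t\<in>I. (a t)\<^sup>2))"
    using \<beta>_pos by (intro mult_left_mono) auto
  also have "\<dots> = \<alpha> * \<beta> * (2 * \<beta>) ^ (1 - 1) * sqrt (\<Sum>t\<in>I. (a t)\<^sup>2)"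
    using \<alpha> by (simp add: real_sqrt_mult)
  finally show ?case by simp
next
  case (Suc m)
  let ?F = "MLP m"
  let ?S = "\<lambda>A f. \<Sum>t\<in>I. rsign A t * (a t * \<mu> (f (x t)))"
  obtain c where c: "\<And>h x. h \<in> ?F \<Longrightarrow> x \<in> D \<Longrightarrow> \<bar>h x\<bar> \<le> c"
    using mlp_bounded[OF Suc.hyps] by blast
  obtain z where z: "z \<in> ?F" "\<And>x. x \<in> D \<Longrightarrow> \<mu> (z x) = 0"
    using \<mu>_zero[OF Suc.hyps] by blast
  have bnd: "bounded_on ?F (\<lambda>f. a t * f (x t))" if "t \<in> I" for t
    using c x[OF that] by (intro bounded_on_cmult bounded_onI[of _ _ c])
  have bnd\<mu>: "bounded_on ?F (\<lambda>f. a t * \<mu> (f (x t)))" if "t \<in> I" for t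
  proof (intro bounded_on_cmult bounded_onI[of _ _ "\<bar>\<mu> 0\<bar> + c"])
    fix f assume "f \<in> ?F"
    then show "\<bar>\<mu> (f (x t))\<bar> \<le> \<bar>\<mu> 0\<bar> + c"
      using \<mu>_diff_le[of "f (x t)" 0] c[OF _ x[OF that], of f] by linarith
  qed
  have "rademacher I (MLP (Suc m)) (\<lambda>t h. a t * h (x t)) \<le>
      (\<Sum>A\<in>Pow I. \<beta> * (SUP f\<in>?F. \<bar>?S A f\<bar>)) / 2 ^ card I"
    unfolding rademacher_def
  proof (intro divide_right_mono sum_mono cSUP_least)
    show "MLP (Suc m) \<noteq> {}" using mlp_zero[of "Suc m"] by auto
    fix A h assume hm: "h \<in> MLP (Suc m)"
    obtain v :: "real ^ 'd" and f where h: "h = (\<lambda>x. \<Sum>j\<in>UNIV. v $ j * \<mu> (f j x))" "(\<Sum>j\<in>UNIV. \<bar>v $ j\<bar>) \<le> \<beta>"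
        "\<And>j. f j \<in> ?F"
      by (rule mlp_SucE[OF Suc.hyps hm]) (rule that)
    have up: "\<bar>?S A g\<bar> \<le> (SUP f\<in>?F. \<bar>?S A f\<bar>)" if "g \<in> ?F" for g
      using that by (intro cSUP_upper bounded_on_bdd_above_abs bounded_on_signed_sum bnd\<mu>)
    \<comment> \<open>After exchanging the sums, the expression is linear in the outer weights.
      These may be negative, which is why absolute values of the sums of single units
      appear.\<close>
    have "(\<Sum>t\<in>I. rsign A t * (a t * h (x t))) = (\<Sum>j\<in>UNIV. v $ j * ?S A (f j))"
      unfolding h sum_distrib_left by (subst sum.swap) (simp add: mult_ac)
    also have "\<dots> \<le> \<beta> * (SUP f\<in>?F. \<bar>?S A f\<bar>)"
      by (rule order_trans[OF abs_ge_self sum_abs_mult_le[OF h(2) up[OF h(3)]]])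
         (rule order_trans[OF abs_ge_zero up[OF z(1)]])
    finally show "(\<Sum>t\<in>I. rsign A t * (a t * h (x t))) \<le> \<beta> * (SUP f\<in>?F. \<bar>?S A f\<bar>)" .
  qed simp
  also have "\<dots> = \<beta> * ((\<Sum>A\<in>Pow I. SUP f\<in>?F. \<bar>?S A f\<bar>) / 2 ^ card I)"
    by (simp add: sum_distrib_left)
  also have "\<dots> \<le> \<beta> * (2 * rademacher I ?F (\<lambda>t f. a t * \<mu> (f (x t))))"
    using \<beta>_pos z x by (intro mult_left_mono rademacher_abs[OF I bnd\<mu> z(1)]) auto
  also have "\<dots> \<le> \<beta> * (2 * rademacher I ?F (\<lambda>t f. a t * f (x t)))"
  proof -
    have "rademacher I ?F (\<lambda>t f. a t * \<mu> (f (x t))) \<le> rademacher I ?F (\<lambda>t f. a t * f (x t))"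
      using z \<mu>_diff_le by (intro rademacher_contraction_scalar I bnd bnd\<mu>)
        (auto simp: abs_mult mult_left_mono simp flip: right_diff_distrib)
    then show ?thesis using \<beta>_pos by simp
  qed
  also have "\<dots> \<le> \<beta> * (2 * (\<alpha> * \<beta> * (2 * \<beta>) ^ (m - 1) * sqrt (\<Sum>t\<in>I. (a t)\<^sup>2)))"
    using \<beta>_pos Suc.IH by simp
  also have "\<dots> = \<alpha> * \<beta> * (2 * \<beta>) ^ (Suc m - 1) * sqrt (\<Sum>t\<in>I. (a t)\<^sup>2)"
    using Suc.hyps by (cases m) (auto simp: mult_ac)
  finally show ?case .
qed

end

section \<open>Risks of the noisy-label model\<close>

text \<open>The \<open>LEAST\<close> of a set of reals is meaningful only if the minimum is
  attained. The infimum of the common Lipschitz constants is itself one, because the defining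
  inequalities are not strict.\<close>

lemma lip_const_lipschitz:
  fixes l :: "real ^ 'c \<Rightarrow> 'c::finite \<Rightarrow> real"
  assumes "\<And>c. \<exists>L. L-lipschitz_on V (\<lambda>v. l v c)"
  shows "(lip_const V l)-lipschitz_on V (\<lambda>v. l v c)"
proof -
  let ?P = "\<lambda>L. \<forall>c. L-lipschitz_on V (\<lambda>v. l v c)"
  define L0 where "L0 = Inf (Collect ?P)"
  obtain L where L: "\<And>c. (L c)-lipschitz_on V (\<lambda>v. l v c)"
    using assms by metis
  \<comment> \<open>A common constant exists because there are finitely many labels.\<close>
  have "?P (\<Sum>c\<in>UNIV. L c)"
  proof
    fix c
    have "L c \<le> (\<Sum>c\<in>UNIV. L c)"
      using lipschitz_on_nonneg[OF L] by (intro member_le_sum) auto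
    then show "(\<Sum>c\<in>UNIV. L c)-lipschitz_on V (\<lambda>v. l v c)"
      by (rule lipschitz_on_le[OF L])
  qed
  then have ne: "Collect ?P \<noteq> {}" by blast
  have nn: "0 \<le> L" if "?P L" for L using that lipschitz_on_nonneg by blast
  then have bdd: "bdd_below (Collect ?P)" by (intro bdd_belowI2[of _ 0 id, simplified]) auto
  have "?P L0"
  proof
    fix c
    show "L0-lipschitz_on V (\<lambda>v. l v c)"
    proof (rule lipschitz_onI)
      show "0 \<le> L0" unfolding L0_def by (rule cInf_greatest[OF ne]) (use nn in auto)
      fix x y assume xy: "x \<in> V" "y \<in> V"
      show "dist (l x c) (l y c) \<le> L0 * dist x y"
      proof (cases "x = y")
        case False
        then have "dist (l x c) (l y c) / dist x y \<le> L0"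
          unfolding L0_def by (intro cInf_greatest[OF ne]) (use xy in \<open>auto simp: field_simps dest: lipschitz_onD\<close>)
        then show ?thesis using False by (simp add: field_simps)
      qed simp
    qed
  qed
  moreover have "L0 \<le> L" if "?P L" for L
    unfolding L0_def by (rule cInf_lower[OF _ bdd]) (use that in simp)
  ultimately have "lip_const V l = L0"
    unfolding lip_const_def by (rule Least_equality)
  with \<open>?P L0\<close> show ?thesis by simp
qed

context noisy_label_model
begin

abbreviation "noisy i \<equiv> noisy_law X P (T i)"
abbreviation "prior i c \<equiv> class_prior X P (T i) $ c"
abbreviation "conditional i c \<equiv> class_conditional X P (T i) c"
abbreviation "closs i \<equiv> composite_loss U \<psi> (forward_correction loss (T i))"
abbreviation "lip i \<equiv> lip_const V (closs i)"

section \<open>Class priors, conditional laws and the corrected risk\<close>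

lemma N_pos: "1 \<le> N"
  using w_sum by (cases N) auto

lemma sets_noisy: "sets (noisy i) = sets (X \<Otimes>\<^sub>M count_space UNIV)"
  by (simp add: noisy_law_def)

lemma space_noisy: "space (noisy i) = space X \<times> UNIV"
  using sets_eq_imp_space_eq[OF sets_noisy] by (simp add: space_pair_measure)

lemma slab_sets: "space X \<times> {c} \<in> sets (noisy i)"
  by (simp add: sets_noisy pair_measureI)

lemma prior_pos: "i \<in> {1..N} \<Longrightarrow> 0 < prior i c"
  using prior_interior by (auto simp: prob_simplex_interior_def)

lemma prior_sum: "i \<in> {1..N} \<Longrightarrow> (\<Sum>c\<in>UNIV. prior i c) = 1"
  using prior_interior by (auto simp: prob_simplex_interior_def)

lemma prior_le_1: "i \<in> {1..N} \<Longrightarrow> prior i c \<le> 1"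
  using member_le_sum[of c UNIV "\<lambda>c. prior i c"] prior_pos[of i] prior_sum[of i]
  by (simp add: less_imp_le)

text \<open>\<open>measure\<close> sends infinite mass to 0, so positivity of the prior already
  forces the slab to have finite mass. Finiteness of the noisy law follows from this, without
  computing with the matrix T.\<close>

lemma emeasure_slab:
  assumes "i \<in> {1..N}" shows "emeasure (noisy i) (space X \<times> {c}) = ennreal (prior i c)"
proof -
  have "measure (noisy i) (space X \<times> {c}) = prior i c" by (simp add: class_prior_def)
  with prior_pos[OF assms, of c] show ?thesis
    by (metis emeasure_eq_ennreal_measure less_irrefl measure_eq_0_null_sets
        infinity_ennreal_def measure_def enn2real_top)
qed

lemma noisy_finite:
  assumes i: "i \<in> {1..N}" shows "finite_measure (noisy i)"
proof
  have "emeasure (noisy i) (\<Union>c\<in>UNIV. space X \<times> {c}) = (\<Sum>c\<in>UNIV. emeasure (noisy i) (space X \<times> {c}))"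
    by (intro sum_emeasure[symmetric]) (auto simp: slab_sets disjoint_family_on_def)
  also have "(\<Union>c\<in>UNIV. space X \<times> {c}) = space (noisy i)" by (auto simp: space_noisy)
  finally show "emeasure (noisy i) (space (noisy i)) \<noteq> \<infinity>"
    by (simp add: emeasure_slab[OF i])
qed

lemma conditional_prob:
  assumes i: "i \<in> {1..N}" shows "prob_space (conditional i c)"
proof -
  have "prob_space (uniform_measure (noisy i) (space X \<times> {c}))"
    using emeasure_slab[OF i, of c] prior_pos[OF i, of c] by (intro prob_space_uniform_measure) auto
  moreover have "fst \<in> uniform_measure (noisy i) (space X \<times> {c}) \<rightarrow>\<^sub>M X"
    by (subst measurable_cong_sets[OF _ refl, of _ "X \<Otimes>\<^sub>M count_space UNIV"]) (simp_all add: sets_noisy)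
  ultimately show ?thesis
    unfolding class_conditional_def by (rule prob_space.prob_space_distr)
qed

lemma sets_conditional: "sets (conditional i c) = sets X"
  by (simp add: class_conditional_def)

lemma space_conditional: "space (conditional i c) = space X"
  by (simp add: class_conditional_def)

text \<open>Law of total expectation over the noisy label: the slabs partition the space, and the
  normalisation of each conditional law is cancelled by the prior.\<close>

lemma integral_noisy:
  fixes f :: "'x \<Rightarrow> 'c \<Rightarrow> real"
  assumes i: "i \<in> {1..N}" and f: "\<And>c. (\<lambda>x. f x c) \<in> borel_measurable X"
    and bound: "\<And>x c. x \<in> space X \<Longrightarrow> \<bar>f x c\<bar> \<le> b"
  shows "(\<integral>z. f (fst z) (snd z) \<partial>noisy i) = (\<Sum>c\<in>UNIV. prior i c * (\<integral>x. f x c \<partial>conditional i c))"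
proof -
  interpret finite_measure "noisy i" by (rule noisy_finite[OF i])
  have fst_m: "fst \<in> noisy i \<rightarrow>\<^sub>M X"
    by (subst measurable_cong_sets[OF sets_noisy refl]) simp
  have fm: "(\<lambda>z. f (fst z) c) \<in> borel_measurable (noisy i)" for c
    by (rule measurable_compose[OF fst_m f])
  let ?A = "\<lambda>c. space X \<times> {c}"
  have int: "integrable (noisy i) (\<lambda>z. indicator (?A c) z * f (fst z) c)" for c
    using fm slab_sets
    by (intro integrable_const_bound[of _ "\<bar>b\<bar>"] borel_measurable_times borel_measurable_indicator AE_I2)
       (auto simp: space_noisy abs_mult split: split_indicator intro: order_trans[OF bound abs_ge_self])
  have "prior i c * (\<integral>x. f x c \<partial>conditional i c) = (\<integral>z. indicator (?A c) z * f (fst z) c \<partial>noisy i)" for c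
  proof -
    have pos: "0 < prior i c" by (rule prior_pos[OF i])
    have unif: "uniform_measure (noisy i) (?A c) =
        density (noisy i) (\<lambda>z. ennreal (indicator (?A c) z / prior i c))"
      unfolding uniform_measure_def emeasure_slab[OF i]
      using pos by (intro arg_cong[where f="density (noisy i)"] ext)
        (auto simp: divide_ennreal[symmetric] split: split_indicator)
    have "(\<integral>x. f x c \<partial>conditional i c) = (\<integral>z. f (fst z) c \<partial>uniform_measure (noisy i) (?A c))"
      unfolding class_conditional_def using fst_m f
      by (intro integral_distr) (auto simp: measurable_cong_sets[OF sets_uniform_measure refl])
    also have "\<dots> = (\<integral>z. (indicator (?A c) z / prior i c) *\<^sub>R f (fst z) c \<partial>noisy i)"
      unfolding unif using pos slab_sets
      by (intro integral_density fm borel_measurable_divide borel_measurable_indicator) auto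
    also have "\<dots> = (\<integral>z. indicator (?A c) z * f (fst z) c / prior i c \<partial>noisy i)"
      by simp
    also have "\<dots> = (\<integral>z. indicator (?A c) z * f (fst z) c \<partial>noisy i) / prior i c"
      by (rule integral_divide_zero)
    finally show ?thesis using pos by simp
  qed
  then have "(\<Sum>c\<in>UNIV. prior i c * (\<integral>x. f x c \<partial>conditional i c)) =
      (\<integral>z. (\<Sum>c\<in>UNIV. indicator (?A c) z * f (fst z) c) \<partial>noisy i)"
    using int by (subst Bochner_Integration.integral_sum) simp_all
  also have "\<dots> = (\<integral>z. f (fst z) (snd z) \<partial>noisy i)"
  proof (rule Bochner_Integration.integral_cong[OF refl])
    fix z assume "z \<in> space (noisy i)"
    then obtain x c where z: "z = (x, c)" "x \<in> space X" by (auto simp: space_noisy)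
    have "(\<Sum>c'\<in>UNIV. indicator (?A c') z * f (fst z) c') = (\<Sum>c'\<in>UNIV. if c' = c then f x c' else 0)"
      using z by (intro sum.cong refl) (auto split: split_indicator)
    then show "(\<Sum>c'\<in>UNIV. indicator (?A c') z * f (fst z) c') = f (fst z) (snd z)"
      using z by simp
  qed
  finally show ?thesis by simp
qed

lemma closs_lipschitz: "i \<in> {1..N} \<Longrightarrow> (lip i)-lipschitz_on V (\<lambda>v. closs i v c)"
  by (rule lip_const_lipschitz) (rule composite_lipschitz)

lemma lip_nonneg: "i \<in> {1..N} \<Longrightarrow> 0 \<le> lip i"
  using lipschitz_on_nonneg[OF closs_lipschitz] by blast

lemma closs_diff_le:
  assumes i: "i \<in> {1..N}" and v: "v \<in> V" "v' \<in> V"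
  shows "\<bar>closs i v c - closs i v' c\<bar> \<le> lip i * norm (v - v')"
  using lipschitz_onD[OF closs_lipschitz[OF i] v] by (simp add: dist_norm)

text \<open>Measurability comes from Lipschitz continuity on V, the regularity assumed of the loss
  and the link together; hence the passage through the subspace V.\<close>

lemma closs_measurable:
  assumes i: "i \<in> {1..N}" and f: "f \<in> borel_measurable M'" and V: "\<And>x. x \<in> space M' \<Longrightarrow> f x \<in> V"
  shows "(\<lambda>x. closs i (f x) c) \<in> borel_measurable M'"
proof -
  have "(\<lambda>v. closs i v c) \<in> borel_measurable (restrict_space borel V)"
    by (rule borel_measurable_continuous_on_restrict[OF lipschitz_on_continuous_on[OF closs_lipschitz[OF i]]])
  moreover have "f \<in> M' \<rightarrow>\<^sub>M restrict_space borel V"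
    using V by (intro measurable_restrict_space2 f) auto
  ultimately show ?thesis by (rule measurable_compose[rotated])
qed

lemma zero_const_le: "\<bar>closs i 0 c\<bar> \<le> zero_const (closs i)"
  unfolding zero_const_def by (rule Max_ge) auto

lemma linked_mem_V: "g \<in> linked_predictors X U \<psi> \<Longrightarrow> x \<in> space X \<Longrightarrow> g x \<in> V"
  using bij_betwE[OF link_bij] by (auto simp: linked_predictors_def)

lemma corrected_risk_eq:
  "corrected_risk X loss P N w T (inv_into U \<psi> \<circ> g) =
    (\<Sum>i=1..N. w i * (\<integral>z. closs i (g (fst z)) (snd z) \<partial>noisy i))"
  by (simp add: corrected_risk_def risk_def composite_loss_def)

end

lemma borel_measurable_vecI:
  fixes f :: "'a \<Rightarrow> real ^ 'c::finite"
  assumes "\<And>c. (\<lambda>x. f x $ c) \<in> borel_measurable M"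
  shows "f \<in> borel_measurable M"
  using assms by (subst borel_measurable_euclidean_space) (auto simp: Basis_vec_def inner_axis)

section \<open>Deviation of the empirical risk\<close>

text \<open>Collects what the deviation argument uses of a scalar class, so that balls and
  perceptrons are two instances. The Rademacher bound is required for all real weights because the
  coordinate split after contraction sets some of them to 0.\<close>

locale sampled_copies = noisy_label_sample X P N T w loss U V \<psi> M n S
  for X :: "'x measure" and P :: "('x \<times> 'c::finite) measure" and N :: nat
    and T :: "nat \<Rightarrow> real ^ 'c ^ 'c" and w :: "nat \<Rightarrow> real" and loss :: "real ^ 'c \<Rightarrow> 'c \<Rightarrow> real"
    and U V :: "(real ^ 'c) set" and \<psi> :: "real ^ 'c \<Rightarrow> real ^ 'c" and M :: "'w measure"
    and n :: "nat \<Rightarrow> 'c \<Rightarrow> nat" and S :: "nat \<Rightarrow> 'c \<Rightarrow> nat \<Rightarrow> 'w \<Rightarrow> 'x" +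
  fixes F :: "('x \<Rightarrow> real) set" and A b :: real
  assumes F_measurable: "h \<in> F \<Longrightarrow> h \<in> borel_measurable X"
    and F_zero: "\<exists>z\<in>F. \<forall>x\<in>space X. z x = 0"
    and b_nonneg: "0 \<le> b"
    and F_rademacher: "finite I \<Longrightarrow> (\<And>t. t \<in> I \<Longrightarrow> y t \<in> space X) \<Longrightarrow>
      rademacher I F (\<lambda>t h. a t * h (y t)) \<le> b * sqrt (\<Sum>t\<in>I. (a t :: real)\<^sup>2)"
    and F_separating: "finite I \<Longrightarrow> (\<And>t :: nat \<times> 'c \<times> nat. prob_space (\<mu> t)) \<Longrightarrow>
      (\<And>t. sets (\<mu> t) = sets X) \<Longrightarrow> \<exists>\<gamma>. separating_family X F I \<mu> \<gamma>"
    and linked: "copies F \<subseteq> linked_predictors X U \<psi>"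
    and A_bound: "x \<in> space X \<Longrightarrow> g \<in> (copies F :: ('x \<Rightarrow> real ^ 'c) set) \<Longrightarrow> norm (g x) \<le> A"
begin

abbreviation "G \<equiv> copies F :: ('x \<Rightarrow> real ^ 'c) set"

definition samples :: "(nat \<times> 'c \<times> nat) set" where
  "samples = (SIGMA i:{1..N}. SIGMA c:UNIV. {1..n i c})"

text \<open>The default index 1 makes this a probability measure for every t, also outside the
  sample, as the product measures require of the whole family.\<close>

definition law :: "nat \<times> 'c \<times> nat \<Rightarrow> 'x measure" where
  "law = (\<lambda>(i, c, j). conditional (if i \<in> {1..N} then i else 1) c)"

definition coeff :: "nat \<times> 'c \<times> nat \<Rightarrow> real" where
  "coeff = (\<lambda>(i, c, j). w i * prior i c / real (n i c))"

definition lossval :: "nat \<times> 'c \<times> nat \<Rightarrow> real ^ 'c \<Rightarrow> real" where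
  "lossval = (\<lambda>(i, c, j) v. closs i v c)"

text \<open>Subtracting the loss at 0 does not change deviations and makes the class contain an
  element on which all terms vanish.\<close>

definition summand :: "nat \<times> 'c \<times> nat \<Rightarrow> ('x \<Rightarrow> real ^ 'c) \<Rightarrow> 'x \<Rightarrow> real" where
  "summand t g x = coeff t * (lossval t (g x) - lossval t 0)"

definition lip_max :: real where "lip_max = Max (lip ` {1..N})"

definition loss_max :: real where
  "loss_max = Max ((\<lambda>i. lip i * A + zero_const (closs i)) ` {1..N})"

definition weight :: real where
  "weight = (\<Sum>i=1..N. \<Sum>c\<in>UNIV. (w i)\<^sup>2 / real (n i c))"

section \<open>The loss along the sample\<close>

lemma finite_samples: "finite samples"
  by (simp add: samples_def)

lemma sum_samples:
  "(\<Sum>t\<in>samples. f t) = (\<Sum>i=1..N. \<Sum>c\<in>UNIV. \<Sum>j=1..n i c. f (i, c, j))"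
  by (simp add: samples_def sum.Sigma)

lemma samplesD: "(i, c, j) \<in> samples \<Longrightarrow> i \<in> {1..N} \<and> j \<in> {1..n i c}"
  by (simp add: samples_def)

lemma samples_nonempty: "samples \<noteq> {}"
proof -
  have "(1, c, 1) \<in> samples" for c using N_pos n_pos[of 1 c] by (simp add: samples_def Suc_le_eq)
  then show ?thesis by blast
qed

lemma law_prob: "prob_space (law t)"
  using N_pos by (cases t) (simp add: law_def conditional_prob)

lemma sets_law: "sets (law t) = sets X"
  by (cases t) (simp add: law_def sets_conditional)

lemma space_law: "space (law t) = space X"
  using sets_law by (rule sets_eq_imp_space_eq)

lemma space_X_nonempty: "space X \<noteq> {}"
  using prob_space.not_empty[OF law_prob] by (simp add: space_law)

lemma coeff_nonneg: "t \<in> samples \<Longrightarrow> 0 \<le> coeff t"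
  using samplesD prior_pos w_nonneg by (cases t) (auto simp: coeff_def less_imp_le)

lemma zero_mem: obtains z where "z \<in> G" "\<And>x. x \<in> space X \<Longrightarrow> z x = 0"
proof -
  obtain z where z: "z \<in> F" "\<forall>x\<in>space X. z x = 0" using F_zero by blast
  show thesis
    by (rule that[of "\<lambda>x. \<chi> c. z x"]) (use z in \<open>auto simp: copies_def vec_eq_iff\<close>)
qed

text \<open>The zero function belongs to the class and is linked, so its value lies in V. Only then
  does the Lipschitz bound on V compare a loss with the loss at 0.\<close>

lemma zero_V: "0 \<in> V"
proof -
  obtain z where z: "z \<in> G" "\<And>x. x \<in> space X \<Longrightarrow> z x = 0" by (rule zero_mem) blast
  obtain x where x: "x \<in> space X" using space_X_nonempty by blast
  have "z x \<in> V" using linked z(1) by (intro linked_mem_V x) blast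
  then show ?thesis by (simp add: z(2)[OF x])
qed

lemma G_mem_V: "g \<in> G \<Longrightarrow> x \<in> space X \<Longrightarrow> g x \<in> V"
  using linked linked_mem_V by blast

lemma G_measurable: "g \<in> G \<Longrightarrow> g \<in> borel_measurable X"
  by (intro borel_measurable_vecI F_measurable) (simp add: copies_def)

lemma lip_le_max: "i \<in> {1..N} \<Longrightarrow> lip i \<le> lip_max"
  unfolding lip_max_def by (rule Max_ge) auto

lemma lip_max_nonneg: "0 \<le> lip_max"
  using lip_le_max[of 1] lip_nonneg[of 1] N_pos by simp

lemma le_loss_max: "i \<in> {1..N} \<Longrightarrow> lip i * A + zero_const (closs i) \<le> loss_max"
  unfolding loss_max_def by (rule Max_ge) auto

lemma abs_closs_le:
  assumes i: "i \<in> {1..N}" and g: "g \<in> G" and x: "x \<in> space X"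
  shows "\<bar>closs i (g x) c\<bar> \<le> loss_max"
proof -
  have "\<bar>closs i (g x) c - closs i 0 c\<bar> \<le> lip i * norm (g x)"
    using closs_diff_le[OF i G_mem_V[OF g x] zero_V] by simp
  also have "\<dots> \<le> lip i * A"
    by (intro mult_left_mono A_bound lip_nonneg i g x)
  finally show ?thesis
    using le_loss_max[OF i] zero_const_le[of i c] by linarith
qed

lemma abs_lossval_le: "t \<in> samples \<Longrightarrow> g \<in> G \<Longrightarrow> x \<in> space X \<Longrightarrow> \<bar>lossval t (g x)\<bar> \<le> loss_max"
  using abs_closs_le samplesD by (cases t) (auto simp: lossval_def)

lemma loss_max_nonneg: "0 \<le> loss_max"
proof -
  obtain z where z: "z \<in> G" "\<And>x. x \<in> space X \<Longrightarrow> z x = 0" by (rule zero_mem) blast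
  obtain x where x: "x \<in> space X" using space_X_nonempty by blast
  have "1 \<in> {1..N}" using N_pos by simp
  from abs_closs_le[OF this z(1) x] show ?thesis by (rule order_trans[OF abs_ge_zero])
qed

lemma lossval_diff_le:
  assumes t: "t \<in> samples" and v: "v \<in> V" "v' \<in> V"
  shows "\<bar>lossval t v - lossval t v'\<bar> \<le> lip_max * (\<Sum>c\<in>UNIV. \<bar>v $ c - v' $ c\<bar>)"
proof -
  obtain i c j where tt: "t = (i, c, j)" by (cases t)
  have i: "i \<in> {1..N}" using samplesD t tt by blast
  have "\<bar>lossval t v - lossval t v'\<bar> \<le> lip i * norm (v - v')"
    using closs_diff_le[OF i v] by (simp add: lossval_def tt)
  \<comment> \<open>The contraction principle is phrased for the l1 distance, which dominates the
    2-norm.\<close>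
  also have "\<dots> \<le> lip_max * (\<Sum>c\<in>UNIV. \<bar>v $ c - v' $ c\<bar>)"
    using norm_le_l1_cart[of "v - v'"] by (intro mult_mono lip_le_max i lip_max_nonneg) auto
  finally show ?thesis .
qed

lemma lossval_measurable:
  assumes t: "t \<in> samples" and f: "f \<in> borel_measurable M'" and V: "\<And>x. x \<in> space M' \<Longrightarrow> f x \<in> V"
  shows "(\<lambda>x. lossval t (f x)) \<in> borel_measurable M'"
  using closs_measurable[OF _ f V] samplesD t by (cases t) (simp add: lossval_def)

lemma lossval_measurable_law:
  "t \<in> samples \<Longrightarrow> g \<in> G \<Longrightarrow> (\<lambda>x. lossval t (g x)) \<in> borel_measurable X"
  by (intro lossval_measurable G_measurable G_mem_V)

lemma lossval_integrable:
  assumes "t \<in> samples" "g \<in> G" shows "integrable (law t) (\<lambda>x. lossval t (g x))"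
proof (rule finite_measure.integrable_const_bound)
  show "finite_measure (law t)" using law_prob by (rule prob_space.finite_measure)
  show "AE x in law t. norm (lossval t (g x)) \<le> loss_max"
    using abs_lossval_le[OF assms] by (intro AE_I2) (simp add: space_law)
  show "(\<lambda>x. lossval t (g x)) \<in> borel_measurable (law t)"
    using lossval_measurable_law[OF assms] by (simp add: measurable_cong_sets[OF sets_law refl])
qed

lemma empirical_risk_eq:
  "empirical_risk X U \<psi> loss P N w T n s g = (\<Sum>(i, c, j)\<in>samples. coeff (i, c, j) * lossval (i, c, j) (g (s i c j)))"
  by (simp add: empirical_risk_def sum_samples coeff_def lossval_def sum_distrib_left mult_ac)

text \<open>All \<open>n i c\<close> points of a cell have the same law, so summing their equal
  means cancels the division by \<open>n i c\<close> in \<open>coeff\<close>.\<close>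

lemma corrected_risk_eq_sum:
  assumes g: "g \<in> G"
  shows "corrected_risk X loss P N w T (inv_into U \<psi> \<circ> g) =
    (\<Sum>t\<in>samples. coeff t * (\<integral>x. lossval t (g x) \<partial>law t))"
proof -
  have "corrected_risk X loss P N w T (inv_into U \<psi> \<circ> g) =
      (\<Sum>i=1..N. w i * (\<Sum>c\<in>UNIV. prior i c * (\<integral>x. closs i (g x) c \<partial>conditional i c)))"
    unfolding corrected_risk_eq
  proof (intro sum.cong refl arg_cong2[where f="(*)"])
    fix i assume i: "i \<in> {1..N}"
    show "(\<integral>z. closs i (g (fst z)) (snd z) \<partial>noisy i) =
        (\<Sum>c\<in>UNIV. prior i c * (\<integral>x. closs i (g x) c \<partial>conditional i c))"
      by (rule integral_noisy[OF i closs_measurable[OF i G_measurable[OF g] G_mem_V[OF g]] abs_closs_le[OF i g]])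
  qed
  also have "\<dots> = (\<Sum>i=1..N. \<Sum>c\<in>UNIV. \<Sum>j=1..n i c. coeff (i, c, j) * (\<integral>x. lossval (i, c, j) (g x) \<partial>law (i, c, j)))"
    using n_pos by (intro sum.cong refl) (auto simp: sum_distrib_left coeff_def lossval_def law_def intro!: sum.cong)
  finally show ?thesis by (simp add: sum_samples)
qed

section \<open>The joint law of the sample\<close>

abbreviation sample :: "'w \<Rightarrow> nat \<times> 'c \<times> nat \<Rightarrow> 'x" where
  "sample \<omega> \<equiv> \<lambda>t\<in>samples. case t of (i, c, j) \<Rightarrow> S i c j \<omega>"

lemma S_indep': "indep_vars (\<lambda>_. X) (\<lambda>(i, c, j). S i c j) samples"
proof -
  have "{(i, c, j). i \<in> {1..N} \<and> j \<in> {1..n i c}} = samples" by (auto simp: samples_def)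
  with S_indep show ?thesis by simp
qed

lemma S_measurable: "(i, c, j) \<in> samples \<Longrightarrow> S i c j \<in> M \<rightarrow>\<^sub>M X"
  using S_indep' by (auto simp: indep_vars_def)

lemma S_distr': "(i, c, j) \<in> samples \<Longrightarrow> distr M X (S i c j) = law (i, c, j)"
  using samplesD[of i c j] S_distr by (auto simp: law_def)

lemma sample_measurable: "sample \<in> M \<rightarrow>\<^sub>M PiM samples law"
proof -
  have "sample \<in> M \<rightarrow>\<^sub>M PiM samples (\<lambda>_. X)"
    by (rule measurable_restrict) (auto split: prod.split intro: S_measurable)
  also have "M \<rightarrow>\<^sub>M PiM samples (\<lambda>_. X) = M \<rightarrow>\<^sub>M PiM samples law"
    by (intro measurable_cong_sets refl sets_PiM_cong sets_law[symmetric])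
  finally show ?thesis .
qed

text \<open>Independence in its product form; it transfers probabilities from M to the product
  measure, where concentration and symmetrisation take place.\<close>

lemma distr_sample: "distr M (PiM samples law) sample = PiM samples law"
proof -
  have "distr M (PiM samples (\<lambda>_. X)) (\<lambda>\<omega>. \<lambda>t\<in>samples. (case t of (i, c, j) \<Rightarrow> S i c j) \<omega>) =
      PiM samples (\<lambda>t. distr M X (case t of (i, c, j) \<Rightarrow> S i c j))"
    using S_indep' S_measurable samples_nonempty
    by (subst indep_vars_iff_distr_eq_PiM'[symmetric]) auto
  also have "\<dots> = PiM samples law"
    by (rule PiM_cong) (auto simp: S_distr')
  also have "(\<lambda>\<omega>. \<lambda>t\<in>samples. (case t of (i, c, j) \<Rightarrow> S i c j) \<omega>) = sample"
    by (auto simp: fun_eq_iff split: prod.split)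
  also have "distr M (PiM samples (\<lambda>_. X)) sample = distr M (PiM samples law) sample"
    by (intro distr_cong refl sets_PiM_cong sets_law[symmetric])
  finally show ?thesis .
qed

lemma expectation_empirical_risk:
  assumes g: "g \<in> G"
  shows "(\<integral>\<omega>. empirical_risk X U \<psi> loss P N w T n (\<lambda>i c j. S i c j \<omega>) g \<partial>M) =
    corrected_risk X loss P N w T (inv_into U \<psi> \<circ> g)"
proof -
  have S: "(\<integral>\<omega>. lossval (i, c, j) (g (S i c j \<omega>)) \<partial>M) = (\<integral>x. lossval (i, c, j) (g x) \<partial>law (i, c, j))"
    and int: "integrable M (\<lambda>\<omega>. lossval (i, c, j) (g (S i c j \<omega>)))"
    if t: "(i, c, j) \<in> samples" for i c j
  proof -
    note m = S_measurable[OF t] lossval_measurable_law[OF t g]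
    show "(\<integral>\<omega>. lossval (i, c, j) (g (S i c j \<omega>)) \<partial>M) = (\<integral>x. lossval (i, c, j) (g x) \<partial>law (i, c, j))"
      unfolding S_distr'[OF t, symmetric] by (rule integral_distr[OF m, symmetric])
    have "integrable (distr M X (S i c j)) (\<lambda>x. lossval (i, c, j) (g x))"
      unfolding S_distr'[OF t] by (rule lossval_integrable[OF t g])
    then show "integrable M (\<lambda>\<omega>. lossval (i, c, j) (g (S i c j \<omega>)))"
      by (simp add: integrable_distr_eq[OF m])
  qed
  have "(\<integral>\<omega>. empirical_risk X U \<psi> loss P N w T n (\<lambda>i c j. S i c j \<omega>) g \<partial>M) =
      (\<Sum>t\<in>samples. \<integral>\<omega>. (case t of (i, c, j) \<Rightarrow> coeff (i, c, j) * lossval (i, c, j) (g (S i c j \<omega>))) \<partial>M)"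
    unfolding empirical_risk_eq using int
    by (intro Bochner_Integration.integral_sum) (auto split: prod.split)
  also have "\<dots> = (\<Sum>t\<in>samples. coeff t * (\<integral>x. lossval t (g x) \<partial>law t))"
    using S by (intro sum.cong refl) (auto split: prod.split)
  finally show ?thesis by (simp add: corrected_risk_eq_sum[OF g])
qed

section \<open>Weights and Rademacher average of the composite class\<close>

lemma sum_coeff_square_le: "(\<Sum>t\<in>samples. (coeff t)\<^sup>2) \<le> weight"
  unfolding sum_samples weight_def
proof (intro sum_mono)
  fix i c assume i: "i \<in> {1..N}"
  have n: "0 < n i c" using n_pos[OF i] .
  have "(\<Sum>j=1..n i c. (coeff (i, c, j))\<^sup>2) = (w i)\<^sup>2 * (prior i c)\<^sup>2 / real (n i c)"
    using n by (simp add: coeff_def power2_eq_square)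
  \<comment> \<open>The priors disappear from the bound here, being at most 1.\<close>
  also have "\<dots> \<le> (w i)\<^sup>2 * 1 / real (n i c)"
    using prior_pos[OF i, of c] prior_le_1[OF i, of c]
    by (intro divide_right_mono mult_left_mono) (auto intro: power_le_one)
  finally show "(\<Sum>j=1..n i c. (coeff (i, c, j))\<^sup>2) \<le> (w i)\<^sup>2 / real (n i c)" by simp
qed

lemma weight_pos: "0 < weight"
proof -
  have "\<exists>i\<in>{1..N}. w i \<noteq> 0"
  proof (rule ccontr)
    assume "\<not> ?thesis"
    then have "(\<Sum>i=1..N. w i) = 0" by (intro sum.neutral) auto
    then show False using w_sum by simp
  qed
  then obtain i where i: "i \<in> {1..N}" "w i \<noteq> 0" by blast
  have "0 < (\<Sum>c\<in>UNIV. (w i)\<^sup>2 / real (n i c))"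
    using i n_pos[OF i(1)] by (intro sum_pos) auto
  also have "\<dots> \<le> weight"
    unfolding weight_def by (rule member_le_sum[OF i(1)]) (auto intro!: sum_nonneg)
  finally show ?thesis .
qed

lemma summand_bounded:
  assumes t: "t \<in> samples" and y: "y \<in> space X"
  shows "bounded_on G (\<lambda>g. summand t g y)"
  unfolding summand_def using abs_lossval_le[OF t _ y]
  by (intro bounded_on_cmult bounded_on_diff bounded_onI[of _ _ loss_max]
      bounded_onI[of _ _ "\<bar>lossval t 0\<bar>"]) auto

text \<open>Contraction leaves one coordinate \<open>\<kappa> t\<close> per sample point at the cost
  of a factor C. Grouping the points by that coordinate yields C scalar averages, bounded one by
  one, hence the square of C.\<close>

lemma rademacher_G_le:
  assumes x: "\<And>t. t \<in> samples \<Longrightarrow> x t \<in> space X"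
  shows "rademacher samples G (\<lambda>t g. summand t g (x t)) \<le> (real CARD('c))\<^sup>2 * lip_max * b * sqrt weight"
proof -
  let ?C = "real CARD('c)"
  obtain z where z: "z \<in> G" "\<And>x. x \<in> space X \<Longrightarrow> z x = 0" by (rule zero_mem) blast
  have bnd_coord: "bounded_on G (\<lambda>g. g (x t) $ c)" if t: "t \<in> samples" for t c
  proof (rule bounded_onI)
    fix g assume "g \<in> G"
    then show "\<bar>g (x t) $ c\<bar> \<le> A"
      using A_bound[OF x[OF t]] component_le_norm_cart[of "g (x t)" c] by fastforce
  qed
  have "\<exists>\<kappa>\<in>samples \<rightarrow> UNIV. rademacher samples G (\<lambda>t g. summand t g (x t)) \<le>
      rademacher samples G (\<lambda>t g. ?C * (coeff t * lip_max * g (x t) $ \<kappa> t))"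
  proof (rule rademacher_contraction)
    fix t g g' assume t: "t \<in> samples" and g: "g \<in> G" "g' \<in> G"
    have "\<bar>summand t g (x t) - summand t g' (x t)\<bar> = coeff t * \<bar>lossval t (g (x t)) - lossval t (g' (x t))\<bar>"
      using coeff_nonneg[OF t] by (simp add: summand_def abs_mult flip: right_diff_distrib)
    also have "\<dots> \<le> coeff t * (lip_max * (\<Sum>c\<in>UNIV. \<bar>g (x t) $ c - g' (x t) $ c\<bar>))"
      by (intro mult_left_mono lossval_diff_le t G_mem_V g x coeff_nonneg)
    also have "\<dots> = (\<Sum>c\<in>UNIV. \<bar>coeff t * lip_max * g (x t) $ c - coeff t * lip_max * g' (x t) $ c\<bar>)"
      using coeff_nonneg[OF t] lip_max_nonneg
      by (simp add: sum_distrib_left abs_mult mult.assoc flip: right_diff_distrib)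
    finally show "\<bar>summand t g (x t) - summand t g' (x t)\<bar> \<le>
        (\<Sum>c\<in>UNIV. \<bar>coeff t * lip_max * g (x t) $ c - coeff t * lip_max * g' (x t) $ c\<bar>)" .
  qed (use finite_samples z x summand_bounded bnd_coord in \<open>auto intro: bounded_on_cmult\<close>)
  then obtain \<kappa> where le: "rademacher samples G (\<lambda>t g. summand t g (x t)) \<le>
      rademacher samples G (\<lambda>t g. ?C * (coeff t * lip_max * g (x t) $ \<kappa> t))" by blast
  \<comment> \<open>The weights of the points whose selected coordinate is c; the mask turns the
    mixed sum into a sum over c of scalar sums on all of \<open>samples\<close>.\<close>
  define a where "a c t = (if \<kappa> t = c then ?C * lip_max * coeff t else 0)" for c t
  obtain z' where z': "z' \<in> F" using F_zero by blast
  have bndF: "bounded_on F (\<lambda>h. a c t * h (x t))" if t: "t \<in> samples" for c t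
  proof (intro bounded_on_cmult bounded_onI[of _ _ A])
    fix h assume h: "h \<in> F"
    \<comment> \<open>The vector with all coordinates equal to h belongs to G, so the bound A on G
      also bounds the scalar class.\<close>
    then have "(\<lambda>y. \<chi> c. h y) \<in> G" by (simp add: copies_def)
    then show "\<bar>h (x t)\<bar> \<le> A"
      using A_bound[OF x[OF t]] component_le_norm_cart[of "(\<chi> c. h (x t)) :: real ^ 'c" c] by fastforce
  qed
  have "rademacher samples G (\<lambda>t g. ?C * (coeff t * lip_max * g (x t) $ \<kappa> t)) \<le>
      (\<Sum>B\<in>Pow samples. \<Sum>c\<in>UNIV. SUP h\<in>F. \<Sum>t\<in>samples. rsign B t * (a c t * h (x t))) / 2 ^ card samples"
    unfolding rademacher_def
  proof (intro divide_right_mono sum_mono cSUP_least)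
    fix B g assume g: "g \<in> G"
    have "(\<Sum>t\<in>samples. rsign B t * (?C * (coeff t * lip_max * g (x t) $ \<kappa> t))) =
        (\<Sum>t\<in>samples. \<Sum>c\<in>UNIV. rsign B t * (a c t * g (x t) $ c))"
    proof (rule sum.cong[OF refl])
      fix t assume "t \<in> samples"
      have "rsign B t * (a c t * g (x t) $ c) =
          (if \<kappa> t = c then rsign B t * (?C * (coeff t * lip_max * g (x t) $ c)) else 0)" for c
        by (simp add: a_def mult_ac)
      then show "rsign B t * (?C * (coeff t * lip_max * g (x t) $ \<kappa> t)) =
          (\<Sum>c\<in>UNIV. rsign B t * (a c t * g (x t) $ c))"
        by (simp only:) simp
    qed
    also have "\<dots> = (\<Sum>c\<in>UNIV. \<Sum>t\<in>samples. rsign B t * (a c t * g (x t) $ c))"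
      by (rule sum.swap)
    also have "\<dots> \<le> (\<Sum>c\<in>UNIV. SUP h\<in>F. \<Sum>t\<in>samples. rsign B t * (a c t * h (x t)))"
    proof (rule sum_mono)
      fix c
      have "(\<lambda>y. g y $ c) \<in> F" using g by (simp add: copies_def)
      then show "(\<Sum>t\<in>samples. rsign B t * (a c t * g (x t) $ c)) \<le>
          (SUP h\<in>F. \<Sum>t\<in>samples. rsign B t * (a c t * h (x t)))"
        by (rule cSUP_upper[where f="\<lambda>h. \<Sum>t\<in>samples. rsign B t * (a c t * h (x t))",
              OF _ bounded_on_bdd_above[OF bounded_on_signed_sum[OF bndF]]])
    qed
    finally show "(\<Sum>t\<in>samples. rsign B t * (?C * (coeff t * lip_max * g (x t) $ \<kappa> t))) \<le>
        (\<Sum>c\<in>UNIV. SUP h\<in>F. \<Sum>t\<in>samples. rsign B t * (a c t * h (x t)))" .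
  qed (use z in auto)
  also have "\<dots> = (\<Sum>c\<in>UNIV. rademacher samples F (\<lambda>t h. a c t * h (x t)))"
    unfolding rademacher_def by (subst sum.swap) (simp add: sum_divide_distrib)
  also have "\<dots> \<le> (\<Sum>c\<in>(UNIV :: 'c set). b * (?C * lip_max * sqrt weight))"
  proof (rule sum_mono)
    fix c
    have "rademacher samples F (\<lambda>t h. a c t * h (x t)) \<le> b * sqrt (\<Sum>t\<in>samples. (a c t)\<^sup>2)"
      by (rule F_rademacher[OF finite_samples x])
    also have "\<dots> \<le> b * sqrt ((?C * lip_max)\<^sup>2 * weight)"
    proof (intro mult_left_mono b_nonneg real_sqrt_le_mono)
      have "(\<Sum>t\<in>samples. (a c t)\<^sup>2) \<le> (\<Sum>t\<in>samples. (?C * lip_max)\<^sup>2 * (coeff t)\<^sup>2)"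
        by (rule sum_mono) (simp add: a_def power_mult_distrib)
      also have "\<dots> \<le> (?C * lip_max)\<^sup>2 * weight"
        unfolding sum_distrib_left[symmetric] by (intro mult_left_mono sum_coeff_square_le) simp
      finally show "(\<Sum>t\<in>samples. (a c t)\<^sup>2) \<le> (?C * lip_max)\<^sup>2 * weight" .
    qed
    also have "\<dots> = b * (?C * lip_max * sqrt weight)"
      using lip_max_nonneg by (simp add: real_sqrt_mult)
    finally show "rademacher samples F (\<lambda>t h. a c t * h (x t)) \<le> b * (?C * lip_max * sqrt weight)" .
  qed
  finally show ?thesis using le by (simp add: power2_eq_square mult_ac)
qed

lemma rademacher_abs_G_le:
  assumes x: "\<And>t. t \<in> samples \<Longrightarrow> x t \<in> space X"
  shows "(\<Sum>B\<in>Pow samples. SUP g\<in>G. \<bar>\<Sum>t\<in>samples. rsign B t * summand t g (x t)\<bar>) / 2 ^ card samples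
    \<le> 2 * ((real CARD('c))\<^sup>2 * lip_max * b * sqrt weight)"
proof -
  obtain z where z: "z \<in> G" "\<And>x. x \<in> space X \<Longrightarrow> z x = 0" by (rule zero_mem) blast
  have "(\<Sum>B\<in>Pow samples. SUP g\<in>G. \<bar>\<Sum>t\<in>samples. rsign B t * summand t g (x t)\<bar>) / 2 ^ card samples
      \<le> 2 * rademacher samples G (\<lambda>t g. summand t g (x t))"
    by (rule rademacher_abs[OF finite_samples summand_bounded[OF _ x] z(1)]) (use z x in \<open>auto simp: summand_def\<close>)
  also have "\<dots> \<le> 2 * ((real CARD('c))\<^sup>2 * lip_max * b * sqrt weight)"
    using rademacher_G_le[OF x] by simp
  finally show ?thesis .
qed

section \<open>Countable approximation of the vector-valued class\<close>

definition combine :: "(nat \<Rightarrow> (nat \<times> 'c \<times> nat \<Rightarrow> 'x) \<Rightarrow> 'x \<Rightarrow> real) \<Rightarrow> ('c \<Rightarrow> nat) \<Rightarrow>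
    (nat \<times> 'c \<times> nat \<Rightarrow> 'x) \<Rightarrow> 'x \<Rightarrow> real ^ 'c" where
  "combine \<gamma> k x = (\<lambda>y. \<chi> c. \<gamma> (k c) x y)"

lemma combine_mem:
  assumes "separating_family X F samples law \<gamma>" "x \<in> space (PiM samples law)"
  shows "combine \<gamma> k x \<in> G"
proof -
  have "\<And>i. \<gamma> i x \<in> F" using assms unfolding separating_family_def by blast
  then show ?thesis by (simp add: copies_def combine_def)
qed

lemma combine_measurable:
  assumes "separating_family X F samples law \<gamma>"
  shows "(\<lambda>(x, y). combine \<gamma> k x y) \<in> borel_measurable (PiM samples law \<Otimes>\<^sub>M X)"
proof (rule borel_measurable_vecI)
  fix c
  have "(\<lambda>(x, y). \<gamma> (k c) x y) \<in> borel_measurable (PiM samples law \<Otimes>\<^sub>M X)"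
    using assms unfolding separating_family_def by blast
  then show "(\<lambda>z. (case z of (x, y) \<Rightarrow> combine \<gamma> k x y) $ c) \<in> borel_measurable (PiM samples law \<Otimes>\<^sub>M X)"
    by (simp add: combine_def case_prod_beta')
qed

text \<open>Every coordinate has its own index, so that the coordinates of a given g can be
  approximated independently. The index type \<open>'c \<Rightarrow> nat\<close> is still countable
  because there are finitely many labels.\<close>

lemma separable_process_combine:
  assumes \<gamma>: "separating_family X F samples law \<gamma>"
  shows "separable_process samples law G summand (combine \<gamma>) (\<lambda>t. 2 * loss_max * coeff t)"
proof (rule separable_process.intro)
  show "finite samples" by (rule finite_samples)
next
  show "prob_space (law t)" for t by (rule law_prob)
next
  fix t g assume t: "t \<in> samples" and g: "g \<in> G"
  show "summand t g \<in> borel_measurable (law t)"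
    unfolding summand_def[abs_def] measurable_cong_sets[OF sets_law refl]
    by (intro borel_measurable_times borel_measurable_diff borel_measurable_const lossval_measurable_law t g)
next
  fix t g y assume t: "t \<in> samples" and g: "g \<in> G" and "y \<in> space (law t)"
  then have y: "y \<in> space X" by (simp add: space_law)
  obtain z where z: "z \<in> G" "\<And>x. x \<in> space X \<Longrightarrow> z x = 0" by (rule zero_mem) blast
  have "\<bar>lossval t (g y) - lossval t 0\<bar> \<le> 2 * loss_max"
    using abs_lossval_le[OF t g y] abs_lossval_le[OF t z(1) y] by (simp add: z(2)[OF y])
  then show "\<bar>summand t g y\<bar> \<le> 2 * loss_max * coeff t"
    using mult_left_mono[of "\<bar>lossval t (g y) - lossval t 0\<bar>" "2 * loss_max" "coeff t"] coeff_nonneg[OF t]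
    by (simp add: summand_def abs_mult mult.commute)
next
  fix x k assume "x \<in> space (PiM samples law)"
  then show "combine \<gamma> k x \<in> G"
    by (rule combine_mem[OF \<gamma>])
next
  fix t k assume t: "t \<in> samples"
  have m: "(\<lambda>(x, y). combine \<gamma> k x y) \<in> borel_measurable (PiM samples law \<Otimes>\<^sub>M X)"
    by (rule combine_measurable[OF \<gamma>])
  have "(\<lambda>z. lossval t (case z of (x, y) \<Rightarrow> combine \<gamma> k x y)) \<in> borel_measurable (PiM samples law \<Otimes>\<^sub>M X)"
  proof (rule lossval_measurable[OF t m])
    fix z assume "z \<in> space (PiM samples law \<Otimes>\<^sub>M X)"
    then obtain x y where z: "z = (x, y)" "x \<in> space (PiM samples law)" "y \<in> space X"
      by (auto simp: space_pair_measure)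
    from G_mem_V[OF combine_mem[OF \<gamma> z(2)] z(3)] show "(case z of (x, y) \<Rightarrow> combine \<gamma> k x y) \<in> V" by (simp add: z(1))
  qed
  then have "(\<lambda>(x, y). summand t (combine \<gamma> k x) y) \<in> borel_measurable (PiM samples law \<Otimes>\<^sub>M X)"
    unfolding summand_def case_prod_beta'
    by (intro borel_measurable_times borel_measurable_diff borel_measurable_const)
  also have "borel_measurable (PiM samples law \<Otimes>\<^sub>M X) = borel_measurable (PiM samples law \<Otimes>\<^sub>M law t)"
    by (rule measurable_cong_sets[OF sets_pair_measure_cong[OF refl sets_law[symmetric]] refl])
  finally show "(\<lambda>(x, y). summand t (combine \<gamma> k x) y) \<in> borel_measurable (PiM samples law \<Otimes>\<^sub>M law t)" .
qed


lemma deviation_eq: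
  assumes \<gamma>: "separating_family X F samples law \<gamma>" and g: "g \<in> G"
  shows "separable_process.deviation samples law summand g x =
    (\<Sum>t\<in>samples. coeff t * lossval t (g (x t))) - (\<Sum>t\<in>samples. coeff t * (\<integral>y. lossval t (g y) \<partial>law t))"
proof -
  interpret process: separable_process samples law G summand "combine \<gamma>" "\<lambda>t. 2 * loss_max * coeff t"
    by (rule separable_process_combine[OF \<gamma>])
  have "(\<integral>y. summand t g y \<partial>law t) = coeff t * ((\<integral>y. lossval t (g y) \<partial>law t) - lossval t 0)"
    if t: "t \<in> samples" for t
  proof -
    have "(\<integral>y. summand t g y \<partial>law t) = coeff t * (\<integral>y. lossval t (g y) - lossval t 0 \<partial>law t)"
      unfolding summand_def by (rule integral_mult_right_zero)
    also have "(\<integral>y. lossval t (g y) - lossval t 0 \<partial>law t) = (\<integral>y. lossval t (g y) \<partial>law t) - (\<integral>y. lossval t 0 \<partial>law t)"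
      by (rule Bochner_Integration.integral_diff[OF lossval_integrable[OF t g]])
         (simp add: finite_measure.integrable_const prob_space.finite_measure law_prob)
    finally show ?thesis by (simp add: prob_space.prob_space[OF law_prob])
  qed
  then show ?thesis
    unfolding process.deviation_def sum_subtractf[symmetric]
    by (intro sum.cong refl) (simp only:, simp add: summand_def algebra_simps)
qed

text \<open>The loss is Lipschitz in the l1 distance, so closeness of the coordinates at the sample
  points controls the empirical part and closeness in L1 controls the means.\<close>

lemma combine_approximates:
  assumes \<gamma>: "separating_family X F samples law \<gamma>" and g: "g \<in> G"
    and x: "x \<in> space (PiM samples law)" and e: "0 < e"
  shows "\<exists>k. \<bar>separable_process.deviation samples law summand g x\<bar> \<le>
    \<bar>separable_process.deviation samples law summand (combine \<gamma> k x) x\<bar> + e"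
proof -
  \<comment> \<open>The total error is q times the coordinate error d; the factor 2 counts the value
    and the mean. Dividing by q + 1 in the choice of d covers q = 0.\<close>
  define q where "q = 2 * real CARD('c) * lip_max * (\<Sum>t\<in>samples. coeff t)"
  have q: "0 \<le> q" unfolding q_def using lip_max_nonneg coeff_nonneg by (intro mult_nonneg_nonneg sum_nonneg) auto
  define d where "d = e / (q + 1)"
  have d: "0 < d" using e q by (simp add: d_def)
  have "\<exists>i. \<forall>t\<in>samples. \<bar>\<gamma> i x (x t) - g (x t) $ c\<bar> \<le> d \<and> (\<integral>y. \<bar>\<gamma> i x y - g y $ c\<bar> \<partial>law t) \<le> d" for c
  proof -
    have "(\<lambda>y. g y $ c) \<in> F" using g by (simp add: copies_def)
    from separating_familyD[OF \<gamma> x this d] show ?thesis .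
  qed
  then have "\<exists>k. \<forall>c. \<forall>t\<in>samples. \<bar>\<gamma> (k c) x (x t) - g (x t) $ c\<bar> \<le> d \<and>
      (\<integral>y. \<bar>\<gamma> (k c) x y - g y $ c\<bar> \<partial>law t) \<le> d"
    by (intro choice allI)
  then obtain k where k: "\<And>c t. t \<in> samples \<Longrightarrow> \<bar>\<gamma> (k c) x (x t) - g (x t) $ c\<bar> \<le> d"
      "\<And>c t. t \<in> samples \<Longrightarrow> (\<integral>y. \<bar>\<gamma> (k c) x y - g y $ c\<bar> \<partial>law t) \<le> d"
    by blast
  let ?h = "combine \<gamma> k x"
  have h: "?h \<in> G" by (rule combine_mem[OF \<gamma> x])
  let ?D = "\<lambda>t y. lossval t (g y) - lossval t (?h y)"
  have pointwise: "\<bar>?D t y\<bar> \<le> lip_max * (\<Sum>c\<in>UNIV. \<bar>\<gamma> (k c) x y - g y $ c\<bar>)"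
    if t: "t \<in> samples" and y: "y \<in> space X" for t y
    using lossval_diff_le[OF t G_mem_V[OF g y] G_mem_V[OF h y]]
    by (simp add: combine_def abs_minus_commute)
  have at_sample: "\<bar>?D t (x t)\<bar> \<le> lip_max * (real CARD('c) * d)" if t: "t \<in> samples" for t
  proof -
    have "x t \<in> space X" using x t by (auto simp: space_PiM space_law)
    then have "\<bar>?D t (x t)\<bar> \<le> lip_max * (\<Sum>c\<in>UNIV. \<bar>\<gamma> (k c) x (x t) - g (x t) $ c\<bar>)" by (rule pointwise[OF t])
    also have "\<dots> \<le> lip_max * (\<Sum>c\<in>(UNIV :: 'c set). d)"
      by (intro mult_left_mono sum_mono k t lip_max_nonneg)
    finally show ?thesis by simp
  qed
  have in_mean: "\<bar>(\<integral>y. lossval t (g y) \<partial>law t) - (\<integral>y. lossval t (?h y) \<partial>law t)\<bar> \<le> lip_max * (real CARD('c) * d)"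
    if t: "t \<in> samples" for t
  proof -
    have int: "integrable (law t) (\<lambda>y. \<bar>\<gamma> (k c) x y - g y $ c\<bar>)" for c
    proof (rule finite_measure.integrable_const_bound)
      show "finite_measure (law t)" using law_prob by (rule prob_space.finite_measure)
      have "\<bar>?h y $ c - g y $ c\<bar> \<le> 2 * A" if y: "y \<in> space X" for y
        using A_bound[OF y g] A_bound[OF y h] component_le_norm_cart[of "g y" c] component_le_norm_cart[of "?h y" c]
        by linarith
      then show "AE y in law t. norm \<bar>\<gamma> (k c) x y - g y $ c\<bar> \<le> 2 * A"
        by (intro AE_I2) (simp add: space_law combine_def)
      have "(\<lambda>y. ?h y $ c) \<in> F" "(\<lambda>y. g y $ c) \<in> F" using g h by (simp_all add: copies_def)
      then have "(\<lambda>y. \<bar>?h y $ c - g y $ c\<bar>) \<in> borel_measurable X"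
        by (intro borel_measurable_abs borel_measurable_diff F_measurable)
      then show "(\<lambda>y. \<bar>\<gamma> (k c) x y - g y $ c\<bar>) \<in> borel_measurable (law t)"
        by (simp add: measurable_cong_sets[OF sets_law refl] combine_def)
    qed
    have "(\<integral>y. lossval t (g y) \<partial>law t) - (\<integral>y. lossval t (?h y) \<partial>law t) = (\<integral>y. ?D t y \<partial>law t)"
      by (intro Bochner_Integration.integral_diff[symmetric] lossval_integrable t g h)
    also have "\<bar>\<dots>\<bar> \<le> (\<integral>y. \<bar>?D t y\<bar> \<partial>law t)" by (rule integral_abs_bound)
    also have "\<dots> \<le> (\<integral>y. lip_max * (\<Sum>c\<in>UNIV. \<bar>\<gamma> (k c) x y - g y $ c\<bar>) \<partial>law t)"
    proof (rule integral_mono)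
      show "integrable (law t) (\<lambda>y. \<bar>?D t y\<bar>)"
        by (intro integrable_abs Bochner_Integration.integrable_diff lossval_integrable t g h)
      show "integrable (law t) (\<lambda>y. lip_max * (\<Sum>c\<in>UNIV. \<bar>\<gamma> (k c) x y - g y $ c\<bar>))"
        by (intro integrable_mult_right Bochner_Integration.integrable_sum int)
    qed (simp add: space_law pointwise t)
    also have "\<dots> = lip_max * (\<Sum>c\<in>UNIV. \<integral>y. \<bar>\<gamma> (k c) x y - g y $ c\<bar> \<partial>law t)"
      by (subst integral_mult_right_zero, subst Bochner_Integration.integral_sum) (simp_all add: int)
    also have "\<dots> \<le> lip_max * (\<Sum>c\<in>(UNIV :: 'c set). d)"
      by (intro mult_left_mono sum_mono k t lip_max_nonneg)
    finally show ?thesis by simp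
  qed
  let ?dev = "separable_process.deviation samples law summand"
  let ?E = "\<lambda>t. (\<integral>y. lossval t (g y) \<partial>law t) - (\<integral>y. lossval t (?h y) \<partial>law t)"
  have eq: "?dev g x - ?dev ?h x = (\<Sum>t\<in>samples. coeff t * (?D t (x t) - ?E t))"
    unfolding deviation_eq[OF \<gamma> g] deviation_eq[OF \<gamma> h]
    unfolding sum_subtractf[symmetric] by (intro sum.cong refl) (simp add: algebra_simps)
  have "\<bar>\<Sum>t\<in>samples. coeff t * (?D t (x t) - ?E t)\<bar> \<le> (\<Sum>t\<in>samples. coeff t * (2 * (lip_max * (real CARD('c) * d))))"
  proof (rule order_trans[OF sum_abs], rule sum_mono)
    fix t assume t: "t \<in> samples"
    show "\<bar>coeff t * (?D t (x t) - ?E t)\<bar> \<le> coeff t * (2 * (lip_max * (real CARD('c) * d)))"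
    proof -
      have "\<bar>?D t (x t) - ?E t\<bar> \<le> 2 * (lip_max * (real CARD('c) * d))"
        using order_trans[OF abs_triangle_ineq4 add_mono[OF at_sample[OF t] in_mean[OF t]]]
        by (simp only: mult_2)
      from mult_left_mono[OF this coeff_nonneg[OF t]] show ?thesis
        by (simp only: abs_mult abs_of_nonneg[OF coeff_nonneg[OF t]])
    qed
  qed
  also have "\<dots> = q * d"
    unfolding sum_distrib_right[symmetric] by (simp add: q_def)
  also have "\<dots> \<le> (q + 1) * d" using d by (simp add: algebra_simps)
  also have "\<dots> = e" using q by (simp add: d_def)
  finally have "\<bar>?dev g x - ?dev ?h x\<bar> \<le> e" by (simp only: eq)
  then have "\<bar>?dev g x\<bar> \<le> \<bar>?dev ?h x\<bar> + e" by linarith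
  then show ?thesis by (intro exI[of _ k])
qed

text \<open>The bound is s + 2 r. Here r bounds the Rademacher average with absolute values, so 2 r
  bounds the mean of the supremum after symmetrisation, and s is the margin for McDiarmid's
  inequality.\<close>

theorem uniform_deviation_bound:
  assumes \<delta>: "0 < \<delta>" "\<delta> \<le> 1"
  shows "with_prob_at_least M (1 - \<delta>) (\<lambda>\<omega>.
      (SUP g\<in>G. ereal \<bar>empirical_risk X U \<psi> loss P N w T n (\<lambda>i c j. S i c j \<omega>) g -
                     corrected_risk X loss P N w T (inv_into U \<psi> \<circ> g)\<bar>)
      \<le> ereal (deviation_bound U V \<psi> loss N w T n A (4 * real CARD('c) * b) \<delta>))"
proof -
  obtain \<gamma> where \<gamma>: "separating_family X F samples law \<gamma>"
    using F_separating[where \<mu>=law, OF finite_samples law_prob sets_law] by blast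
  interpret process: separable_process samples law G summand "combine \<gamma>" "\<lambda>t. 2 * loss_max * coeff t"
    by (rule separable_process_combine[OF \<gamma>])
  define r where "r = 2 * ((real CARD('c))\<^sup>2 * lip_max * b * sqrt weight)"
  define s where "s = loss_max * sqrt (2 * ln (2 / \<delta>)) * sqrt weight"
  have r: "0 \<le> r" unfolding r_def using lip_max_nonneg b_nonneg weight_pos by simp
  have log: "0 < ln (2 / \<delta>)" using \<delta> by simp
  have bound: "deviation_bound U V \<psi> loss N w T n A (4 * real CARD('c) * b) \<delta> = s + 2 * r"
    unfolding deviation_bound_def Let_def loss_max_def[symmetric] lip_max_def[symmetric] weight_def[symmetric]
    by (simp add: s_def r_def algebra_simps power2_eq_square)
  have dev: "empirical_risk X U \<psi> loss P N w T n (\<lambda>i c j. S i c j \<omega>) g -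
      corrected_risk X loss P N w T (inv_into U \<psi> \<circ> g) = process.deviation g (sample \<omega>)"
    if g: "g \<in> G" for g \<omega>
    unfolding deviation_eq[OF \<gamma> g] corrected_risk_eq_sum[OF g] empirical_risk_eq
    by (intro arg_cong2[where f="(-)"] refl sum.cong) (auto split: prod.split)
  have sup: "(SUP g\<in>G. ereal \<bar>empirical_risk X U \<psi> loss P N w T n (\<lambda>i c j. S i c j \<omega>) g -
      corrected_risk X loss P N w T (inv_into U \<psi> \<circ> g)\<bar>) \<le> ereal (s + 2 * r)"
    if \<omega>: "\<omega> \<in> space M" and le: "process.sup_deviation (sample \<omega>) \<le> 2 * r + s" for \<omega>
  proof (rule SUP_least)
    fix g assume g: "g \<in> G"
    have x: "sample \<omega> \<in> space (PiM samples law)"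
      by (rule measurable_space[OF sample_measurable \<omega>])
    have "\<bar>process.deviation g (sample \<omega>)\<bar> \<le> process.sup_deviation (sample \<omega>)"
      by (rule process.abs_deviation_le_sup[OF x combine_approximates[OF \<gamma> g x]])
    with le show "ereal \<bar>empirical_risk X U \<psi> loss P N w T n (\<lambda>i c j. S i c j \<omega>) g -
        corrected_risk X loss P N w T (inv_into U \<psi> \<circ> g)\<bar> \<le> ereal (s + 2 * r)"
      unfolding dev[OF g] by simp
  qed
  let ?bad = "{x \<in> space (PiM samples law). 2 * r + s < process.sup_deviation x}"
  have bad: "?bad \<in> sets (PiM samples law)"
    using process.sup_deviation_measurable by measurable
  have small: "measure (PiM samples law) ?bad \<le> \<delta>"
  \<comment> \<open>McDiarmid's inequality needs a positive margin and variance proxy. If all losses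
    vanish there is no deviation, and the bad event is empty.\<close>
  proof (cases "loss_max = 0")
    case True
    have "\<not> 2 * r + s < process.sup_deviation x" if "x \<in> space (PiM samples law)" for x
      using process.sup_deviation_bound[OF that] True r by (simp add: s_def)
    then have "?bad = {}" by blast
    then show ?thesis using \<delta> by (simp only: measure_empty)
  next
    case False
    then have pos: "0 < loss_max" using loss_max_nonneg by simp
    \<comment> \<open>One point changes a deviation by at most 2 \<open>loss_max\<close> times its
      coefficient; the squares of these sum to at most 4 \<open>loss_max\<close> squared times
      \<open>weight\<close>.\<close>
    have "measure (PiM samples law) ?bad \<le> exp (- 2 * s\<^sup>2 / (4 * loss_max\<^sup>2 * weight))"
    proof (rule process.sup_deviation_concentration[where c="\<lambda>t. 2 * loss_max * coeff t"])
      fix x assume "x \<in> space (PiM samples law)"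
      then show "(\<Sum>B\<in>Pow samples. SUP g\<in>G. \<bar>\<Sum>t\<in>samples. rsign B t * summand t g (x t)\<bar>) / 2 ^ card samples \<le> r"
        unfolding r_def by (intro rademacher_abs_G_le) (auto simp: space_PiM space_law)
    next
      fix g x and e :: real assume "g \<in> G" "x \<in> space (PiM samples law)" "0 < e"
      then show "\<exists>k. \<bar>process.deviation g x\<bar> \<le> \<bar>process.deviation (combine \<gamma> k x) x\<bar> + e"
        by (rule combine_approximates[OF \<gamma>])
    next
      fix t g y y' assume t: "t \<in> samples" and g: "g \<in> G" and "y \<in> space (law t)" "y' \<in> space (law t)"
      then have y: "y \<in> space X" "y' \<in> space X" by (simp_all add: space_law)
      have "\<bar>summand t g y - summand t g y'\<bar> = coeff t * \<bar>lossval t (g y) - lossval t (g y')\<bar>"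
        using coeff_nonneg[OF t] by (simp add: summand_def abs_mult flip: right_diff_distrib)
      also have "\<dots> \<le> coeff t * (2 * loss_max)"
        using abs_lossval_le[OF t g y(1)] abs_lossval_le[OF t g y(2)]
        by (intro mult_left_mono coeff_nonneg t) linarith
      finally show "\<bar>summand t g y - summand t g y'\<bar> \<le> 2 * loss_max * coeff t" by (simp add: mult_ac)
    next
      have "(\<Sum>t\<in>samples. (2 * loss_max * coeff t)\<^sup>2) = 4 * loss_max\<^sup>2 * (\<Sum>t\<in>samples. (coeff t)\<^sup>2)"
        by (simp add: power_mult_distrib sum_distrib_left)
      also have "\<dots> \<le> 4 * loss_max\<^sup>2 * weight"
        by (intro mult_left_mono sum_coeff_square_le) simp
      finally show "(\<Sum>t\<in>samples. (2 * loss_max * coeff t)\<^sup>2) \<le> 4 * loss_max\<^sup>2 * weight" .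
      show "0 < 4 * loss_max\<^sup>2 * weight" using pos weight_pos by simp
      show "0 < s" unfolding s_def using pos weight_pos log by simp
    qed
    moreover have "s\<^sup>2 = 2 * ln (2 / \<delta>) * (loss_max\<^sup>2 * weight)"
      using weight_pos log by (simp add: s_def power_mult_distrib)
    then have "- 2 * s\<^sup>2 / (4 * loss_max\<^sup>2 * weight) = - ln (2 / \<delta>)"
      using pos weight_pos by (simp add: field_simps)
    \<comment> \<open>The tail is \<delta>/2. The supremum is already over absolute values, so only
      its upper tail has to be bounded.\<close>
    moreover have "exp (- ln (2 / \<delta>)) \<le> \<delta>" using \<delta> by (simp add: exp_minus)
    ultimately show ?thesis by simp
  qed
  \<comment> \<open>The event is defined by the countable supremum and is therefore measurable; the
    bound for the whole class holds on it.\<close>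
  define E where "E = {\<omega> \<in> space M. process.sup_deviation (sample \<omega>) \<le> 2 * r + s}"
  have sd_m: "(\<lambda>\<omega>. process.sup_deviation (sample \<omega>)) \<in> borel_measurable M"
    by (rule measurable_compose[OF sample_measurable process.sup_deviation_measurable])
  have E: "E \<in> sets M" unfolding E_def using sd_m by measurable
  have "sample -` ?bad \<inter> space M = space M - E"
  proof (rule set_eqI)
    fix \<omega>
    show "\<omega> \<in> sample -` ?bad \<inter> space M \<longleftrightarrow> \<omega> \<in> space M - E"
      using measurable_space[OF sample_measurable, of \<omega>]
      by (simp only: E_def Int_iff Diff_iff vimage_eq mem_Collect_eq de_Morgan_conj not_le) blast
  qed
  then have "prob (space M - E) = measure (distr M (PiM samples law) sample) ?bad"
    using measure_distr[OF sample_measurable bad] by (simp only:)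
  also have "\<dots> \<le> \<delta>" unfolding distr_sample by (rule small)
  finally have "1 - \<delta> \<le> prob E" using prob_compl[OF E] by simp
  then show ?thesis
    unfolding with_prob_at_least_def bound using E sup by (intro bexI[OF _ E]) (auto simp: E_def)
qed

end

section \<open>The bound for the two function classes\<close>

lemma (in noisy_label_model) space_nonempty: "space X \<noteq> {}"
  using prob_space.not_empty[OF conditional_prob[of 1]] N_pos by (simp add: space_conditional)

theorem theorem11:
  shows
    "(\<forall>(X :: 'x measure) k H ip K R.
        rkhs (space X) k H ip \<and>
        (\<lambda>(x, y). k x y) \<in> borel_measurable (X \<Otimes>\<^sub>M X) \<and>
        (\<forall>x\<in>space X. fun_norm ip (kernel_section (space X) k x) \<le> K) \<and>
        0 \<le> R \<longrightarrow>
        (let G = (copies (rkhs_ball H ip R) :: ('x \<Rightarrow> real ^ 'c::finite) set) in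
         \<exists>B. \<forall>P N T w loss U V \<psi> (M :: 'w measure) n S A.
           noisy_label_sample X P N T w loss U V \<psi> M n S \<and>
           G \<subseteq> linked_predictors X U \<psi> \<and>
           (\<forall>x\<in>space X. \<forall>g\<in>G. norm (g x) \<le> A) \<longrightarrow>
             (\<forall>g\<in>G. corrected_risk X loss P N w T (inv_into U \<psi> \<circ> g) =
                (\<integral>\<omega>. empirical_risk X U \<psi> loss P N w T n (\<lambda>i c j. S i c j \<omega>) g \<partial>M)) \<and>
             (\<forall>\<delta>. 0 < \<delta> \<and> \<delta> \<le> 1 \<longrightarrow>
                with_prob_at_least M (1 - \<delta>) (\<lambda>\<omega>.
                  (SUP g\<in>G. ereal \<bar>empirical_risk X U \<psi> loss P N w T n (\<lambda>i c j. S i c j \<omega>) g -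
                                 corrected_risk X loss P N w T (inv_into U \<psi> \<circ> g)\<bar>)
                  \<le> ereal (deviation_bound U V \<psi> loss N w T n A B \<delta>)))))
   \<and>
     (\<forall>(D :: (real ^ 'd) set) \<alpha> \<beta> \<mu> m.
        (\<forall>x\<in>D. norm x \<le> \<alpha>) \<and>
        0 < \<beta> \<and>
        1-lipschitz_on UNIV \<mu> \<and>
        (\<forall>m'\<ge>1. \<exists>h\<in>mlp \<beta> \<mu> m'. \<forall>x\<in>D. \<mu> (h x) = 0) \<and>
        1 \<le> m \<longrightarrow>
        (let X = restrict_space borel D;
             G = (copies (mlp \<beta> \<mu> m) :: (real ^ 'd \<Rightarrow> real ^ 'c) set) in
         \<exists>B. \<forall>P N T w loss U V \<psi> (M :: 'w measure) n S A.
           noisy_label_sample X P N T w loss U V \<psi> M n S \<and>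
           G \<subseteq> linked_predictors X U \<psi> \<and>
           (\<forall>x\<in>space X. \<forall>g\<in>G. norm (g x) \<le> A) \<longrightarrow>
             (\<forall>g\<in>G. corrected_risk X loss P N w T (inv_into U \<psi> \<circ> g) =
                (\<integral>\<omega>. empirical_risk X U \<psi> loss P N w T n (\<lambda>i c j. S i c j \<omega>) g \<partial>M)) \<and>
             (\<forall>\<delta>. 0 < \<delta> \<and> \<delta> \<le> 1 \<longrightarrow>
                with_prob_at_least M (1 - \<delta>) (\<lambda>\<omega>.
                  (SUP g\<in>G. ereal \<bar>empirical_risk X U \<psi> loss P N w T n (\<lambda>i c j. S i c j \<omega>) g -
                                 corrected_risk X loss P N w T (inv_into U \<psi> \<circ> g)\<bar>)
                  \<le> ereal (deviation_bound U V \<psi> loss N w T n A B \<delta>)))))"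
proof (intro conjI allI impI, goal_cases)
  case (1 X k H ip K R)
  interpret bounded_rkhs X k H ip K
    using 1 by (intro bounded_rkhs.intro bounded_rkhs_axioms.intro) auto
  have R: "0 \<le> R" using 1 by simp
  show ?case
    unfolding Let_def
  \<comment> \<open>B is fixed before the distribution, the matrices, the loss and the sample; it
    combines the constant R K of \<open>rademacher_ball_le\<close> with the number of
    labels.\<close>
  proof (intro exI[of _ "4 * real CARD('c) * (R * K)"] allI impI, elim conjE, goal_cases)
    case (1 P N T w loss U V \<psi> M n S A)
    interpret noisy_label_sample X P N T w loss U V \<psi> M n S by (rule 1(1))
    \<comment> \<open>The bound K is known to be nonnegative once the space has a point, which the
      sampling model guarantees.\<close>
    obtain x0 where x0: "x0 \<in> space X" using space_nonempty by blast
    have K: "0 \<le> K"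
      using nrm_nonneg[OF section_mem[OF x0]] k_bound[OF x0] by simp
    interpret sampled_copies X P N T w loss U V \<psi> M n S "rkhs_ball H ip R" A "R * K"
    proof (intro sampled_copies.intro[OF 1(1)] sampled_copies_axioms.intro)
      show "\<exists>z\<in>rkhs_ball H ip R. \<forall>x\<in>space X. z x = 0"
        using zero_mem R by (intro bexI[of _ "\<lambda>_. 0"]) (auto simp: rkhs_ball_def fun_norm_def ip_zero)
      show "0 \<le> R * K" using R K by simp
      show "h \<in> borel_measurable X" if "h \<in> rkhs_ball H ip R" for h
        using that by (intro H_measurable) (simp add: rkhs_ball_def)
      show "norm (g x) \<le> A" if "x \<in> space X" "g \<in> copies (rkhs_ball H ip R)" for x and g :: "'x \<Rightarrow> real ^ 'c"
        using 1(3) that by blast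
    qed (use R K 1(2) in \<open>blast intro: rademacher_ball_le separating_family_ball\<close>)+
    show ?case using expectation_empirical_risk uniform_deviation_bound by simp
  qed
next
  case (2 D \<alpha> \<beta> \<mu> m)
  interpret bounded_mlp D \<alpha> \<beta> \<mu>
    using 2 by unfold_locales auto
  have m: "1 \<le> m" using 2 by simp
  \<comment> \<open>\<open>?b\<close> is the constant of \<open>rademacher_mlp_le\<close>: \<alpha>
    \<beta> for the linear layer and 2 \<beta> for each of the m - 1 others.\<close>
  let ?X = "restrict_space borel D" and ?b = "\<alpha> * \<beta> * (2 * \<beta>) ^ (m - 1)"
  show ?case
    unfolding Let_def
  proof (intro exI[of _ "4 * real CARD('c) * ?b"] allI impI, elim conjE, goal_cases)
    case (1 P N T w loss U V \<psi> M n S A)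
    interpret noisy_label_sample ?X P N T w loss U V \<psi> M n S by (rule 1(1))
    have sp: "space ?X = D" by (simp add: space_restrict_space)
    obtain x0 where x0: "x0 \<in> D" using space_nonempty unfolding sp by blast
    have \<alpha>: "0 \<le> \<alpha>" using order_trans[OF norm_ge_zero D_bound[OF x0]] .
    interpret sampled_copies ?X P N T w loss U V \<psi> M n S "mlp \<beta> \<mu> m" A ?b
    proof (intro sampled_copies.intro[OF 1(1)] sampled_copies_axioms.intro)
      show "\<exists>z\<in>mlp \<beta> \<mu> m. \<forall>x\<in>space ?X. z x = 0" using mlp_zero[OF m] by blast
      show "0 \<le> ?b" using \<alpha> \<beta>_pos by simp
      show "h \<in> borel_measurable ?X" if "h \<in> mlp \<beta> \<mu> m" for h by (rule mlp_measurable[OF m that])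
      show "norm (g x) \<le> A" if "x \<in> space ?X" "g \<in> copies (mlp \<beta> \<mu> m)" for x and g :: "real ^ 'd \<Rightarrow> real ^ 'c"
        using 1(3) that by blast
      show "rademacher I (mlp \<beta> \<mu> m) (\<lambda>t h. a t * h (y t)) \<le> ?b * sqrt (\<Sum>t\<in>I. (a t)\<^sup>2)"
        if "finite I" "\<And>t. t \<in> I \<Longrightarrow> y t \<in> space ?X" for I and y :: "nat \<times> 'c \<times> nat \<Rightarrow> real ^ 'd" and a
        using that unfolding sp by (intro rademacher_mlp_le m \<alpha>)
    qed (use 1(2) in \<open>blast intro: separating_family_mlp[OF m]\<close>)+
    show ?case using expectation_empirical_risk uniform_deviation_bound by simp
  qed
qed

end
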